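(* Let $R$ be a ring and let $(\mathcal{F},\mathcal{C})$ be a cotorsion theory of $R$-modules. Then $(\mathcal{F},\mathcal{C})$ is generated by a set if and only if the saturated pair $(\mathcal{F}\text{-}\mathrm{Mono},\ \mathcal{C}\text{-}\mathrm{Epi})$ in the category of $R$-modules is fibrantly generated.
   Context: A cotorsion theory is a pair $(\mathcal{F},\mathcal{C})$ of classes of $R$-modules such that $\mathcal{C}=\mathcal{F}^\perp=\{C\mid \mathrm{Ext}^1(F,C)=0\text{ for all }F\in\mathcal{F}\}$ and $\mathcal{F}={}^\perp\mathcal{C}=\{F\mid \mathrm{Ext}^1(F,C)=0\text{ for all }C\in\mathcal{C}\}$. It is generated by a set if there is a set $\mathcal{X}$ of $R$-modules with $\mathcal{F}={}^\perp\mathcal{X}$ (where ${}^\perp\mathcal{X}=\{F\mid\mathrm{Ext}^1(F,X)=0\text{ for all }X\in\mathcal{X}\}$). (Some literature calls this "cogenerated by a set".) $\mathcal{F}\text{-}\mathrm{Mono}$ is the class of monomorphisms whose cokernel is in $\mathcal{F}$, and $\mathcal{C}\text{-}\mathrm{Epi}$ is the class of epimorphisms whose kernel is in $\mathcal{C}$. For morphisms $f:A\to B$ and $g:C\to D$ write $f\,\square\, g$ if for every commutative square $g u = v f$ (with $u:A\to C$, $v:B\to D$) there is $d:B\to C$ with $d f=u$ and $g d=v$. For a class $\mathcal{X}$ of morphisms, $\mathcal{X}^\square=\{g\mid f\,\square\, g\text{ for all }f\in\mathcal{X}\}$ and ${}^\square\mathcal{X}=\{f\mid f\,\square\, g\text{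 for all }g\in\mathcal{X}\}$. A saturated pair is a pair $(\mathcal{L},\mathcal{R})$ of classes of morphisms with $\mathcal{R}=\mathcal{L}^\square$ and $\mathcal{L}={}^\square\mathcal{R}$; it is fibrantly generated if $\mathcal{L}={}^\square\mathcal{Y}$ for some set $\mathcal{Y}$ of morphisms. It is a known fact that $(\mathcal{F}\text{-}\mathrm{Mono},\mathcal{C}\text{-}\mathrm{Epi})$ is a saturated pair for every cotorsion theory $(\mathcal{F},\mathcal{C})$. *)

theory Defs
  imports "HOL-Algebra.Algebra" "HOL-Library.Equipollence"
begin

section \<open>Universe\<close>

text \<open>
  Classes and sets of modules are told apart by a Grothendieck universe: the carriers of the
  modules are subsets of a type \<open>'u\<close> whose cardinality is strongly inaccessible. They are small,
  that is, have fewer elements than \<open>'u\<close>. A family of modules or morphisms is a ``set'' if it is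
  small; arbitrary families are ``classes''.
\<close>

definition strongly_inaccessible :: "'u set \<Rightarrow> bool" where
  "strongly_inaccessible U \<longleftrightarrow>
     (UNIV :: nat set) \<prec> U \<and>
     (\<forall>A. A \<subseteq> U \<and> A \<prec> U \<longrightarrow> Pow A \<prec> U) \<and>
     (\<forall>\<A>. \<A> \<subseteq> Pow U \<and> \<A> \<prec> U \<and> (\<forall>A\<in>\<A>. A \<prec> U) \<longrightarrow> \<Union>\<A> \<prec> U)"


section \<open>Left modules over a ring\<close>

text \<open>
  The locale \<open>module\<close> of HOL-Algebra requires a commutative ring. As there, the fields
  \<open>mult\<close> and \<open>one\<close> of a module record carry no information.
\<close>

locale left_module = R?: ring R + M?: abelian_group M
  for R :: "'r ring" (structure) and M :: "('r, 'm) module" (structure) +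
  assumes smult_closed:
      "\<lbrakk>a \<in> carrier R; x \<in> carrier M\<rbrakk> \<Longrightarrow> a \<odot>\<^bsub>M\<^esub> x \<in> carrier M"
    and smult_l_distr:
      "\<lbrakk>a \<in> carrier R; b \<in> carrier R; x \<in> carrier M\<rbrakk> \<Longrightarrow>
        (a \<oplus> b) \<odot>\<^bsub>M\<^esub> x = a \<odot>\<^bsub>M\<^esub> x \<oplus>\<^bsub>M\<^esub> b \<odot>\<^bsub>M\<^esub> x"
    and smult_r_distr:
      "\<lbrakk>a \<in> carrier R; x \<in> carrier M; y \<in> carrier M\<rbrakk> \<Longrightarrow>
        a \<odot>\<^bsub>M\<^esub> (x \<oplus>\<^bsub>M\<^esub> y) = a \<odot>\<^bsub>M\<^esub> x \<oplus>\<^bsub>M\<^esub> a \<odot>\<^bsub>M\<^esub> y"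
    and smult_assoc1:
      "\<lbrakk>a \<in> carrier R; b \<in> carrier R; x \<in> carrier M\<rbrakk> \<Longrightarrow>
        (a \<otimes> b) \<odot>\<^bsub>M\<^esub> x = a \<odot>\<^bsub>M\<^esub> (b \<odot>\<^bsub>M\<^esub> x)"
    and smult_one:
      "x \<in> carrier M \<Longrightarrow> \<one> \<odot>\<^bsub>M\<^esub> x = x"

text \<open>Linear maps are extensional, so that equality of functions is equality of linear maps.\<close>

definition lin_maps :: "'r ring \<Rightarrow> ('r, 'm) module \<Rightarrow> ('r, 'n) module \<Rightarrow> ('m \<Rightarrow> 'n) set" where
  "lin_maps R M N =
     {h \<in> hom (add_monoid M) (add_monoid N) \<inter> extensional (carrier M).
        \<forall>r\<in>carrier R. \<forall>x\<in>carrier M. h (r \<odot>\<^bsub>M\<^esub> x) = r \<odot>\<^bsub>N\<^esub> h x}"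

definition module_iso :: "'r ring \<Rightarrow> ('r, 'm) module \<Rightarrow> ('r, 'n) module \<Rightarrow> bool" where
  "module_iso R M N \<longleftrightarrow> (\<exists>h\<in>lin_maps R M N. bij_betw h (carrier M) (carrier N))"

definition quot_module :: "('r, 'm) module \<Rightarrow> 'm set \<Rightarrow> ('r, 'm set) module" where
  "quot_module M S =
     \<lparr>carrier = a_rcosets\<^bsub>M\<^esub> S, monoid.mult = undefined, monoid.one = undefined,
      ring.zero = S, add = set_add M,
      smult = (\<lambda>r Y. (\<Union>y\<in>Y. S +>\<^bsub>M\<^esub> (r \<odot>\<^bsub>M\<^esub> y)))\<rparr>"


section \<open>The functor \<open>Ext\<^sup>1\<close>\<close>

text \<open>The free module on the underlying set of \<open>M\<close>: finitely supported functions to \<open>R\<close>.\<close>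

definition free_cover :: "'r ring \<Rightarrow> ('r, 'm) module \<Rightarrow> ('r, 'm \<Rightarrow> 'r) module" where
  "free_cover R M =
     \<lparr>carrier = {p. (\<forall>x. p x \<in> carrier R) \<and> (\<forall>x. x \<notin> carrier M \<longrightarrow> p x = \<zero>\<^bsub>R\<^esub>) \<and>
                    finite {x. p x \<noteq> \<zero>\<^bsub>R\<^esub>}},
      monoid.mult = undefined, monoid.one = undefined,
      ring.zero = (\<lambda>x. \<zero>\<^bsub>R\<^esub>), add = (\<lambda>p q x. p x \<oplus>\<^bsub>R\<^esub> q x),
      smult = (\<lambda>r p x. r \<otimes>\<^bsub>R\<^esub> p x)\<rparr>"

definition free_cover_map :: "'r ring \<Rightarrow> ('r, 'm) module \<Rightarrow> ('m \<Rightarrow> 'r) \<Rightarrow> 'm" where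
  "free_cover_map R M p = (\<Oplus>\<^bsub>M\<^esub>x\<in>{x. p x \<noteq> \<zero>\<^bsub>R\<^esub>}. p x \<odot>\<^bsub>M\<^esub> x)"

definition relation_module :: "'r ring \<Rightarrow> ('r, 'm) module \<Rightarrow> ('r, 'm \<Rightarrow> 'r) module" where
  "relation_module R M =
     (free_cover R M)\<lparr>carrier := a_kernel (free_cover R M) M (free_cover_map R M)\<rparr>"

definition Hom_group :: "'r ring \<Rightarrow> ('r, 'm) module \<Rightarrow> ('r, 'n) module \<Rightarrow> ('m \<Rightarrow> 'n) monoid" where
  "Hom_group R M N =
     \<lparr>carrier = lin_maps R M N,
      monoid.mult = (\<lambda>g h. \<lambda>x\<in>carrier M. g x \<oplus>\<^bsub>N\<^esub> h x),
      monoid.one = (\<lambda>x\<in>carrier M. \<zero>\<^bsub>N\<^esub>)\<rparr>"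

text \<open>
  With the free presentation \<open>0 \<rightarrow> K \<rightarrow> P \<rightarrow> M \<rightarrow> 0\<close> given by \<open>P = free_cover R M\<close> and
  \<open>K = relation_module R M\<close>, the group \<open>Ext\<^sup>1(M, N)\<close> is the cokernel of the restriction map
  \<open>Hom(P, N) \<rightarrow> Hom(K, N)\<close>.
\<close>

definition Ext1 ::
  "'r ring \<Rightarrow> ('r, 'm) module \<Rightarrow> ('r, 'n) module \<Rightarrow> (('m \<Rightarrow> 'r) \<Rightarrow> 'n) set monoid" where
  "Ext1 R M N =
     Hom_group R (relation_module R M) N Mod
       ((\<lambda>h. restrict h (carrier (relation_module R M))) ` lin_maps R (free_cover R M) N)"


section \<open>The category of modules\<close>

definition Modules :: "'r ring \<Rightarrow> ('r, 'u) module set" where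
  "Modules R = {M. left_module R M \<and> carrier M \<prec> (UNIV :: 'u set)}"

datatype ('r, 'u) morphism =
  Morphism (Dom: "('r, 'u) module") (Cod: "('r, 'u) module") (Map: "'u \<Rightarrow> 'u")

definition Morphisms :: "'r ring \<Rightarrow> ('r, 'u) morphism set" where
  "Morphisms R = {f. Dom f \<in> Modules R \<and> Cod f \<in> Modules R \<and> Map f \<in> lin_maps R (Dom f) (Cod f)}"


section \<open>Cotorsion theories\<close>

definition right_perp :: "'r ring \<Rightarrow> ('r, 'u) module set \<Rightarrow> ('r, 'u) module set" where
  "right_perp R \<F> = {C \<in> Modules R. \<forall>F\<in>\<F>. trivial_group (Ext1 R F C)}"

definition left_perp :: "'r ring \<Rightarrow> ('r, 'u) module set \<Rightarrow> ('r, 'u) module set" where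
  "left_perp R \<C> = {F \<in> Modules R. \<forall>C\<in>\<C>. trivial_group (Ext1 R F C)}"

definition cotorsion_theory ::
  "'r ring \<Rightarrow> ('r, 'u) module set \<Rightarrow> ('r, 'u) module set \<Rightarrow> bool" where
  "cotorsion_theory R \<F> \<C> \<longleftrightarrow> \<C> = right_perp R \<F> \<and> \<F> = left_perp R \<C>"

definition generated_by_set ::
  "'r ring \<Rightarrow> ('r, 'u) module set \<Rightarrow> ('r, 'u) module set \<Rightarrow> bool" where
  "generated_by_set R \<F> \<C> \<longleftrightarrow>
     cotorsion_theory R \<F> \<C> \<and>
     (\<exists>\<S>. \<S> \<subseteq> Modules R \<and> \<S> \<prec> (UNIV :: 'u set) \<and> \<F> = left_perp R \<S>)"


section \<open>Lifting properties and saturated pairs\<close>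

definition lifts_against :: "'r ring \<Rightarrow> ('r, 'u) morphism \<Rightarrow> ('r, 'u) morphism \<Rightarrow> bool" where
  "lifts_against R f g \<longleftrightarrow>
     (\<forall>u\<in>lin_maps R (Dom f) (Dom g). \<forall>v\<in>lin_maps R (Cod f) (Cod g).
        compose (carrier (Dom f)) (Map g) u = compose (carrier (Dom f)) v (Map f) \<longrightarrow>
        (\<exists>d\<in>lin_maps R (Cod f) (Dom g).
           compose (carrier (Dom f)) d (Map f) = u \<and>
           compose (carrier (Cod f)) (Map g) d = v))"

definition right_box :: "'r ring \<Rightarrow> ('r, 'u) morphism set \<Rightarrow> ('r, 'u) morphism set" where
  "right_box R \<S> = {g \<in> Morphisms R. \<forall>f\<in>\<S>. lifts_against R f g}"

definition left_box :: "'r ring \<Rightarrow> ('r, 'u) morphism set \<Rightarrow> ('r, 'u) morphism set" where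
  "left_box R \<S> = {f \<in> Morphisms R. \<forall>g\<in>\<S>. lifts_against R f g}"

definition saturated_pair ::
  "'r ring \<Rightarrow> ('r, 'u) morphism set \<Rightarrow> ('r, 'u) morphism set \<Rightarrow> bool" where
  "saturated_pair R \<L> \<R> \<longleftrightarrow> \<R> = right_box R \<L> \<and> \<L> = left_box R \<R>"

definition fibrantly_generated ::
  "'r ring \<Rightarrow> ('r, 'u) morphism set \<Rightarrow> ('r, 'u) morphism set \<Rightarrow> bool" where
  "fibrantly_generated R \<L> \<R> \<longleftrightarrow>
     saturated_pair R \<L> \<R> \<and>
     (\<exists>\<S>. \<S> \<subseteq> Morphisms R \<and> \<S> \<prec> (UNIV :: 'u set) \<and> \<L> = left_box R \<S>)"

text \<open>
  The kernel of a morphism is a submodule of its domain. The cokernel lives on a type of cosets,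
  so that it is only required to be isomorphic to a member of \<open>\<F>\<close>.
\<close>

definition F_Mono :: "'r ring \<Rightarrow> ('r, 'u) module set \<Rightarrow> ('r, 'u) morphism set" where
  "F_Mono R \<F> =
     {f \<in> Morphisms R. inj_on (Map f) (carrier (Dom f)) \<and>
        (\<exists>Q\<in>\<F>. module_iso R Q (quot_module (Cod f) (Map f ` carrier (Dom f))))}"

definition C_Epi :: "'r ring \<Rightarrow> ('r, 'u) module set \<Rightarrow> ('r, 'u) morphism set" where
  "C_Epi R \<C> =
     {g \<in> Morphisms R. Map g ` carrier (Dom g) = carrier (Cod g) \<and>
        (Dom g)\<lparr>carrier := a_kernel (Dom g) (Cod g) (Map g)\<rparr> \<in> \<C>}"

end

theory Submission
  imports Defs Complex_Main
begin

text \<open>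
  Both notions are tied together by a lifting criterion. Let \<open>f : A \<rightarrow> B\<close> be a monomorphism with
  cokernel \<open>Q\<close>, and \<open>g : D \<rightarrow> Y\<close> an epimorphism with kernel \<open>N\<close>. If \<open>Ext\<^sup>1(Q, N) = 0\<close>, then \<open>f\<close> lifts
  against \<open>g\<close> (\<open>lift_of_trivial_Ext1\<close>). There are two partial converses. If \<open>f\<close> is the inclusion of
  the relation module into a free cover of \<open>Q\<close>, then lifting against \<open>g\<close> extends maps from the relation
  module to \<open>N\<close>, so that \<open>Ext\<^sup>1(Q, N) = 0\<close> (\<open>right_box_F_Mono_kernel\<close>). If \<open>D\<close> is injective, then
  lifting \<open>f\<close> against \<open>g\<close> makes every map \<open>Q \<rightarrow> Y\<close> factor through \<open>g\<close>, and again \<open>Ext\<^sup>1(Q, N) = 0\<close>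
  (\<open>trivial_Ext1_of_lifts_against\<close>).

  For a cotorsion theory \<open>(\<F>, \<C>)\<close> this yields the saturated pair. The criterion itself says that
  \<open>\<F>\<close>-monomorphisms lift against \<open>\<C>\<close>-epimorphisms. The first converse, together with the maps \<open>0 \<rightarrow> P\<close>
  for \<open>P\<close> free, shows that whatever all \<open>\<F>\<close>-monomorphisms lift against is a \<open>\<C>\<close>-epimorphism. In the
  other direction, embed each \<open>C \<in> \<C>\<close> into an injective module \<open>J\<close> and choose an injective cogenerator \<open>E\<close>:
  a map that lifts against \<open>E \<rightarrow> 0\<close> is a monomorphism, and if it also lifts against every \<open>J \<rightarrow> J/C\<close>,
  its cokernel is in \<open>\<F>\<close> by the second converse.

  The last argument spends one map on each \<open>C\<close>, plus one. Hence if \<open>\<F>\<close> is the left orthogonal class of a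
  set \<open>\<S>\<close>, the maps \<open>J \<rightarrow> J/C\<close> for \<open>C \<in> \<S>\<close> and the map \<open>E \<rightarrow> 0\<close> are a set that generates the pair
  (\<open>test_maps_exist\<close>). Conversely, if a set of maps generates the pair, its members are
  \<open>\<C>\<close>-epimorphisms, and their kernels form a set \<open>\<S>\<close> of members of \<open>\<C>\<close>. If \<open>M\<close> is left orthogonal to \<open>\<S>\<close>,
  then \<open>0 \<rightarrow> M\<close> lifts against all generators by the criterion; hence it is an \<open>\<F>\<close>-monomorphism, and its
  cokernel \<open>M\<close> is in \<open>\<F>\<close>.

  The injective modules come from the multiplicative group of nonzero complex numbers. As it is divisible,
  characters with values in it extend from subgroups; as it contains roots of unity, they separate points.
  So additive maps from \<open>R\<close> to this group form an injective cogenerator, and its powers contain every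
  module. Free covers, quotients and powers are built on the types where they live naturally, and are moved
  to the universe along a bijection; inaccessibility ensures that they are small.
\<close>


section \<open>Small sets\<close>

text \<open>
  The closure properties of an inaccessible universe speak about its subsets; a small set of any
  type is first replaced by an equipotent one.
\<close>

lemma small_transfer:
  assumes "A \<prec> (UNIV :: 'u set)"
  obtains B :: "'u set" where "A \<approx> B" "B \<prec> (UNIV :: 'u set)"
proof -
  obtain f :: "_ \<Rightarrow> 'u" where f: "inj_on f A"
    using assms unfolding lesspoll_def lepoll_def by auto
  then have "A \<approx> f ` A"
    by (simp add: eqpoll_sym)
  moreover from this have "f ` A \<prec> (UNIV :: 'u set)"
    using assms eqpoll_sym eq_lesspoll_trans by blast
  ultimately show thesis ..
qed

lemma Pow_lepoll_mono:
  assumes "lepoll A B" shows "lepoll (Pow A) (Pow B)"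
proof -
  obtain f where "inj_on f A" "f ` A \<subseteq> B"
    using assms unfolding lepoll_def by auto
  then have "inj_on (image f) (Pow A)" "image f ` Pow A \<subseteq> Pow B"
    by (auto simp: inj_on_image_Pow)
  then show ?thesis
    unfolding lepoll_def by auto
qed

lemma small_Pow:
  assumes "strongly_inaccessible (UNIV :: 'u set)" and "A \<prec> (UNIV :: 'u set)"
  shows "Pow A \<prec> (UNIV :: 'u set)"
proof -
  obtain B :: "'u set" where B: "A \<approx> B" "B \<prec> (UNIV :: 'u set)"
    using small_transfer[OF assms(2)] .
  then have "Pow B \<prec> (UNIV :: 'u set)"
    using assms(1) unfolding strongly_inaccessible_def by blast
  then show ?thesis
    using Pow_lepoll_mono[OF eqpoll_imp_lepoll[OF B(1)]] lesspoll_trans1 by blast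
qed

lemma small_nat: "strongly_inaccessible (UNIV :: 'u set) \<Longrightarrow> (UNIV :: nat set) \<prec> (UNIV :: 'u set)"
  unfolding strongly_inaccessible_def by blast

lemma small_finite:
  assumes "strongly_inaccessible (UNIV :: 'u set)" and "finite A"
  shows "A \<prec> (UNIV :: 'u set)"
  by (rule finite_lesspoll_infinite[OF _ assms(2)])
     (use small_nat[OF assms(1)] infinite_le_lepoll lesspoll_imp_lepoll in blast)

lemma small_insert:
  assumes inacc: "strongly_inaccessible (UNIV :: 'u set)" and "A \<prec> (UNIV :: 'u set)"
  shows "insert a A \<prec> (UNIV :: 'u set)"
proof (cases "finite A")
  case False
  then show ?thesis
    using infinite_insert_eqpoll[of A a] assms(2) eq_lesspoll_trans by blast
qed (simp add: small_finite[OF inacc])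

lemma card_of_Times_ordLeq:
  assumes "infinite A" "B \<noteq> {}" "ordLeq3 (card_of B) (card_of A)"
  shows "ordLeq3 (card_of (A \<times> B)) (card_of A)" "ordLeq3 (card_of (B \<times> A)) (card_of A)"
  using card_of_Times_infinite[OF assms] ordIso_imp_ordLeq by auto

lemma small_Times:
  assumes inacc: "strongly_inaccessible (UNIV :: 'u set)"
    and "A \<prec> (UNIV :: 'u set)" "B \<prec> (UNIV :: 'u set)"
  shows "A \<times> B \<prec> (UNIV :: 'u set)"
proof (cases "finite A \<and> finite B")
  case True
  then show ?thesis by (simp add: small_finite[OF inacc])
next
  case False
  consider "ordLeq3 (card_of A) (card_of B)" | "ordLeq3 (card_of B) (card_of A)"
    using ordLeq_total[OF card_of_Well_order card_of_Well_order] by metis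
  then have "A = {} \<or> B = {} \<or> ordLeq3 (card_of (A \<times> B)) (card_of A) \<or>
      ordLeq3 (card_of (A \<times> B)) (card_of B)"
  proof cases
    case 1
    then have "infinite B" using False card_of_ordLeq_finite[OF 1] by metis
    then show ?thesis using card_of_Times_ordLeq(2)[OF _ _ 1] by metis
  next
    case 2
    then have "infinite A" using False card_of_ordLeq_finite[OF 2] by metis
    then show ?thesis using card_of_Times_ordLeq(1)[OF _ _ 2] by metis
  qed
  then have "A = {} \<or> B = {} \<or> lepoll (A \<times> B) A \<or> lepoll (A \<times> B) B"
    by (simp add: card_of_ordLeq[symmetric] lepoll_def)
  then consider "A \<times> B = {}" | "lepoll (A \<times> B) A" | "lepoll (A \<times> B) B" by blast
  then show ?thesis
  proof cases
    case 1
    show ?thesis unfolding 1 by (rule small_finite[OF inacc]) simp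
  next
    case 2 then show ?thesis by (rule lesspoll_trans1) (rule assms(2))
  next
    case 3 then show ?thesis by (rule lesspoll_trans1) (rule assms(3))
  qed
qed

text \<open>Functions that agree outside \<open>D\<close> are determined by their graphs over \<open>D\<close>.\<close>

lemma small_functions:
  assumes inacc: "strongly_inaccessible (UNIV :: 'u set)"
    and "D \<prec> (UNIV :: 'u set)" "Y \<prec> (UNIV :: 'u set)"
    and "\<And>f x. f \<in> F \<Longrightarrow> x \<in> D \<Longrightarrow> f x \<in> Y" "\<And>f x. f \<in> F \<Longrightarrow> x \<notin> D \<Longrightarrow> f x = c"
  shows "F \<prec> (UNIV :: 'u set)"
proof -
  let ?gr = "\<lambda>f. (\<lambda>x. (x, f x)) ` D"
  have "inj_on ?gr F"
  proof (rule inj_onI)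
    fix f g assume fg: "f \<in> F" "g \<in> F" "?gr f = ?gr g"
    show "f = g"
    proof
      fix x show "f x = g x"
        using fg assms(5)[OF fg(1), of x] assms(5)[OF fg(2), of x] by (cases "x \<in> D") (auto simp: image_iff set_eq_iff)
    qed
  qed
  moreover have "?gr ` F \<subseteq> Pow (D \<times> Y)"
    using assms(4) by auto
  ultimately have "lepoll F (Pow (D \<times> Y))"
    unfolding lepoll_def by blast
  then show ?thesis
    using small_Pow[OF inacc small_Times[OF assms(1-3)]] lesspoll_trans1 by blast
qed

text \<open>A real number is determined by its Dedekind cut, a set of rationals.\<close>

lemma small_complex:
  assumes inacc: "strongly_inaccessible (UNIV :: 'u set)"
  shows "(UNIV :: complex set) \<prec> (UNIV :: 'u set)"
proof -
  have rat: "(UNIV :: rat set) \<prec> (UNIV :: 'u set)"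
    using small_nat[OF inacc] countableI_type[of "UNIV :: rat set"] lesspoll_trans1
    unfolding countable_def lepoll_def by blast
  have "inj (\<lambda>x :: real. {q :: rat. of_rat q < x})"
  proof (rule linorder_injI)
    fix x y :: real assume "x < y"
    then obtain q where "x < of_rat q" "of_rat q < y"
      using of_rat_dense by blast
    then have "q \<in> {q. of_rat q < y}" "q \<notin> {q. of_rat q < x}" by auto
    then show "{q :: rat. of_rat q < x} \<noteq> {q. of_rat q < y}" by blast
  qed
  then have "lepoll (UNIV :: real set) (Pow (UNIV :: rat set))"
    unfolding lepoll_def by auto
  then have real: "(UNIV :: real set) \<prec> (UNIV :: 'u set)"
    using small_Pow[OF inacc rat] lesspoll_trans1 by blast
  have "(UNIV :: complex set) \<subseteq> case_prod Complex ` (UNIV \<times> UNIV)"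
    by (metis UNIV_I UNIV_Times_UNIV case_prod_conv complex.exhaust image_eqI subsetI)
  then show ?thesis
    using small_Times[OF inacc real real] subset_image_lepoll lesspoll_trans1 by blast
qed


section \<open>Extension of characters\<close>

text \<open>
  A partial character is encoded by its graph, a subgroup of the product of \<open>G\<close> and the nonzero complex
  numbers, so that extensions are inclusions and Zorn's lemma applies to unions of chains. For such a
  subgroup, being the graph of a function means that only \<open>1\<close> is related to the neutral element.
\<close>

definition character_graph :: "('a, 'b) monoid_scheme \<Rightarrow> ('a \<times> complex) set \<Rightarrow> bool" where
  "character_graph G S \<longleftrightarrow>
     S \<subseteq> carrier G \<times> - {0} \<and> (\<one>\<^bsub>G\<^esub>, 1) \<in> S \<and>
     (\<forall>x z y w. (x, z) \<in> S \<longrightarrow> (y, w) \<in> S \<longrightarrow> (x \<otimes>\<^bsub>G\<^esub> y, z * w) \<in> S) \<and>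
     (\<forall>x z. (x, z) \<in> S \<longrightarrow> (inv\<^bsub>G\<^esub> x, inverse z) \<in> S) \<and>
     (\<forall>z. (\<one>\<^bsub>G\<^esub>, z) \<in> S \<longrightarrow> z = 1)"

lemma character_graph_functional:
  assumes "group G" "character_graph G S" "(x, z) \<in> S" "(x, w) \<in> S"
  shows "z = w"
proof -
  interpret group G by fact
  have x: "x \<in> carrier G" and w: "w \<noteq> 0"
    using assms unfolding character_graph_def by auto
  have "(inv\<^bsub>G\<^esub> x, inverse w) \<in> S"
    using assms(2,4) unfolding character_graph_def by blast
  then have "(x \<otimes>\<^bsub>G\<^esub> inv\<^bsub>G\<^esub> x, z * inverse w) \<in> S"
    using assms(2,3) unfolding character_graph_def by blast
  then have "z * inverse w = 1"
    using assms(2) x unfolding character_graph_def by simp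
  then show ?thesis
    using w by (simp add: field_simps)
qed

lemma character_graph_int_pow:
  assumes "group G" "character_graph G S" "(x, z) \<in> S"
  shows "(x [^]\<^bsub>G\<^esub> (k :: int), z powi k) \<in> S"
proof -
  interpret group G by fact
  have x: "x \<in> carrier G" and z: "z \<noteq> 0"
    using assms unfolding character_graph_def by auto
  have nat: "(x [^]\<^bsub>G\<^esub> (n :: nat), z ^ n) \<in> S" for n
  proof (induction n)
    case (Suc n)
    then have "(x [^]\<^bsub>G\<^esub> n \<otimes>\<^bsub>G\<^esub> x, z ^ n * z) \<in> S"
      using assms unfolding character_graph_def by blast
    then show ?case by (simp add: mult.commute)
  qed (use assms in \<open>simp add: character_graph_def\<close>)
  show ?thesis
  proof (cases "k \<ge> 0")
    case True
    then obtain n where "k = int n" using nonneg_int_cases by blast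
    then show ?thesis using nat[of n] by (simp add: int_pow_int)
  next
    case False
    then have k: "k = - int (nat (- k))" by simp
    then obtain n where k: "k = - int n" ..
    have "(inv\<^bsub>G\<^esub> (x [^]\<^bsub>G\<^esub> n), inverse (z ^ n)) \<in> S"
      using assms(2) nat[of n] unfolding character_graph_def by blast
    then show ?thesis using x by (simp add: k int_pow_neg_int power_int_minus)
  qed
qed

text \<open>
  The value \<open>t\<close> at a new element \<open>x\<close> may be prescribed as long as the powers of \<open>x\<close> that already have a
  value have the one that \<open>t\<close> dictates: the extended graph is generated by \<open>S\<close> and \<open>(x, t)\<close>.
\<close>

lemma character_graph_adjoin:
  assumes "comm_group G" and S: "character_graph G S"
    and x: "x \<in> carrier G" and t: "t \<noteq> 0"
    and compat: "\<And>(k :: int) z. (x [^]\<^bsub>G\<^esub> k, z) \<in> S \<Longrightarrow> z = t powi k"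
  obtains S' where "character_graph G S'" "S \<subseteq> S'" "(x, t) \<in> S'"
proof -
  interpret comm_group G by fact
  define S' where "S' = {(h \<otimes>\<^bsub>G\<^esub> x [^]\<^bsub>G\<^esub> k, z * t powi k) | h z (k :: int). (h, z) \<in> S}"
  have sub: "S \<subseteq> carrier G \<times> - {0}" and one: "(\<one>\<^bsub>G\<^esub>, 1) \<in> S"
    and mul: "\<And>a z b w. (a, z) \<in> S \<Longrightarrow> (b, w) \<in> S \<Longrightarrow> (a \<otimes>\<^bsub>G\<^esub> b, z * w) \<in> S"
    and inv: "\<And>a z. (a, z) \<in> S \<Longrightarrow> (inv\<^bsub>G\<^esub> a, inverse z) \<in> S"
    using S unfolding character_graph_def by blast+
  have memI: "(h \<otimes>\<^bsub>G\<^esub> x [^]\<^bsub>G\<^esub> k, z * t powi k) \<in> S'" if "(h, z) \<in> S" for h z and k :: int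
    using that unfolding S'_def by blast
  have memE: "\<exists>h z (k :: int). (h, z) \<in> S \<and> a = h \<otimes>\<^bsub>G\<^esub> x [^]\<^bsub>G\<^esub> k \<and> c = z * t powi k" if "(a, c) \<in> S'" for a c
    using that unfolding S'_def by blast
  have "S \<subseteq> S'"
  proof
    fix p assume p: "p \<in> S"
    obtain h z where "p = (h, z)" by fastforce
    then show "p \<in> S'" using memI[of h z 0] p sub by auto
  qed
  moreover have "(x, t) \<in> S'"
    using memI[OF one, of 1] x by simp
  moreover have "character_graph G S'"
    unfolding character_graph_def
  proof (intro conjI allI impI)
    show "S' \<subseteq> carrier G \<times> - {0}"
      using sub x t unfolding S'_def by auto
    show "(\<one>\<^bsub>G\<^esub>, 1) \<in> S'"
      using one \<open>S \<subseteq> S'\<close> by blast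
  next
    fix a z b w assume "(a, z) \<in> S'" "(b, w) \<in> S'"
    then obtain h c k h' c' k' where *: "(h, c) \<in> S" "a = h \<otimes>\<^bsub>G\<^esub> x [^]\<^bsub>G\<^esub> (k :: int)" "z = c * t powi k"
        "(h', c') \<in> S" "b = h' \<otimes>\<^bsub>G\<^esub> x [^]\<^bsub>G\<^esub> (k' :: int)" "w = c' * t powi k'"
      using memE by metis
    have "h \<in> carrier G" "h' \<in> carrier G" using * sub by auto
    then have "a \<otimes>\<^bsub>G\<^esub> b = (h \<otimes>\<^bsub>G\<^esub> h') \<otimes>\<^bsub>G\<^esub> x [^]\<^bsub>G\<^esub> (k + k')"
      using x by (simp add: * int_pow_mult m_ac)
    moreover have "z * w = (c * c') * t powi (k + k')"
      using t by (simp add: * power_int_add)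
    ultimately show "(a \<otimes>\<^bsub>G\<^esub> b, z * w) \<in> S'"
      using memI[OF mul[OF *(1,4)], of "k + k'"] by simp
  next
    fix a z assume "(a, z) \<in> S'"
    then obtain h c k where *: "(h, c) \<in> S" "a = h \<otimes>\<^bsub>G\<^esub> x [^]\<^bsub>G\<^esub> (k :: int)" "z = c * t powi k"
      using memE by metis
    have "h \<in> carrier G" using * sub by auto
    then have "inv\<^bsub>G\<^esub> a = inv\<^bsub>G\<^esub> h \<otimes>\<^bsub>G\<^esub> x [^]\<^bsub>G\<^esub> (- k)"
      using x by (simp add: * int_pow_neg inv_mult)
    moreover have "inverse z = inverse c * t powi (- k)"
      by (simp add: * power_int_minus)
    ultimately show "(inv\<^bsub>G\<^esub> a, inverse z) \<in> S'"
      using memI[OF inv[OF *(1)], of "- k"] by simp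
  next
    fix z assume "(\<one>\<^bsub>G\<^esub>, z) \<in> S'"
    then obtain h c k where *: "(h, c) \<in> S" "\<one>\<^bsub>G\<^esub> = h \<otimes>\<^bsub>G\<^esub> x [^]\<^bsub>G\<^esub> (k :: int)" "z = c * t powi k"
      using memE by metis
    have h: "h \<in> carrier G" and c: "c \<noteq> 0" using * sub by auto
    have "inv\<^bsub>G\<^esub> h = x [^]\<^bsub>G\<^esub> k"
      using h x *(2) by (metis inv_equality m_comm int_pow_closed)
    then have "inverse c = t powi k"
      using inv[OF *(1)] compat by simp
    then show "z = 1"
      using c *(3) by (metis right_inverse)
  qed
  ultimately show thesis using that by blast
qed

lemma complex_root_exists:
  assumes "n > 0" obtains t :: complex where "t ^ n = z"
proof
  have "rcis (root n (cmod z)) (Arg z / real n) ^ n = rcis (cmod z) (Arg z)"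
    using assms by (simp add: DeMoivre2)
  then show "rcis (root n (cmod z)) (Arg z / real n) ^ n = z"
    by (simp add: rcis_cmod_Arg)
qed

text \<open>
  The exponents \<open>k\<close> for which the power \<open>x\<^sup>k\<close> has a value are the multiples of some \<open>n\<close>. If \<open>n > 0\<close>, an
  \<open>n\<close>-th root of the value at \<open>x\<^sup>n\<close> is a consistent value for \<open>x\<close>; such roots exist because the group of
  nonzero complex numbers is divisible. If \<open>n = 0\<close>, every value is consistent.
\<close>

lemma character_graph_extend_step:
  assumes "comm_group G" and S: "character_graph G S" and x: "x \<in> carrier G"
  obtains S' where "character_graph G S'" "S \<subseteq> S'" "x \<in> fst ` S'"
proof -
  interpret comm_group G by fact
  have "\<exists>t. t \<noteq> 0 \<and> (\<forall>(k :: int) z. (x [^]\<^bsub>G\<^esub> k, z) \<in> S \<longrightarrow> z = t powi k)"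
  proof (cases "\<exists>n :: nat. n > 0 \<and> x [^]\<^bsub>G\<^esub> n \<in> fst ` S")
    case False
    have "k = 0" if "(x [^]\<^bsub>G\<^esub> k, z) \<in> S" for k :: int and z
    proof (rule ccontr)
      assume "k \<noteq> 0"
      have "(x [^]\<^bsub>G\<^esub> (- k), inverse z) \<in> S"
        using that S x unfolding character_graph_def by (simp add: int_pow_neg)
      then have "x [^]\<^bsub>G\<^esub> \<bar>k\<bar> \<in> fst ` S"
        using that by (cases "k \<ge> 0") (auto simp: image_iff intro: bexI[rotated])
      moreover have "x [^]\<^bsub>G\<^esub> \<bar>k\<bar> = x [^]\<^bsub>G\<^esub> nat \<bar>k\<bar>"
        by (metis abs_ge_zero int_nat_eq int_pow_int)
      ultimately show False
        using False \<open>k \<noteq> 0\<close> by (metis zero_less_abs_iff zero_less_nat_eq)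
    qed
    then have "\<forall>(k :: int) z. (x [^]\<^bsub>G\<^esub> k, z) \<in> S \<longrightarrow> z = 1 powi k"
      using S unfolding character_graph_def by fastforce
    then show ?thesis by (metis one_neq_zero)
  next
    case True
    define n where "n = (LEAST n :: nat. n > 0 \<and> x [^]\<^bsub>G\<^esub> n \<in> fst ` S)"
    have n: "n > 0" "x [^]\<^bsub>G\<^esub> n \<in> fst ` S"
      using LeastI_ex[OF True] unfolding n_def by auto
    have least: "\<not> (0 < m \<and> x [^]\<^bsub>G\<^esub> m \<in> fst ` S)" if "m < n" for m :: nat
      using not_less_Least that unfolding n_def by blast
    obtain c where c: "(x [^]\<^bsub>G\<^esub> n, c) \<in> S" using n(2) by fastforce
    then have c0: "c \<noteq> 0" using S unfolding character_graph_def by auto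
    obtain t where t: "t ^ n = c" using complex_root_exists[OF n(1)] .
    then have t0: "t \<noteq> 0" using c0 n(1) by auto
    have "z = t powi k" if kz: "(x [^]\<^bsub>G\<^esub> k, z) \<in> S" for k :: int and z
    proof -
      (* Reducing k modulo n keeps the power in the domain of S, so that n divides k by minimality. *)
      define q where "q = k div int n"
      have q: "((x [^]\<^bsub>G\<^esub> n) [^]\<^bsub>G\<^esub> q, c powi q) \<in> S"
        using character_graph_int_pow[OF is_group S c] .
      have xq: "(x [^]\<^bsub>G\<^esub> n) [^]\<^bsub>G\<^esub> q = x [^]\<^bsub>G\<^esub> (int n * q)"
        using x by (metis int_pow_int int_pow_pow)
      have "x [^]\<^bsub>G\<^esub> (int n * (- q)) \<in> fst ` S"
      proof -
        have "((x [^]\<^bsub>G\<^esub> n) [^]\<^bsub>G\<^esub> (- q), c powi (- q)) \<in> S"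
          using character_graph_int_pow[OF is_group S c] .
        moreover have "(x [^]\<^bsub>G\<^esub> n) [^]\<^bsub>G\<^esub> (- q) = x [^]\<^bsub>G\<^esub> (int n * (- q))"
          using x by (metis int_pow_int int_pow_pow)
        ultimately show ?thesis by force
      qed
      then obtain w where "(x [^]\<^bsub>G\<^esub> (int n * (- q)), w) \<in> S" by fastforce
      then have "(x [^]\<^bsub>G\<^esub> k \<otimes>\<^bsub>G\<^esub> x [^]\<^bsub>G\<^esub> (int n * (- q)), z * w) \<in> S"
        using kz S unfolding character_graph_def by blast
      moreover have "x [^]\<^bsub>G\<^esub> k \<otimes>\<^bsub>G\<^esub> x [^]\<^bsub>G\<^esub> (int n * (- q)) = x [^]\<^bsub>G\<^esub> (k mod int n)"
        using x by (simp add: int_pow_mult[symmetric] q_def minus_mult_div_eq_mod)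
      moreover have "x [^]\<^bsub>G\<^esub> (k mod int n) = x [^]\<^bsub>G\<^esub> nat (k mod int n)"
        using n(1) by (metis int_nat_eq int_pow_int of_nat_0_less_iff pos_mod_sign)
      ultimately have "x [^]\<^bsub>G\<^esub> nat (k mod int n) \<in> fst ` S" by force
      moreover have "nat (k mod int n) < n"
        using n(1) by (simp add: nat_less_iff)
      ultimately have "k mod int n = 0"
        using least n(1) by (metis of_nat_0_less_iff pos_mod_sign not_le zero_less_nat_eq order_le_less)
      then have k: "k = int n * q" unfolding q_def by auto
      then have "z = c powi q"
        using character_graph_functional[OF is_group S kz] q xq by simp
      also have "\<dots> = t powi k"
        by (simp add: t[symmetric] k power_int_mult)
      finally show ?thesis .
    qed
    then show ?thesis using t0 by blast
  qed
  then obtain t where "t \<noteq> 0" "\<And>(k :: int) z. (x [^]\<^bsub>G\<^esub> k, z) \<in> S \<Longrightarrow> z = t powi k"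
    by blast
  from character_graph_adjoin[OF assms this] that show thesis
    by (metis fst_conv imageI)
qed

text \<open>By Zorn's lemma there is a maximal extension, which is total by the previous step.\<close>

lemma character_graph_extend:
  assumes "comm_group G" and S: "character_graph G S"
  obtains \<chi> where "\<And>x. x \<in> carrier G \<Longrightarrow> \<chi> x \<noteq> 0"
    "\<And>x y. x \<in> carrier G \<Longrightarrow> y \<in> carrier G \<Longrightarrow> \<chi> (x \<otimes>\<^bsub>G\<^esub> y) = \<chi> x * \<chi> y"
    "\<And>x z. (x, z) \<in> S \<Longrightarrow> \<chi> x = z"
proof -
  interpret comm_group G by fact
  let ?A = "{S'. S \<subseteq> S' \<and> character_graph G S'}"
  have "\<exists>M\<in>?A. \<forall>D\<in>?A. M \<subseteq> D \<longrightarrow> D = M"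
  proof (rule subset_Zorn_nonempty)
    show "?A \<noteq> {}" using S by blast
    fix C assume C: "C \<noteq> {}" "subset.chain ?A C"
    have chain: "D \<subseteq> Y \<or> Y \<subseteq> D" if "D \<in> C" "Y \<in> C" for D Y
      using C(2) that unfolding subset.chain_def by blast
    have CA: "S \<subseteq> D" "character_graph G D" if "D \<in> C" for D
      using C(2) that unfolding subset.chain_def by auto
    have "character_graph G (\<Union>C)"
      unfolding character_graph_def
    proof (intro conjI allI impI)
      fix a z b w assume "(a, z) \<in> \<Union>C" "(b, w) \<in> \<Union>C"
      then obtain D E where "D \<in> C" "(a, z) \<in> D" "E \<in> C" "(b, w) \<in> E" by blast
      then obtain D where "D \<in> C" "(a, z) \<in> D" "(b, w) \<in> D"
        using chain[of D E] by blast
      then show "(a \<otimes>\<^bsub>G\<^esub> b, z * w) \<in> \<Union>C"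
        using CA(2)[of D] unfolding character_graph_def by blast
    qed (use C(1) CA(2) in \<open>unfold character_graph_def, blast+\<close>)
    then show "\<Union>C \<in> ?A" using CA(1) C(1) by blast
  qed
  then obtain M where MA: "M \<in> ?A" and max: "\<forall>D\<in>?A. M \<subseteq> D \<longrightarrow> D = M" ..
  then have M: "S \<subseteq> M" "character_graph G M" by simp_all
  have total: "\<exists>z. (x, z) \<in> M" if x: "x \<in> carrier G" for x
  proof -
    obtain M' where "character_graph G M'" "M \<subseteq> M'" "x \<in> fst ` M'"
      using character_graph_extend_step[OF assms(1) M(2) x] .
    then show ?thesis using max M(1) by (metis (no_types, lifting) image_iff mem_Collect_eq order_trans prod.collapse)
  qed
  define \<chi> where "\<chi> x = (THE z. (x, z) \<in> M)" for x
  have \<chi>: "\<chi> x = z" if "(x, z) \<in> M" for x z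
    unfolding \<chi>_def using that character_graph_functional[OF is_group M(2)] by blast
  show thesis
  proof (rule that[of \<chi>])
    fix x assume "x \<in> carrier G"
    then show "\<chi> x \<noteq> 0" using total[of x] \<chi> M(2) unfolding character_graph_def by auto
    fix y assume "y \<in> carrier G"
    with \<open>x \<in> carrier G\<close> obtain z w where "(x, z) \<in> M" "(y, w) \<in> M" using total by blast
    then show "\<chi> (x \<otimes>\<^bsub>G\<^esub> y) = \<chi> x * \<chi> y"
      using \<chi> M(2) unfolding character_graph_def by metis
  qed (use \<chi> M(1) in blast)
qed

lemma extend_character:
  assumes G: "comm_group G" and H: "subgroup H G"
    and nz: "\<And>x. x \<in> H \<Longrightarrow> \<chi> x \<noteq> (0 :: complex)"
    and mult: "\<And>x y. x \<in> H \<Longrightarrow> y \<in> H \<Longrightarrow> \<chi> (x \<otimes>\<^bsub>G\<^esub> y) = \<chi> x * \<chi> y"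
  shows "\<exists>\<chi>'. (\<forall>x\<in>carrier G. \<chi>' x \<noteq> 0) \<and>
    (\<forall>x\<in>carrier G. \<forall>y\<in>carrier G. \<chi>' (x \<otimes>\<^bsub>G\<^esub> y) = \<chi>' x * \<chi>' y) \<and> (\<forall>x\<in>H. \<chi>' x = \<chi> x)"
proof -
  interpret comm_group G by fact
  interpret H: subgroup H G by fact
  let ?S = "(\<lambda>x. (x, \<chi> x)) ` H"
  have one: "\<chi> \<one>\<^bsub>G\<^esub> = 1"
  proof -
    have "\<chi> \<one>\<^bsub>G\<^esub> * \<chi> \<one>\<^bsub>G\<^esub> = \<chi> \<one>\<^bsub>G\<^esub>" using mult[OF H.one_closed H.one_closed] by simp
    then show ?thesis using nz[OF H.one_closed] by simp
  qed
  have inv: "\<chi> (inv\<^bsub>G\<^esub> x) = inverse (\<chi> x)" if x: "x \<in> H" for x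
  proof -
    have "\<chi> x * \<chi> (inv\<^bsub>G\<^esub> x) = 1"
      using mult[OF x H.m_inv_closed[OF x]] one H.mem_carrier[OF x] by simp
    then show ?thesis by (metis inverse_unique)
  qed
  have memI: "(x, \<chi> x) \<in> ?S" if "x \<in> H" for x using that by (rule imageI)
  have memE: "x \<in> H \<and> z = \<chi> x" if "(x, z) \<in> ?S" for x z using that by auto
  have graph: "character_graph G ?S"
    unfolding character_graph_def
  proof (intro conjI allI impI)
    show "?S \<subseteq> carrier G \<times> - {0}" using nz H.mem_carrier by auto
    show "(\<one>\<^bsub>G\<^esub>, 1) \<in> ?S" using memI[OF H.one_closed] one by simp
    show "(x \<otimes>\<^bsub>G\<^esub> y, z * w) \<in> ?S" if "(x, z) \<in> ?S" "(y, w) \<in> ?S" for x z y w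
      using memI[of "x \<otimes>\<^bsub>G\<^esub> y"] memE[OF that(1)] memE[OF that(2)] mult by simp
    show "(inv\<^bsub>G\<^esub> x, inverse z) \<in> ?S" if "(x, z) \<in> ?S" for x z
      using memI[of "inv\<^bsub>G\<^esub> x"] memE[OF that] inv by simp
    show "z = 1" if "(\<one>\<^bsub>G\<^esub>, z) \<in> ?S" for z using memE[OF that] one by simp
  qed
  show ?thesis
  proof (rule character_graph_extend[OF G graph])
    fix \<chi>' assume \<chi>': "\<And>x. x \<in> carrier G \<Longrightarrow> \<chi>' x \<noteq> 0"
      "\<And>x y. x \<in> carrier G \<Longrightarrow> y \<in> carrier G \<Longrightarrow> \<chi>' (x \<otimes>\<^bsub>G\<^esub> y) = \<chi>' x * \<chi>' y"
      "\<And>x z. (x, z) \<in> ?S \<Longrightarrow> \<chi>' x = z"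
    show ?thesis
      by (intro exI[of _ \<chi>'] conjI ballI) (use \<chi>'(1,2) \<chi>'(3)[OF memI] in auto)
  qed
qed

text \<open>
  Start from the trivial character of the trivial subgroup and give \<open>x\<close> a value other than \<open>1\<close>: a
  primitive root of unity if the order of \<open>x\<close> is finite, and any other nonzero number otherwise.
\<close>

lemma separating_character:
  assumes "comm_group G" and x: "x \<in> carrier G" "x \<noteq> \<one>\<^bsub>G\<^esub>"
  obtains \<chi> where "\<And>x. x \<in> carrier G \<Longrightarrow> \<chi> x \<noteq> (0 :: complex)"
    "\<And>x y. x \<in> carrier G \<Longrightarrow> y \<in> carrier G \<Longrightarrow> \<chi> (x \<otimes>\<^bsub>G\<^esub> y) = \<chi> x * \<chi> y"
    "\<chi> x \<noteq> 1"
proof -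
  interpret comm_group G by fact
  let ?S = "{(\<one>\<^bsub>G\<^esub>, 1 :: complex)}"
  have S: "character_graph G ?S" unfolding character_graph_def by auto
  (* The order is 0 for elements of infinite order. *)
  obtain t :: complex where t: "t \<noteq> 0" "t \<noteq> 1" "\<And>k :: int. x [^]\<^bsub>G\<^esub> k = \<one>\<^bsub>G\<^esub> \<Longrightarrow> t powi k = 1"
  proof (cases "ord x = 0")
    case True
    have "k = 0" if "x [^]\<^bsub>G\<^esub> k = \<one>\<^bsub>G\<^esub>" for k :: int
      using that True int_pow_eq_id[OF x(1)] by simp
    then show thesis using that[of 2] by fastforce
  next
    case False
    have "ord x \<noteq> 1" using x ord_eq_1 by auto
    define n where "n = ord x"
    have n: "n > 1" using False \<open>ord x \<noteq> 1\<close> unfolding n_def by simp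
    let ?t = "cis (2 * pi / real n)"
    have "?t \<noteq> 1"
    proof
      assume "?t = 1"
      then have 1: "cos (2 * pi / real n) = 1" by (simp add: complex_eq_iff)
      have "cos (2 * pi / real n) < cos 0" 
      proof (cases "n = 2")
        case True then show ?thesis by simp
      next
        case False
        with n have "2 * pi / real n \<le> pi" "0 < 2 * pi / real n" by (auto simp: field_simps)
        then show ?thesis by (intro cos_monotone_0_pi) auto
      qed
      with 1 show False by simp
    qed
    moreover have "?t ^ n = 1" using n by (simp add: DeMoivre)
    moreover have "?t powi k = 1" if "x [^]\<^bsub>G\<^esub> k = \<one>\<^bsub>G\<^esub>" for k :: int
    proof -
      have "int n dvd k" using that int_pow_eq_id[OF x(1)] unfolding n_def by simp
      then obtain m where "k = int n * m" by blast
      then show ?thesis using \<open>?t ^ n = 1\<close> by (simp add: power_int_mult)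
    qed
    ultimately show thesis using that[of ?t] by simp
  qed
  have compat: "z = t powi k" if "(x [^]\<^bsub>G\<^esub> k, z) \<in> ?S" for k :: int and z
    using that t(3)[of k] by simp
  obtain S' where S': "character_graph G S'" "(x, t) \<in> S'"
    using character_graph_adjoin[OF assms(1) S x(1) t(1) compat] by metis
  show thesis
    using character_graph_extend[OF assms(1) S'(1)] S'(2) t(2) that by metis
qed


section \<open>Linear maps\<close>

lemma left_module_imp_abelian_group: "left_module R M \<Longrightarrow> abelian_group M"
  and left_module_imp_ring: "left_module R M \<Longrightarrow> ring R"
  by (simp_all add: left_module_def)

lemma comm_group_add_monoid:
  assumes "left_module R M" shows "comm_group (add_monoid M)"
  using abelian_group.a_comm_group[OF left_module_imp_abelian_group[OF assms]] .

lemma smult_zero: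
  assumes "left_module R M" "r \<in> carrier R"
  shows "r \<odot>\<^bsub>M\<^esub> \<zero>\<^bsub>M\<^esub> = \<zero>\<^bsub>M\<^esub>"
proof -
  interpret abelian_group M using assms(1) by (rule left_module_imp_abelian_group)
  have "r \<odot>\<^bsub>M\<^esub> \<zero>\<^bsub>M\<^esub> \<oplus>\<^bsub>M\<^esub> r \<odot>\<^bsub>M\<^esub> \<zero>\<^bsub>M\<^esub> = r \<odot>\<^bsub>M\<^esub> \<zero>\<^bsub>M\<^esub>"
    using left_module.smult_r_distr[OF assms zero_closed zero_closed] by simp
  then show ?thesis
    using left_module.smult_closed[OF assms zero_closed] by (metis add.l_cancel_one')
qed

lemma zero_smult:
  assumes "left_module R M" "x \<in> carrier M"
  shows "\<zero>\<^bsub>R\<^esub> \<odot>\<^bsub>M\<^esub> x = \<zero>\<^bsub>M\<^esub>"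
proof -
  interpret abelian_group M using assms(1) by (rule left_module_imp_abelian_group)
  interpret R: ring R using assms(1) by (rule left_module_imp_ring)
  have "\<zero>\<^bsub>R\<^esub> \<odot>\<^bsub>M\<^esub> x \<oplus>\<^bsub>M\<^esub> \<zero>\<^bsub>R\<^esub> \<odot>\<^bsub>M\<^esub> x = \<zero>\<^bsub>R\<^esub> \<odot>\<^bsub>M\<^esub> x"
    using left_module.smult_l_distr[OF assms(1) R.zero_closed R.zero_closed assms(2)] by simp
  then show ?thesis
    using left_module.smult_closed[OF assms(1) R.zero_closed assms(2)] by (metis add.l_cancel_one')
qed

lemma minus_one_smult:
  assumes "left_module R M" "x \<in> carrier M"
  shows "(\<ominus>\<^bsub>R\<^esub> \<one>\<^bsub>R\<^esub>) \<odot>\<^bsub>M\<^esub> x = \<ominus>\<^bsub>M\<^esub> x"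
proof -
  interpret abelian_group M using assms(1) by (rule left_module_imp_abelian_group)
  interpret R: ring R using assms(1) by (rule left_module_imp_ring)
  have cl: "(\<ominus>\<^bsub>R\<^esub> \<one>\<^bsub>R\<^esub>) \<odot>\<^bsub>M\<^esub> x \<in> carrier M"
    using left_module.smult_closed[OF assms(1) _ assms(2)] by simp
  have "(\<ominus>\<^bsub>R\<^esub> \<one>\<^bsub>R\<^esub>) \<odot>\<^bsub>M\<^esub> x \<oplus>\<^bsub>M\<^esub> x = (\<ominus>\<^bsub>R\<^esub> \<one>\<^bsub>R\<^esub> \<oplus>\<^bsub>R\<^esub> \<one>\<^bsub>R\<^esub>) \<odot>\<^bsub>M\<^esub> x"
    using left_module.smult_l_distr[OF assms(1) _ R.one_closed assms(2), of "\<ominus>\<^bsub>R\<^esub> \<one>\<^bsub>R\<^esub>"]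
      left_module.smult_one[OF assms] by simp
  also have "\<dots> = \<zero>\<^bsub>M\<^esub>"
    using zero_smult[OF assms] by (simp add: R.l_neg)
  finally show ?thesis
    using cl assms(2) minus_equality by metis
qed

lemma lin_mapsI:
  assumes "\<And>x. x \<in> carrier M \<Longrightarrow> h x \<in> carrier N"
    and "\<And>x y. x \<in> carrier M \<Longrightarrow> y \<in> carrier M \<Longrightarrow> h (x \<oplus>\<^bsub>M\<^esub> y) = h x \<oplus>\<^bsub>N\<^esub> h y"
    and "\<And>r x. r \<in> carrier R \<Longrightarrow> x \<in> carrier M \<Longrightarrow> h (r \<odot>\<^bsub>M\<^esub> x) = r \<odot>\<^bsub>N\<^esub> h x"
    and "\<And>x. x \<notin> carrier M \<Longrightarrow> h x = undefined"
  shows "h \<in> lin_maps R M N"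
  using assms by (auto simp: lin_maps_def hom_def extensional_def)

lemma lin_maps_closed: "h \<in> lin_maps R M N \<Longrightarrow> x \<in> carrier M \<Longrightarrow> h x \<in> carrier N"
  and lin_maps_add: "h \<in> lin_maps R M N \<Longrightarrow> x \<in> carrier M \<Longrightarrow> y \<in> carrier M \<Longrightarrow>
    h (x \<oplus>\<^bsub>M\<^esub> y) = h x \<oplus>\<^bsub>N\<^esub> h y"
  and lin_maps_smult: "h \<in> lin_maps R M N \<Longrightarrow> r \<in> carrier R \<Longrightarrow> x \<in> carrier M \<Longrightarrow>
    h (r \<odot>\<^bsub>M\<^esub> x) = r \<odot>\<^bsub>N\<^esub> h x"
  and lin_maps_outside: "h \<in> lin_maps R M N \<Longrightarrow> x \<notin> carrier M \<Longrightarrow> h x = undefined"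
  by (auto simp: lin_maps_def hom_def extensional_def)

lemma lin_maps_zero:
  assumes "left_module R M" "left_module R N" "h \<in> lin_maps R M N"
  shows "h \<zero>\<^bsub>M\<^esub> = \<zero>\<^bsub>N\<^esub>"
proof -
  interpret M: abelian_group M using assms(1) by (rule left_module_imp_abelian_group)
  interpret N: abelian_group N using assms(2) by (rule left_module_imp_abelian_group)
  have "h \<zero>\<^bsub>M\<^esub> \<oplus>\<^bsub>N\<^esub> h \<zero>\<^bsub>M\<^esub> = h \<zero>\<^bsub>M\<^esub>"
    using lin_maps_add[OF assms(3) M.zero_closed M.zero_closed] by simp
  then show ?thesis
    using lin_maps_closed[OF assms(3) M.zero_closed] by (metis N.add.l_cancel_one')
qed

lemma lin_maps_neg:
  assumes "left_module R M" "left_module R N" "h \<in> lin_maps R M N" "x \<in> carrier M"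
  shows "h (\<ominus>\<^bsub>M\<^esub> x) = \<ominus>\<^bsub>N\<^esub> h x"
proof -
  interpret R: ring R using assms(1) by (rule left_module_imp_ring)
  show ?thesis
    using lin_maps_smult[OF assms(3) _ assms(4), of "\<ominus>\<^bsub>R\<^esub> \<one>\<^bsub>R\<^esub>"]
      minus_one_smult[OF assms(1,4)] minus_one_smult[OF assms(2) lin_maps_closed[OF assms(3,4)]]
    by simp
qed

lemma lin_maps_diff_apply:
  assumes "left_module R M" "left_module R N" "h \<in> lin_maps R M N" "x \<in> carrier M" "y \<in> carrier M"
  shows "h (x \<ominus>\<^bsub>M\<^esub> y) = h x \<ominus>\<^bsub>N\<^esub> h y"
proof -
  interpret M: abelian_group M using assms(1) by (rule left_module_imp_abelian_group)
  show ?thesis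
    unfolding a_minus_def using assms lin_maps_add[OF assms(3,4)] lin_maps_neg[OF assms(1-3,5)] by simp
qed

lemma lin_maps_inj:
  assumes M: "left_module R M" and N: "left_module R N" and h: "h \<in> lin_maps R M N"
    and ker: "\<And>x. x \<in> carrier M \<Longrightarrow> h x = \<zero>\<^bsub>N\<^esub> \<Longrightarrow> x = \<zero>\<^bsub>M\<^esub>"
  shows "inj_on h (carrier M)"
proof (rule inj_onI)
  interpret M: abelian_group M using M by (rule left_module_imp_abelian_group)
  interpret N: abelian_group N using N by (rule left_module_imp_abelian_group)
  fix x y assume xy: "x \<in> carrier M" "y \<in> carrier M" "h x = h y"
  have "h x \<ominus>\<^bsub>N\<^esub> h y = \<zero>\<^bsub>N\<^esub>"
    using xy(3) lin_maps_closed[OF h xy(2)] by (simp add: a_minus_def N.r_neg)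
  then have "h (x \<ominus>\<^bsub>M\<^esub> y) = \<zero>\<^bsub>N\<^esub>"
    by (simp only: lin_maps_diff_apply[OF M N h xy(1,2)])
  then have "x \<ominus>\<^bsub>M\<^esub> y = \<zero>\<^bsub>M\<^esub>" using ker[of "x \<ominus>\<^bsub>M\<^esub> y"] xy by simp
  then have "\<ominus>\<^bsub>M\<^esub> (\<ominus>\<^bsub>M\<^esub> y) = x"
    using xy(1,2) by (intro M.minus_equality) (simp_all add: a_minus_def)
  then show "x = y" using xy(2) by simp
qed

lemma lin_maps_eqI:
  assumes "f \<in> lin_maps R M N" "g \<in> lin_maps R M N'" "\<And>x. x \<in> carrier M \<Longrightarrow> f x = g x"
  shows "f = g"
  using assms by (intro ext) (metis lin_maps_outside)

lemma lin_maps_compose: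
  assumes "left_module R M" "f \<in> lin_maps R M N" "g \<in> lin_maps R N K"
  shows "compose (carrier M) g f \<in> lin_maps R M K"
proof -
  interpret M: abelian_group M using assms(1) by (rule left_module_imp_abelian_group)
  show ?thesis
    using assms left_module.smult_closed[OF assms(1)]
    by (intro lin_mapsI)
       (simp_all add: compose_def lin_maps_closed[OF assms(2)] lin_maps_closed[OF assms(3)]
          lin_maps_add[OF assms(2)] lin_maps_add[OF assms(3)]
          lin_maps_smult[OF assms(2)] lin_maps_smult[OF assms(3)])
qed

lemma lin_maps_id: "left_module R M \<Longrightarrow> (\<lambda>x\<in>carrier M. x) \<in> lin_maps R M M"
  by (rule lin_mapsI)
     (auto simp: left_module.smult_closed abelian_monoid.a_closed abelian_group.axioms left_module_imp_abelian_group)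

lemma lin_maps_zero_map:
  assumes "left_module R M" "left_module R N"
  shows "(\<lambda>x\<in>carrier M. \<zero>\<^bsub>N\<^esub>) \<in> lin_maps R M N"
proof -
  interpret M: abelian_group M using assms(1) by (rule left_module_imp_abelian_group)
  interpret N: abelian_group N using assms(2) by (rule left_module_imp_abelian_group)
  show ?thesis
    by (rule lin_mapsI) (simp_all add: left_module.smult_closed[OF assms(1)] smult_zero[OF assms(2)])
qed

lemma lin_maps_diff:
  assumes "left_module R M" "left_module R N" "f \<in> lin_maps R M N" "g \<in> lin_maps R M N"
  shows "(\<lambda>x\<in>carrier M. f x \<ominus>\<^bsub>N\<^esub> g x) \<in> lin_maps R M N"
proof -
  interpret R: ring R using assms(1) by (rule left_module_imp_ring)
  interpret M: abelian_group M using assms(1) by (rule left_module_imp_abelian_group)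
  interpret N: abelian_group N using assms(2) by (rule left_module_imp_abelian_group)
  note fg = lin_maps_closed[OF assms(3)] lin_maps_closed[OF assms(4)]
  show ?thesis
  proof (rule lin_mapsI)
    fix x y assume xy: "x \<in> carrier M" "y \<in> carrier M"
    then show "(\<lambda>x\<in>carrier M. f x \<ominus>\<^bsub>N\<^esub> g x) (x \<oplus>\<^bsub>M\<^esub> y) =
        (\<lambda>x\<in>carrier M. f x \<ominus>\<^bsub>N\<^esub> g x) x \<oplus>\<^bsub>N\<^esub> (\<lambda>x\<in>carrier M. f x \<ominus>\<^bsub>N\<^esub> g x) y"
      using fg by (simp add: lin_maps_add[OF assms(3)] lin_maps_add[OF assms(4)] a_minus_def
          N.minus_add N.a_ac)
  next
    fix r x assume rx: "r \<in> carrier R" "x \<in> carrier M"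
    have "r \<odot>\<^bsub>N\<^esub> (\<ominus>\<^bsub>N\<^esub> g x) = \<ominus>\<^bsub>N\<^esub> (r \<odot>\<^bsub>N\<^esub> g x)"
    proof (rule N.minus_equality[symmetric])
      show "r \<odot>\<^bsub>N\<^esub> (\<ominus>\<^bsub>N\<^esub> g x) \<oplus>\<^bsub>N\<^esub> r \<odot>\<^bsub>N\<^esub> g x = \<zero>\<^bsub>N\<^esub>"
        using left_module.smult_r_distr[OF assms(2) rx(1), of "\<ominus>\<^bsub>N\<^esub> g x" "g x"] fg rx
        by (simp add: N.l_neg smult_zero[OF assms(2)])
    qed (use fg rx left_module.smult_closed[OF assms(2)] in auto)
    then show "(\<lambda>x\<in>carrier M. f x \<ominus>\<^bsub>N\<^esub> g x) (r \<odot>\<^bsub>M\<^esub> x) = r \<odot>\<^bsub>N\<^esub> (\<lambda>x\<in>carrier M. f x \<ominus>\<^bsub>N\<^esub> g x) x"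
      using fg rx left_module.smult_closed[OF assms(1)]
      by (simp add: lin_maps_smult[OF assms(3)] lin_maps_smult[OF assms(4)] a_minus_def
          left_module.smult_r_distr[OF assms(2)])
  qed (use fg in \<open>simp_all add: left_module.smult_closed[OF assms(1)]\<close>)
qed

text \<open>
  Linear maps that are specified on representatives (on a quotient, or on a sum of two images) are well
  defined if they send every representation of \<open>0\<close> to \<open>0\<close>: differences of two values of a linear
  relation at one point are values at \<open>0\<close>.
\<close>

lemma lin_map_of_relation:
  assumes M: "left_module R M" and N: "left_module R N"
    and sub: "\<Gamma> \<subseteq> carrier M \<times> carrier N"
    and total: "\<And>x. x \<in> carrier M \<Longrightarrow> \<exists>y. (x, y) \<in> \<Gamma>"
    and add: "\<And>x y x' y'. (x, y) \<in> \<Gamma> \<Longrightarrow> (x', y') \<in> \<Gamma> \<Longrightarrow> (x \<oplus>\<^bsub>M\<^esub> x', y \<oplus>\<^bsub>N\<^esub> y') \<in> \<Gamma>"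
    and smult: "\<And>r x y. r \<in> carrier R \<Longrightarrow> (x, y) \<in> \<Gamma> \<Longrightarrow> (r \<odot>\<^bsub>M\<^esub> x, r \<odot>\<^bsub>N\<^esub> y) \<in> \<Gamma>"
    and zero: "\<And>y. (\<zero>\<^bsub>M\<^esub>, y) \<in> \<Gamma> \<Longrightarrow> y = \<zero>\<^bsub>N\<^esub>"
  obtains h where "h \<in> lin_maps R M N" "\<And>x y. (x, y) \<in> \<Gamma> \<Longrightarrow> h x = y"
proof -
  interpret R: ring R using M by (rule left_module_imp_ring)
  interpret M: abelian_group M using M by (rule left_module_imp_abelian_group)
  interpret N: abelian_group N using N by (rule left_module_imp_abelian_group)
  have unique: "y = y'" if "(x, y) \<in> \<Gamma>" "(x, y') \<in> \<Gamma>" for x y y'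
  proof -
    have mem: "x \<in> carrier M" "y \<in> carrier N" "y' \<in> carrier N" using that sub by auto
    have "(\<ominus>\<^bsub>M\<^esub> x, \<ominus>\<^bsub>N\<^esub> y') \<in> \<Gamma>"
      using smult[OF _ that(2), of "\<ominus>\<^bsub>R\<^esub> \<one>\<^bsub>R\<^esub>"] mem
      by (simp add: minus_one_smult[OF M] minus_one_smult[OF N])
    from add[OF that(1) this] have "y \<oplus>\<^bsub>N\<^esub> \<ominus>\<^bsub>N\<^esub> y' = \<zero>\<^bsub>N\<^esub>"
      using mem zero by (simp add: M.r_neg)
    then show ?thesis using mem by (metis N.minus_equality N.minus_minus N.a_inv_closed)
  qed
  define h where "h = (\<lambda>x\<in>carrier M. THE y. (x, y) \<in> \<Gamma>)"
  have h: "h x = y" if "(x, y) \<in> \<Gamma>" for x y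
  proof -
    have "x \<in> carrier M" using that sub by auto
    then show ?thesis unfolding h_def using that unique by auto
  qed
  have rel: "(x, h x) \<in> \<Gamma>" if "x \<in> carrier M" for x
    using total[OF that] h by metis
  have "h \<in> lin_maps R M N"
  proof (rule lin_mapsI)
    show "h x \<in> carrier N" if "x \<in> carrier M" for x using rel[OF that] sub by auto
    show "h (x \<oplus>\<^bsub>M\<^esub> y) = h x \<oplus>\<^bsub>N\<^esub> h y" if "x \<in> carrier M" "y \<in> carrier M" for x y
      using h[OF add[OF rel rel]] that by simp
    show "h (r \<odot>\<^bsub>M\<^esub> x) = r \<odot>\<^bsub>N\<^esub> h x" if "r \<in> carrier R" "x \<in> carrier M" for r x
      using h[OF smult[OF _ rel]] that by simp
  qed (simp add: h_def)
  then show thesis using h that by blast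
qed

lemma lin_map_factor:
  assumes Z: "left_module R Z" and M: "left_module R M" and N: "left_module R N"
    and p: "p \<in> lin_maps R Z M" "p ` carrier Z = carrier M" and t: "t \<in> lin_maps R Z N"
    and ker: "\<forall>z\<in>carrier Z. p z = \<zero>\<^bsub>M\<^esub> \<longrightarrow> t z = \<zero>\<^bsub>N\<^esub>"
  obtains h where "h \<in> lin_maps R M N" "\<And>z. z \<in> carrier Z \<Longrightarrow> h (p z) = t z"
proof -
  interpret Z: abelian_group Z using Z by (rule left_module_imp_abelian_group)
  let ?\<Gamma> = "(\<lambda>z. (p z, t z)) ` carrier Z"
  have *: "?\<Gamma> \<subseteq> carrier M \<times> carrier N"
    using lin_maps_closed[OF p(1)] lin_maps_closed[OF t] by auto
  obtain h where "h \<in> lin_maps R M N" "\<And>x y. (x, y) \<in> ?\<Gamma> \<Longrightarrow> h x = y"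
  proof (rule lin_map_of_relation[OF M N *])
    show "\<exists>y. (x, y) \<in> ?\<Gamma>" if "x \<in> carrier M" for x
    proof -
      obtain z where "z \<in> carrier Z" "x = p z" using \<open>x \<in> carrier M\<close> p(2) by blast
      then show ?thesis by blast
    qed
    show "(x \<oplus>\<^bsub>M\<^esub> x', y \<oplus>\<^bsub>N\<^esub> y') \<in> ?\<Gamma>" if xy: "(x, y) \<in> ?\<Gamma>" "(x', y') \<in> ?\<Gamma>" for x y x' y'
    proof -
      obtain z z' where "z \<in> carrier Z" "z' \<in> carrier Z" "x = p z" "y = t z" "x' = p z'" "y' = t z'"
        using xy by auto
      then show ?thesis
        by (intro image_eqI[of _ _ "z \<oplus>\<^bsub>Z\<^esub> z'"])
           (simp_all add: lin_maps_add[OF p(1)] lin_maps_add[OF t])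
    qed
    show "(r \<odot>\<^bsub>M\<^esub> x, r \<odot>\<^bsub>N\<^esub> y) \<in> ?\<Gamma>" if r: "r \<in> carrier R" and xy: "(x, y) \<in> ?\<Gamma>" for r x y
    proof -
      obtain z where "z \<in> carrier Z" "x = p z" "y = t z"
        using xy by auto
      then show ?thesis
        using r left_module.smult_closed[OF Z]
        by (intro image_eqI[of _ _ "r \<odot>\<^bsub>Z\<^esub> z"])
           (simp_all add: lin_maps_smult[OF p(1)] lin_maps_smult[OF t])
    qed
    show "y = \<zero>\<^bsub>N\<^esub>" if "(\<zero>\<^bsub>M\<^esub>, y) \<in> ?\<Gamma>" for y
      using that ker by force
  qed blast
  then show thesis using that by blast
qed

lemma lin_maps_inverse:
  assumes M: "left_module R M" and N: "left_module R N"
    and h: "h \<in> lin_maps R M N" "bij_betw h (carrier M) (carrier N)"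
  obtains h' where "h' \<in> lin_maps R N M" "bij_betw h' (carrier N) (carrier M)"
    "\<And>x. x \<in> carrier M \<Longrightarrow> h' (h x) = x" "\<And>y. y \<in> carrier N \<Longrightarrow> h (h' y) = y"
proof -
  have "\<zero>\<^bsub>M\<^esub> \<in> carrier M"
    using left_module_imp_abelian_group[OF M] by (simp add: abelian_group_def abelian_monoid.zero_closed)
  moreover have im: "h ` carrier M = carrier N" and inj: "inj_on h (carrier M)"
    using h(2) unfolding bij_betw_def by auto
  ultimately have ker: "\<forall>x\<in>carrier M. h x = \<zero>\<^bsub>N\<^esub> \<longrightarrow> (\<lambda>x\<in>carrier M. x) x = \<zero>\<^bsub>M\<^esub>"
    using inj_onD[OF inj, of _ "\<zero>\<^bsub>M\<^esub>"] lin_maps_zero[OF M N h(1)] by simp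
  have "\<exists>h'\<in>lin_maps R N M. \<forall>x\<in>carrier M. h' (h x) = x"
    by (rule lin_map_factor[OF M N M h(1) im lin_maps_id[OF M] ker]) (intro bexI ballI, simp_all)
  then obtain h' where h': "h' \<in> lin_maps R N M" and all: "\<forall>x\<in>carrier M. h' (h x) = x" ..
  have h'h: "h' (h x) = x" if "x \<in> carrier M" for x
    using all that ..
  moreover have hh': "h (h' y) = y" if "y \<in> carrier N" for y
  proof -
    have "y \<in> h ` carrier M" using that im by simp
    then obtain x where "y = h x" "x \<in> carrier M" by (rule imageE)
    then show ?thesis using h'h by simp
  qed
  moreover have "bij_betw h' (carrier N) (carrier M)"
    by (rule bij_betw_byWitness[of _ h])
       (use h'h hh' lin_maps_closed[OF h(1)] lin_maps_closed[OF h'] in auto)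
  ultimately show thesis using that h' by blast
qed


section \<open>Submodules, quotients and transport of structure\<close>

definition is_submodule :: "'r ring \<Rightarrow> ('r, 'm) module \<Rightarrow> 'm set \<Rightarrow> bool" where
  "is_submodule R M S \<longleftrightarrow> S \<subseteq> carrier M \<and> \<zero>\<^bsub>M\<^esub> \<in> S \<and> (\<forall>x\<in>S. \<forall>y\<in>S. x \<oplus>\<^bsub>M\<^esub> y \<in> S) \<and>
     (\<forall>r\<in>carrier R. \<forall>x\<in>S. r \<odot>\<^bsub>M\<^esub> x \<in> S)"

lemma is_submodule_neg:
  assumes "left_module R M" "is_submodule R M S" "x \<in> S"
  shows "\<ominus>\<^bsub>M\<^esub> x \<in> S"
proof -
  interpret R: ring R using assms(1) by (rule left_module_imp_ring)
  have "x \<in> carrier M" using assms unfolding is_submodule_def by blast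
  moreover have "(\<ominus>\<^bsub>R\<^esub> \<one>\<^bsub>R\<^esub>) \<odot>\<^bsub>M\<^esub> x \<in> S"
    using assms(2,3) unfolding is_submodule_def by simp
  ultimately show ?thesis by (simp add: minus_one_smult[OF assms(1)])
qed

lemma left_module_submodule:
  assumes M: "left_module R M" and S: "is_submodule R M S"
  shows "left_module R (M\<lparr>carrier := S\<rparr>)"
proof -
  interpret R: ring R using M by (rule left_module_imp_ring)
  interpret M: abelian_group M using M by (rule left_module_imp_abelian_group)
  have sub: "x \<in> carrier M" if "x \<in> S" for x using that S unfolding is_submodule_def by blast
  have "abelian_group (M\<lparr>carrier := S\<rparr>)"
  proof (rule abelian_groupI)
    fix x assume x: "x \<in> carrier (M\<lparr>carrier := S\<rparr>)"
    show "\<exists>y\<in>carrier (M\<lparr>carrier := S\<rparr>). y \<oplus>\<^bsub>M\<lparr>carrier := S\<rparr>\<^esub> x = \<zero>\<^bsub>M\<lparr>carrier := S\<rparr>\<^esub>"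
      using is_submodule_neg[OF M S, of x] x sub by (auto simp: M.l_neg intro!: bexI[of _ "\<ominus>\<^bsub>M\<^esub> x"])
  qed (use S sub in \<open>auto simp: is_submodule_def M.a_ac\<close>)
  then show ?thesis
    using S sub R.ring_axioms left_module.smult_l_distr[OF M] left_module.smult_r_distr[OF M]
      left_module.smult_assoc1[OF M] left_module.smult_one[OF M]
    by (intro left_module.intro left_module_axioms.intro) (auto simp: is_submodule_def)
qed

lemma lin_maps_restrict:
  assumes "left_module R M" "is_submodule R M S" "f \<in> lin_maps R M N"
  shows "restrict f S \<in> lin_maps R (M\<lparr>carrier := S\<rparr>) N"
  using assms(2) lin_maps_closed[OF assms(3)] lin_maps_add[OF assms(3)] lin_maps_smult[OF assms(3)]
  by (intro lin_mapsI) (auto simp: is_submodule_def subset_iff)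

lemma lin_maps_corestrict:
  assumes "f \<in> lin_maps R M N" "\<And>x. x \<in> carrier M \<Longrightarrow> f x \<in> S"
  shows "f \<in> lin_maps R M (N\<lparr>carrier := S\<rparr>)"
  using assms(2) lin_maps_add[OF assms(1)] lin_maps_smult[OF assms(1)] lin_maps_outside[OF assms(1)]
  by (intro lin_mapsI) auto

lemma lin_maps_into_submodule:
  assumes "f \<in> lin_maps R M (N\<lparr>carrier := S\<rparr>)" "S \<subseteq> carrier N"
  shows "f \<in> lin_maps R M N"
  using lin_maps_closed[OF assms(1)] lin_maps_add[OF assms(1)] lin_maps_smult[OF assms(1)]
    lin_maps_outside[OF assms(1)] assms(2)
  by (intro lin_mapsI) auto

lemma mem_a_kernel: "x \<in> a_kernel M N h \<longleftrightarrow> x \<in> carrier M \<and> h x = \<zero>\<^bsub>N\<^esub>"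
  by (simp add: a_kernel_def')

lemma is_submodule_kernel:
  assumes M: "left_module R M" and N: "left_module R N" and h: "h \<in> lin_maps R M N"
  shows "is_submodule R M (a_kernel M N h)"
proof -
  interpret M: abelian_group M using M by (rule left_module_imp_abelian_group)
  interpret N: abelian_group N using N by (rule left_module_imp_abelian_group)
  show ?thesis
    using left_module.smult_closed[OF M]
    by (auto simp: is_submodule_def mem_a_kernel lin_maps_zero[OF assms] lin_maps_add[OF h]
        lin_maps_smult[OF h] smult_zero[OF N])
qed

lemma is_submodule_image:
  assumes M: "left_module R M" and N: "left_module R N" and h: "h \<in> lin_maps R M N"
  shows "is_submodule R N (h ` carrier M)"
proof -
  interpret M: abelian_group M using M by (rule left_module_imp_abelian_group)
  show ?thesis
    unfolding is_submodule_def
  proof (intro conjI ballI)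
    show "h ` carrier M \<subseteq> carrier N" using lin_maps_closed[OF h] by auto
    show "\<zero>\<^bsub>N\<^esub> \<in> h ` carrier M" using lin_maps_zero[OF assms] M.zero_closed by (metis imageI)
    show "x \<oplus>\<^bsub>N\<^esub> y \<in> h ` carrier M" if xy: "x \<in> h ` carrier M" "y \<in> h ` carrier M" for x y
    proof -
      obtain a where a: "x = h a" "a \<in> carrier M" using xy(1) by blast
      obtain b where b: "y = h b" "b \<in> carrier M" using xy(2) by blast
      have "x \<oplus>\<^bsub>N\<^esub> y = h (a \<oplus>\<^bsub>M\<^esub> b)" using lin_maps_add[OF h a(2) b(2)] a(1) b(1) by simp
      then show ?thesis by (rule image_eqI) (rule M.a_closed[OF a(2) b(2)])
    qed
    show "r \<odot>\<^bsub>N\<^esub> x \<in> h ` carrier M" if r: "r \<in> carrier R" and x: "x \<in> h ` carrier M" for x r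
    proof -
      obtain a where a: "a \<in> carrier M" "x = h a" using x by blast
      then have "r \<odot>\<^bsub>N\<^esub> x = h (r \<odot>\<^bsub>M\<^esub> a)" using lin_maps_smult[OF h r a(1)] by simp
      then show ?thesis by (rule image_eqI) (rule left_module.smult_closed[OF M r a(1)])
    qed
  qed
qed

text \<open>
  Quotients and transported structures have operations that are pushed forward along a surjection; this
  spares the verification of the axioms for each of them.
\<close>

lemma left_module_surj_image:
  assumes M: "left_module R M" and surj: "h ` carrier M = carrier N"
    and add: "\<And>x y. x \<in> carrier M \<Longrightarrow> y \<in> carrier M \<Longrightarrow> h (x \<oplus>\<^bsub>M\<^esub> y) = h x \<oplus>\<^bsub>N\<^esub> h y"
    and smult: "\<And>r x. r \<in> carrier R \<Longrightarrow> x \<in> carrier M \<Longrightarrow> h (r \<odot>\<^bsub>M\<^esub> x) = r \<odot>\<^bsub>N\<^esub> h x"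
    and zero: "h \<zero>\<^bsub>M\<^esub> = \<zero>\<^bsub>N\<^esub>"
  shows "left_module R N"
proof -
  interpret R: ring R using M by (rule left_module_imp_ring)
  interpret M: abelian_group M using M by (rule left_module_imp_abelian_group)
  note sc = left_module.smult_closed[OF M]
  have E: "\<exists>x\<in>carrier M. y = h x" if "y \<in> carrier N" for y using that surj by auto
  have C: "h x \<in> carrier N" if "x \<in> carrier M" for x using that surj by auto
  have "abelian_group N"
  proof (rule abelian_groupI)
    show "\<zero>\<^bsub>N\<^esub> \<in> carrier N" using C[OF M.zero_closed] zero by simp
    fix x y z assume "x \<in> carrier N" "y \<in> carrier N" "z \<in> carrier N"
    then obtain a b c where *: "a \<in> carrier M" "b \<in> carrier M" "c \<in> carrier M" "x = h a" "y = h b" "z = h c"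
      by (meson E)
    show "x \<oplus>\<^bsub>N\<^esub> y \<in> carrier N" using * C[of "a \<oplus>\<^bsub>M\<^esub> b"] by (simp add: add)
    show "x \<oplus>\<^bsub>N\<^esub> y \<oplus>\<^bsub>N\<^esub> z = x \<oplus>\<^bsub>N\<^esub> (y \<oplus>\<^bsub>N\<^esub> z)" using * by (simp add: add[symmetric] M.a_assoc)
    show "x \<oplus>\<^bsub>N\<^esub> y = y \<oplus>\<^bsub>N\<^esub> x" using * by (simp add: add[symmetric] M.a_comm)
    show "\<zero>\<^bsub>N\<^esub> \<oplus>\<^bsub>N\<^esub> x = x" using * by (simp add: add[symmetric] zero[symmetric])
    show "\<exists>y\<in>carrier N. y \<oplus>\<^bsub>N\<^esub> x = \<zero>\<^bsub>N\<^esub>"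
      using * C[of "\<ominus>\<^bsub>M\<^esub> a"] by (intro bexI[of _ "h (\<ominus>\<^bsub>M\<^esub> a)"]) (simp_all add: add[symmetric] zero[symmetric] M.l_neg)
  qed
  moreover have "left_module_axioms R N"
  proof (rule left_module_axioms.intro)
    fix a b x y assume *: "a \<in> carrier R" "x \<in> carrier N"
    obtain x' where x: "x' \<in> carrier M" "x = h x'" using E[OF *(2)] by auto
    show "a \<odot>\<^bsub>N\<^esub> x \<in> carrier N" using x C[of "a \<odot>\<^bsub>M\<^esub> x'"] * sc by (simp add: smult)
    show "(a \<oplus>\<^bsub>R\<^esub> b) \<odot>\<^bsub>N\<^esub> x = a \<odot>\<^bsub>N\<^esub> x \<oplus>\<^bsub>N\<^esub> b \<odot>\<^bsub>N\<^esub> x" if "b \<in> carrier R"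
      using x that * sc by (simp add: smult[symmetric] add[symmetric] left_module.smult_l_distr[OF M])
    show "a \<odot>\<^bsub>N\<^esub> (x \<oplus>\<^bsub>N\<^esub> y) = a \<odot>\<^bsub>N\<^esub> x \<oplus>\<^bsub>N\<^esub> a \<odot>\<^bsub>N\<^esub> y" if y: "y \<in> carrier N"
    proof -
      obtain y' where "y' \<in> carrier M" "y = h y'" using E[OF y] by auto
      then show ?thesis
        using x * sc by (simp add: smult[symmetric] add[symmetric] left_module.smult_r_distr[OF M])
    qed
    show "(a \<otimes>\<^bsub>R\<^esub> b) \<odot>\<^bsub>N\<^esub> x = a \<odot>\<^bsub>N\<^esub> (b \<odot>\<^bsub>N\<^esub> x)" if "b \<in> carrier R"
      using x that * sc by (simp add: smult[symmetric] left_module.smult_assoc1[OF M])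
  next
    fix x assume "x \<in> carrier N"
    then obtain x' where "x' \<in> carrier M" "x = h x'" using E by auto
    then show "\<one>\<^bsub>R\<^esub> \<odot>\<^bsub>N\<^esub> x = x" by (simp add: smult[symmetric] left_module.smult_one[OF M])
  qed
  ultimately show ?thesis using R.ring_axioms by (simp add: left_module_def)
qed

lemma transport_to_universe:
  fixes M :: "('r, 'm) module"
  assumes M: "left_module R M" and small: "carrier M \<prec> (UNIV :: 'u set)"
  obtains N :: "('r, 'u) module" and h where "N \<in> Modules R" "h \<in> lin_maps R M N"
    "bij_betw h (carrier M) (carrier N)"
proof -
  interpret M: abelian_group M using M by (rule left_module_imp_abelian_group)
  obtain i :: "'m \<Rightarrow> 'u" where i: "inj_on i (carrier M)"
    using small unfolding lesspoll_def lepoll_def by blast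
  let ?j = "inv_into (carrier M) i"
  have j: "?j (i x) = x" if "x \<in> carrier M" for x using i that by simp
  define N :: "('r, 'u) module" where
    "N = \<lparr>carrier = i ` carrier M, monoid.mult = undefined, monoid.one = undefined,
      ring.zero = i \<zero>\<^bsub>M\<^esub>, add = (\<lambda>x y. i (?j x \<oplus>\<^bsub>M\<^esub> ?j y)), smult = (\<lambda>r x. i (r \<odot>\<^bsub>M\<^esub> ?j x))\<rparr>"
  have "left_module R N"
    by (rule left_module_surj_image[OF M, of i]) (simp_all add: N_def j)
  moreover have "carrier N \<prec> (UNIV :: 'u set)"
    using small image_lepoll lesspoll_trans1 unfolding N_def by fastforce
  moreover have "restrict i (carrier M) \<in> lin_maps R M N"
    using left_module.smult_closed[OF M] by (intro lin_mapsI) (simp_all add: N_def j)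
  moreover have "bij_betw (restrict i (carrier M)) (carrier M) (carrier N)"
    using i by (simp add: bij_betw_def N_def)
  ultimately show thesis using that unfolding Modules_def by blast
qed

lemma quot_module_projection:
  assumes M: "left_module R M" and S: "is_submodule R M S"
  shows "left_module R (quot_module M S)"
    and "(\<lambda>x\<in>carrier M. S +>\<^bsub>M\<^esub> x) \<in> lin_maps R M (quot_module M S)"
    and "(\<lambda>x\<in>carrier M. S +>\<^bsub>M\<^esub> x) ` carrier M = carrier (quot_module M S)"
    and "x \<in> carrier M \<Longrightarrow> S +>\<^bsub>M\<^esub> x = \<zero>\<^bsub>quot_module M S\<^esub> \<longleftrightarrow> x \<in> S"
proof -
  interpret M: abelian_group M using M by (rule left_module_imp_abelian_group)
  have sub: "S \<subseteq> carrier M" using S unfolding is_submodule_def by blast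
  have sg: "subgroup S (add_monoid M)"
    using S is_submodule_neg[OF M S] unfolding is_submodule_def
    by (intro group.subgroupI[OF M.a_group]) (auto simp flip: a_inv_def)
  interpret abelian_subgroup S M
    by (rule abelian_subgroupI3) (auto intro: additive_subgroup.intro sg M.abelian_group_axioms)
  have eq: "S +>\<^bsub>M\<^esub> y = S +>\<^bsub>M\<^esub> x" if "y \<in> S +>\<^bsub>M\<^esub> x" "x \<in> carrier M" for x y
    using M.a_repr_independence[OF that sg] by simp
  let ?h = "\<lambda>x\<in>carrier M. S +>\<^bsub>M\<^esub> x"
  show surj: "?h ` carrier M = carrier (quot_module M S)"
    by (auto simp: quot_module_def A_RCOSETS_def')
  have smult: "(\<Union>y\<in>S +>\<^bsub>M\<^esub> x. S +>\<^bsub>M\<^esub> (r \<odot>\<^bsub>M\<^esub> y)) = S +>\<^bsub>M\<^esub> (r \<odot>\<^bsub>M\<^esub> x)"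
    if r: "r \<in> carrier R" and x: "x \<in> carrier M" for r x
  proof -
    have "S +>\<^bsub>M\<^esub> (r \<odot>\<^bsub>M\<^esub> y) = S +>\<^bsub>M\<^esub> (r \<odot>\<^bsub>M\<^esub> x)" if "y \<in> S +>\<^bsub>M\<^esub> x" for y
    proof (rule eq)
      have "\<exists>s\<in>S. y = s \<oplus>\<^bsub>M\<^esub> x" using that by (simp add: a_r_coset_def')
      then obtain s where s: "s \<in> S" "y = s \<oplus>\<^bsub>M\<^esub> x" ..
      then have "r \<odot>\<^bsub>M\<^esub> y = r \<odot>\<^bsub>M\<^esub> s \<oplus>\<^bsub>M\<^esub> r \<odot>\<^bsub>M\<^esub> x"
        using r x sub by (simp add: left_module.smult_r_distr[OF M] subset_iff)
      moreover have "r \<odot>\<^bsub>M\<^esub> s \<in> S" using S r s unfolding is_submodule_def by blast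
      ultimately show "r \<odot>\<^bsub>M\<^esub> y \<in> S +>\<^bsub>M\<^esub> (r \<odot>\<^bsub>M\<^esub> x)" by (auto simp: a_r_coset_def')
    qed (use r x left_module.smult_closed[OF M] in blast)
    moreover have "x \<in> S +>\<^bsub>M\<^esub> x" using a_rcos_self[OF x] .
    ultimately show ?thesis by blast
  qed
  have z: "S +>\<^bsub>M\<^esub> \<zero>\<^bsub>M\<^esub> = S" by (rule M.a_coset_join2) (use sg S in \<open>auto simp: is_submodule_def\<close>)
  show "left_module R (quot_module M S)"
    by (rule left_module_surj_image[OF M surj])
       (use left_module.smult_closed[OF M] in \<open>simp_all add: quot_module_def a_rcos_sum smult z\<close>)
  show "?h \<in> lin_maps R M (quot_module M S)"
    using surj left_module.smult_closed[OF M]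
    by (intro lin_mapsI) (auto simp: quot_module_def a_rcos_sum smult A_RCOSETS_def')
  show "S +>\<^bsub>M\<^esub> x = \<zero>\<^bsub>quot_module M S\<^esub> \<longleftrightarrow> x \<in> S" if "x \<in> carrier M"
    using M.a_coset_join1[OF _ that sg] M.a_coset_join2[OF that sg] by (auto simp: quot_module_def)
qed

text \<open>
  The cokernel of a morphism is given up to isomorphism as a module of cosets. The right-hand side avoids
  the type of cosets and can be composed with other linear maps.
\<close>

lemma module_iso_quot_iff:
  assumes M: "left_module R M" and S: "is_submodule R M S" and Q: "left_module R Q"
  shows "module_iso R Q (quot_module M S) \<longleftrightarrow>
    (\<exists>p\<in>lin_maps R M Q. p ` carrier M = carrier Q \<and> (\<forall>x\<in>carrier M. p x = \<zero>\<^bsub>Q\<^esub> \<longleftrightarrow> x \<in> S))"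
proof
  note q = quot_module_projection[OF M S]
  let ?q = "\<lambda>x\<in>carrier M. S +>\<^bsub>M\<^esub> x"
  {
    assume "module_iso R Q (quot_module M S)"
    then obtain h where h: "h \<in> lin_maps R Q (quot_module M S)" "bij_betw h (carrier Q) (carrier (quot_module M S))"
      unfolding module_iso_def by blast
    obtain h' where h': "h' \<in> lin_maps R (quot_module M S) Q" "bij_betw h' (carrier (quot_module M S)) (carrier Q)"
      "\<And>y. y \<in> carrier (quot_module M S) \<Longrightarrow> h (h' y) = y"
      using lin_maps_inverse[OF Q q(1) h] by metis
    have inj: "h' y = \<zero>\<^bsub>Q\<^esub> \<longleftrightarrow> y = \<zero>\<^bsub>quot_module M S\<^esub>" if "y \<in> carrier (quot_module M S)" for y
      using h'(3)[OF that] lin_maps_zero[OF Q q(1) h(1)] lin_maps_zero[OF q(1) Q h'(1)] by metis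
    let ?p = "compose (carrier M) h' ?q"
    have "?p \<in> lin_maps R M Q" by (rule lin_maps_compose[OF M q(2) h'(1)])
    moreover have "?p ` carrier M = carrier Q"
    proof -
      have "?p ` carrier M = h' ` ?q ` carrier M" by (auto simp: compose_def)
      then show ?thesis using q(3) h'(2) by (simp add: bij_betw_def)
    qed
    moreover have "?p x = \<zero>\<^bsub>Q\<^esub> \<longleftrightarrow> x \<in> S" if "x \<in> carrier M" for x
      using inj[of "S +>\<^bsub>M\<^esub> x"] q(4)[OF that] lin_maps_closed[OF q(2) that] that by (simp add: compose_def)
    ultimately show "\<exists>p\<in>lin_maps R M Q. p ` carrier M = carrier Q \<and> (\<forall>x\<in>carrier M. p x = \<zero>\<^bsub>Q\<^esub> \<longleftrightarrow> x \<in> S)"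
      by blast
  }
  assume "\<exists>p\<in>lin_maps R M Q. p ` carrier M = carrier Q \<and> (\<forall>x\<in>carrier M. p x = \<zero>\<^bsub>Q\<^esub> \<longleftrightarrow> x \<in> S)"
  then obtain p where p: "p \<in> lin_maps R M Q" "p ` carrier M = carrier Q"
    "\<And>x. x \<in> carrier M \<Longrightarrow> p x = \<zero>\<^bsub>Q\<^esub> \<longleftrightarrow> x \<in> S" by blast
  have "\<forall>x\<in>carrier M. p x = \<zero>\<^bsub>Q\<^esub> \<longrightarrow> ?q x = \<zero>\<^bsub>quot_module M S\<^esub>"
    using p(3) q(4) by simp
  then obtain h where h: "h \<in> lin_maps R Q (quot_module M S)" "\<And>x. x \<in> carrier M \<Longrightarrow> h (p x) = ?q x"
    using lin_map_factor[OF M Q q(1) p(1,2) q(2)] by blast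
  have "\<forall>x\<in>carrier M. ?q x = \<zero>\<^bsub>quot_module M S\<^esub> \<longrightarrow> p x = \<zero>\<^bsub>Q\<^esub>"
    using p(3) q(4) by simp
  then obtain h' where h': "h' \<in> lin_maps R (quot_module M S) Q" "\<And>x. x \<in> carrier M \<Longrightarrow> h' (?q x) = p x"
    using lin_map_factor[OF M q(1) Q q(2,3) p(1)] by blast
  have "bij_betw h (carrier Q) (carrier (quot_module M S))"
  proof (rule bij_betw_byWitness[of _ h'])
    show "\<forall>y\<in>carrier Q. h' (h y) = y"
      using h(2) h'(2) by (simp flip: p(2))
    show "\<forall>y\<in>carrier (quot_module M S). h (h' y) = y"
      using h(2) h'(2) by (simp flip: q(3))
  qed (use lin_maps_closed[OF h(1)] lin_maps_closed[OF h'(1)] in auto)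
  then show "module_iso R Q (quot_module M S)" unfolding module_iso_def using h(1) by blast
qed

lemma module_iso_sym:
  assumes "left_module R M" "left_module R N" "module_iso R M N"
  shows "module_iso R N M"
proof -
  obtain h where "h \<in> lin_maps R M N" "bij_betw h (carrier M) (carrier N)"
    using assms(3) unfolding module_iso_def by blast
  then obtain h' where "h' \<in> lin_maps R N M" "bij_betw h' (carrier N) (carrier M)"
    by (rule lin_maps_inverse[OF assms(1,2)])
  then show ?thesis unfolding module_iso_def by blast
qed


section \<open>Free modules\<close>

lemma mem_free_cover:
  "p \<in> carrier (free_cover R M) \<longleftrightarrow>
    (\<forall>x. p x \<in> carrier R) \<and> (\<forall>x. x \<notin> carrier M \<longrightarrow> p x = \<zero>\<^bsub>R\<^esub>) \<and> finite {x. p x \<noteq> \<zero>\<^bsub>R\<^esub>}"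
  by (simp add: free_cover_def)

lemma free_cover_ops:
  "\<zero>\<^bsub>free_cover R M\<^esub> = (\<lambda>x. \<zero>\<^bsub>R\<^esub>)"
  "p \<oplus>\<^bsub>free_cover R M\<^esub> q = (\<lambda>x. p x \<oplus>\<^bsub>R\<^esub> q x)"
  "r \<odot>\<^bsub>free_cover R M\<^esub> p = (\<lambda>x. r \<otimes>\<^bsub>R\<^esub> p x)"
  by (simp_all add: free_cover_def)

lemma left_module_free_cover:
  assumes "ring R" shows "left_module R (free_cover R M)"
proof -
  interpret R: ring R by fact
  have supp_neg: "{x. \<ominus>\<^bsub>R\<^esub> p x \<noteq> \<zero>\<^bsub>R\<^esub>} \<subseteq> {x. p x \<noteq> \<zero>\<^bsub>R\<^esub>}" for p :: "'b \<Rightarrow> 'a" by auto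
  have add: "p \<oplus>\<^bsub>free_cover R M\<^esub> q \<in> carrier (free_cover R M)"
    if "p \<in> carrier (free_cover R M)" "q \<in> carrier (free_cover R M)" for p q
  proof -
    have "{x. p x \<oplus>\<^bsub>R\<^esub> q x \<noteq> \<zero>\<^bsub>R\<^esub>} \<subseteq> {x. p x \<noteq> \<zero>\<^bsub>R\<^esub>} \<union> {x. q x \<noteq> \<zero>\<^bsub>R\<^esub>}" by auto
    then have "finite {x. p x \<oplus>\<^bsub>R\<^esub> q x \<noteq> \<zero>\<^bsub>R\<^esub>}"
      using that by (auto simp: mem_free_cover intro: finite_subset)
    then show ?thesis using that by (simp add: mem_free_cover free_cover_ops)
  qed
  have smult: "r \<odot>\<^bsub>free_cover R M\<^esub> p \<in> carrier (free_cover R M)"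
    if "r \<in> carrier R" "p \<in> carrier (free_cover R M)" for r p
  proof -
    have "{x. r \<otimes>\<^bsub>R\<^esub> p x \<noteq> \<zero>\<^bsub>R\<^esub>} \<subseteq> {x. p x \<noteq> \<zero>\<^bsub>R\<^esub>}" using that(1) by auto
    then have "finite {x. r \<otimes>\<^bsub>R\<^esub> p x \<noteq> \<zero>\<^bsub>R\<^esub>}"
      using that by (auto simp: mem_free_cover intro: finite_subset)
    then show ?thesis using that by (simp add: mem_free_cover free_cover_ops)
  qed
  have "abelian_group (free_cover R M)"
  proof (rule abelian_groupI)
    fix p assume p: "p \<in> carrier (free_cover R M)"
    show "\<exists>q\<in>carrier (free_cover R M). q \<oplus>\<^bsub>free_cover R M\<^esub> p = \<zero>\<^bsub>free_cover R M\<^esub>"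
    proof
      show "(\<lambda>x. \<ominus>\<^bsub>R\<^esub> p x) \<in> carrier (free_cover R M)"
        using p finite_subset[OF supp_neg[of p]] by (simp add: mem_free_cover)
    qed (use p in \<open>simp add: mem_free_cover free_cover_ops R.l_neg\<close>)
  qed (simp_all add: add, simp_all add: mem_free_cover free_cover_ops R.a_ac)
  then show ?thesis
    using smult R.ring_axioms
    by (intro left_module.intro left_module_axioms.intro)
       (simp_all, simp_all add: mem_free_cover free_cover_ops R.l_distr R.r_distr R.m_assoc)
qed

definition free_gen :: "'r ring \<Rightarrow> 'm \<Rightarrow> 'm \<Rightarrow> 'r" where
  "free_gen R m = (\<lambda>x. if x = m then \<one>\<^bsub>R\<^esub> else \<zero>\<^bsub>R\<^esub>)"

lemma free_gen_closed:
  assumes "ring R" "m \<in> carrier M" shows "free_gen R m \<in> carrier (free_cover R M)"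
proof -
  interpret R: ring R by fact
  have "{x. free_gen R m x \<noteq> \<zero>\<^bsub>R\<^esub>} \<subseteq> {m}" by (auto simp: free_gen_def)
  then have "finite {x. free_gen R m x \<noteq> \<zero>\<^bsub>R\<^esub>}" by (rule finite_subset) simp
  then show ?thesis using assms(2) by (auto simp: mem_free_cover free_gen_def)
qed

lemma free_cover_induct:
  assumes "ring R" and p: "p \<in> carrier (free_cover R M)"
    and zero: "Q \<zero>\<^bsub>free_cover R M\<^esub>"
    and step: "\<And>p r m. p \<in> carrier (free_cover R M) \<Longrightarrow> Q p \<Longrightarrow> r \<in> carrier R \<Longrightarrow> m \<in> carrier M \<Longrightarrow>
      Q (p \<oplus>\<^bsub>free_cover R M\<^esub> r \<odot>\<^bsub>free_cover R M\<^esub> free_gen R m)"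
  shows "Q p"
proof -
  interpret R: ring R by fact
  have "{x. p x \<noteq> \<zero>\<^bsub>R\<^esub>} = A \<longrightarrow> p \<in> carrier (free_cover R M) \<longrightarrow> Q p" if "finite A" for A p
    using that
  proof (induction A arbitrary: p rule: finite_induct)
    case empty
    show ?case
    proof (intro impI)
      assume "{x. p x \<noteq> \<zero>\<^bsub>R\<^esub>} = {}"
      then have "p = \<zero>\<^bsub>free_cover R M\<^esub>" by (auto simp: free_cover_ops)
      then show "Q p" using zero by simp
    qed
  next
    case (insert m A)
    show ?case
    proof (intro impI)
      assume supp: "{x. p x \<noteq> \<zero>\<^bsub>R\<^esub>} = insert m A" and p: "p \<in> carrier (free_cover R M)"
      let ?q = "p(m := \<zero>\<^bsub>R\<^esub>)"
      have A: "{x. ?q x \<noteq> \<zero>\<^bsub>R\<^esub>} = A" using supp insert.hyps(2) by auto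
      have q: "?q \<in> carrier (free_cover R M)"
        using p A insert.hyps(1) by (auto simp: mem_free_cover)
      have m: "m \<in> carrier M" "p m \<in> carrier R" using supp p by (auto simp: mem_free_cover)
      have "p x = (?q \<oplus>\<^bsub>free_cover R M\<^esub> p m \<odot>\<^bsub>free_cover R M\<^esub> free_gen R m) x" for x
        using p by (simp add: free_cover_ops free_gen_def mem_free_cover)
      then have "p = ?q \<oplus>\<^bsub>free_cover R M\<^esub> p m \<odot>\<^bsub>free_cover R M\<^esub> free_gen R m" by (rule ext)
      moreover have "Q ?q" using insert.IH[of ?q] A q by blast
      ultimately show "Q p" using step[OF q _ m(2,1)] by simp
    qed
  qed
  from this[of "{x. p x \<noteq> \<zero>\<^bsub>R\<^esub>}" p] show ?thesis using p by (simp add: mem_free_cover)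
qed

lemma lin_maps_free_cover_eqI:
  assumes "ring R" and N: "left_module R N"
    and f: "f \<in> lin_maps R (free_cover R M) N" and g: "g \<in> lin_maps R (free_cover R M) N"
    and eq: "\<And>m. m \<in> carrier M \<Longrightarrow> f (free_gen R m) = g (free_gen R m)"
  shows "f = g"
proof (rule lin_maps_eqI[OF f g])
  note F = left_module_free_cover[OF assms(1), of M]
  fix p assume "p \<in> carrier (free_cover R M)"
  then show "f p = g p"
  proof (rule free_cover_induct[OF assms(1)])
    show "f \<zero>\<^bsub>free_cover R M\<^esub> = g \<zero>\<^bsub>free_cover R M\<^esub>"
      by (simp add: lin_maps_zero[OF F N f] lin_maps_zero[OF F N g])
    fix p r m assume *: "p \<in> carrier (free_cover R M)" "f p = g p" "r \<in> carrier R" "m \<in> carrier M"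
    note gen = free_gen_closed[OF assms(1) *(4)]
    note sgen = left_module.smult_closed[OF F *(3) gen]
    show "f (p \<oplus>\<^bsub>free_cover R M\<^esub> r \<odot>\<^bsub>free_cover R M\<^esub> free_gen R m) =
        g (p \<oplus>\<^bsub>free_cover R M\<^esub> r \<odot>\<^bsub>free_cover R M\<^esub> free_gen R m)"
      using * eq[OF *(4)]
      by (simp add: lin_maps_add[OF f *(1) sgen] lin_maps_add[OF g *(1) sgen]
          lin_maps_smult[OF f *(3) gen] lin_maps_smult[OF g *(3) gen])
  qed
qed

text \<open>
  The universal property of the free module. For \<open>t\<close> the identity on \<open>M\<close> this is the map
  \<open>free_cover_map\<close>, made extensional.
\<close>

definition lin_ext ::
  "'r ring \<Rightarrow> ('r, 'm) module \<Rightarrow> ('r, 'n) module \<Rightarrow> ('m \<Rightarrow> 'n) \<Rightarrow> ('m \<Rightarrow> 'r) \<Rightarrow> 'n" where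
  "lin_ext R M N t =
     (\<lambda>p\<in>carrier (free_cover R M). finsum N (\<lambda>x. p x \<odot>\<^bsub>N\<^esub> t x) {x. p x \<noteq> \<zero>\<^bsub>R\<^esub>})"

text \<open>Summing over a larger finite set makes sums for different \<open>p\<close> comparable.\<close>

lemma lin_ext_eq_finsum:
  assumes N: "left_module R N" and t: "\<forall>m\<in>carrier M. t m \<in> carrier N"
    and p: "p \<in> carrier (free_cover R M)"
    and A: "finite A" "{x. p x \<noteq> \<zero>\<^bsub>R\<^esub>} \<subseteq> A" "A \<subseteq> carrier M"
  shows "lin_ext R M N t p = finsum N (\<lambda>x. p x \<odot>\<^bsub>N\<^esub> t x) A"
proof -
  interpret N: abelian_group N using N by (rule left_module_imp_abelian_group)
  have "finsum N (\<lambda>x. p x \<odot>\<^bsub>N\<^esub> t x) {x. p x \<noteq> \<zero>\<^bsub>R\<^esub>} = finsum N (\<lambda>x. p x \<odot>\<^bsub>N\<^esub> t x) A"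
  proof (rule N.add.finprod_mono_neutral_cong_left[OF A(1,2)])
    fix x assume x: "x \<in> A - {x. p x \<noteq> \<zero>\<^bsub>R\<^esub>}"
    then have "t x \<in> carrier N" using t A(3) by blast
    then show "p x \<odot>\<^bsub>N\<^esub> t x = \<zero>\<^bsub>N\<^esub>" using x zero_smult[OF N] by simp
  next
    show "(\<lambda>x. p x \<odot>\<^bsub>N\<^esub> t x) \<in> A \<rightarrow> carrier N"
      using t A(3) p left_module.smult_closed[OF N] by (auto simp: mem_free_cover)
  qed simp
  then show ?thesis using p by (simp add: lin_ext_def)
qed

lemma finsum_smult:
  assumes N: "left_module R N" and r: "r \<in> carrier R" and "finite A" "f \<in> A \<rightarrow> carrier N"
  shows "r \<odot>\<^bsub>N\<^esub> finsum N f A = finsum N (\<lambda>x. r \<odot>\<^bsub>N\<^esub> f x) A"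
proof -
  interpret N: abelian_group N using N by (rule left_module_imp_abelian_group)
  show ?thesis
    using assms(3,4)
  proof (induction A rule: finite_induct)
    case empty
    then show ?case using smult_zero[OF N r] by simp
  next
    case (insert x A)
    then have "f x \<in> carrier N" "f \<in> A \<rightarrow> carrier N" by auto
    then show ?case
      using insert left_module.smult_closed[OF N r]
      by (simp add: left_module.smult_r_distr[OF N r] N.finsum_closed Pi_def)
  qed
qed

lemma lin_ext_lin_maps:
  assumes N: "left_module R N" and t: "\<forall>m\<in>carrier M. t m \<in> carrier N"
  shows "lin_ext R M N t \<in> lin_maps R (free_cover R M) N"
proof -
  interpret N: abelian_group N using N by (rule left_module_imp_abelian_group)
  interpret R: ring R using N by (rule left_module_imp_ring)
  note F = left_module_free_cover[OF R.ring_axioms, of M]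
  interpret F: abelian_group "free_cover R M" using F by (rule left_module_imp_abelian_group)
  have supp: "finite {x. p x \<noteq> \<zero>\<^bsub>R\<^esub>}" "{x. p x \<noteq> \<zero>\<^bsub>R\<^esub>} \<subseteq> carrier M" "\<And>x. p x \<in> carrier R"
    if "p \<in> carrier (free_cover R M)" for p
    using that by (auto simp: mem_free_cover)
  have term_closed: "p x \<odot>\<^bsub>N\<^esub> t x \<in> carrier N" if "p \<in> carrier (free_cover R M)" "x \<in> carrier M" for p x
    using left_module.smult_closed[OF N supp(3)[OF that(1)] bspec[OF t that(2)]] .
  show ?thesis
  proof (rule lin_mapsI)
    fix p assume p: "p \<in> carrier (free_cover R M)"
    show "lin_ext R M N t p \<in> carrier N"
    proof -
      have "(\<lambda>x. p x \<odot>\<^bsub>N\<^esub> t x) \<in> {x. p x \<noteq> \<zero>\<^bsub>R\<^esub>} \<rightarrow> carrier N"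
        using term_closed[OF p] supp(2)[OF p] by blast
      then show ?thesis
        using N.finsum_closed p by (simp add: lin_ext_def)
    qed
  next
    fix p q assume p: "p \<in> carrier (free_cover R M)" and q: "q \<in> carrier (free_cover R M)"
    let ?A = "{x. p x \<noteq> \<zero>\<^bsub>R\<^esub>} \<union> {x. q x \<noteq> \<zero>\<^bsub>R\<^esub>}"
    have A: "finite ?A" "?A \<subseteq> carrier M" using supp(1,2)[OF p] supp(1,2)[OF q] by auto
    let ?s = "p \<oplus>\<^bsub>free_cover R M\<^esub> q"
    have "{x. ?s x \<noteq> \<zero>\<^bsub>R\<^esub>} \<subseteq> ?A" by (auto simp: free_cover_ops)
    then have "lin_ext R M N t ?s = finsum N (\<lambda>x. ?s x \<odot>\<^bsub>N\<^esub> t x) ?A"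
      by (rule lin_ext_eq_finsum[OF N t F.a_closed[OF p q] A(1) _ A(2)])
    also have "\<dots> = finsum N (\<lambda>x. p x \<odot>\<^bsub>N\<^esub> t x \<oplus>\<^bsub>N\<^esub> q x \<odot>\<^bsub>N\<^esub> t x) ?A"
    proof (rule N.finsum_cong'[OF refl])
      show "(\<lambda>x. p x \<odot>\<^bsub>N\<^esub> t x \<oplus>\<^bsub>N\<^esub> q x \<odot>\<^bsub>N\<^esub> t x) \<in> ?A \<rightarrow> carrier N"
        using term_closed[OF p] term_closed[OF q] A(2) by blast
      fix x assume "x \<in> ?A"
      then have "t x \<in> carrier N" using A(2) t by blast
      then show "?s x \<odot>\<^bsub>N\<^esub> t x = p x \<odot>\<^bsub>N\<^esub> t x \<oplus>\<^bsub>N\<^esub> q x \<odot>\<^bsub>N\<^esub> t x"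
        using left_module.smult_l_distr[OF N supp(3)[OF p] supp(3)[OF q]] by (simp add: free_cover_ops)
    qed
    also have "\<dots> = finsum N (\<lambda>x. p x \<odot>\<^bsub>N\<^esub> t x) ?A \<oplus>\<^bsub>N\<^esub> finsum N (\<lambda>x. q x \<odot>\<^bsub>N\<^esub> t x) ?A"
      by (rule N.finsum_addf) (use term_closed[OF p] term_closed[OF q] A(2) in blast)+
    also have "\<dots> = lin_ext R M N t p \<oplus>\<^bsub>N\<^esub> lin_ext R M N t q"
      using lin_ext_eq_finsum[OF N t p A(1) _ A(2)] lin_ext_eq_finsum[OF N t q A(1) _ A(2)] by simp
    finally show "lin_ext R M N t ?s = lin_ext R M N t p \<oplus>\<^bsub>N\<^esub> lin_ext R M N t q" .
  next
    fix r p assume r: "r \<in> carrier R" and p: "p \<in> carrier (free_cover R M)"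
    let ?A = "{x. p x \<noteq> \<zero>\<^bsub>R\<^esub>}" and ?s = "r \<odot>\<^bsub>free_cover R M\<^esub> p"
    have "{x. ?s x \<noteq> \<zero>\<^bsub>R\<^esub>} \<subseteq> ?A" using r by (auto simp: free_cover_ops)
    then have "lin_ext R M N t ?s = finsum N (\<lambda>x. ?s x \<odot>\<^bsub>N\<^esub> t x) ?A"
      by (rule lin_ext_eq_finsum[OF N t left_module.smult_closed[OF F r p] supp(1)[OF p] _ supp(2)[OF p]])
    also have "\<dots> = finsum N (\<lambda>x. r \<odot>\<^bsub>N\<^esub> (p x \<odot>\<^bsub>N\<^esub> t x)) ?A"
    proof (rule N.finsum_cong'[OF refl])
      show "(\<lambda>x. r \<odot>\<^bsub>N\<^esub> (p x \<odot>\<^bsub>N\<^esub> t x)) \<in> ?A \<rightarrow> carrier N"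
        using left_module.smult_closed[OF N r term_closed[OF p]] supp(2)[OF p] by blast
      fix x assume "x \<in> ?A"
      then have "t x \<in> carrier N" using supp(2)[OF p] t by blast
      then show "?s x \<odot>\<^bsub>N\<^esub> t x = r \<odot>\<^bsub>N\<^esub> (p x \<odot>\<^bsub>N\<^esub> t x)"
        using left_module.smult_assoc1[OF N r supp(3)[OF p]] by (simp add: free_cover_ops)
    qed
    also have "\<dots> = r \<odot>\<^bsub>N\<^esub> finsum N (\<lambda>x. p x \<odot>\<^bsub>N\<^esub> t x) ?A"
      by (rule finsum_smult[OF N r supp(1)[OF p], symmetric]) (use term_closed[OF p] supp(2)[OF p] in blast)
    also have "\<dots> = r \<odot>\<^bsub>N\<^esub> lin_ext R M N t p"
      using lin_ext_eq_finsum[OF N t p supp(1)[OF p] order_refl supp(2)[OF p]] by simp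
    finally show "lin_ext R M N t ?s = r \<odot>\<^bsub>N\<^esub> lin_ext R M N t p" .
  qed (simp add: lin_ext_def)
qed

lemma lin_ext_free_gen:
  assumes N: "left_module R N" and t: "\<forall>m\<in>carrier M. t m \<in> carrier N" and m: "m \<in> carrier M"
  shows "lin_ext R M N t (free_gen R m) = t m"
proof -
  interpret N: abelian_group N using N by (rule left_module_imp_abelian_group)
  have "lin_ext R M N t (free_gen R m) = finsum N (\<lambda>x. free_gen R m x \<odot>\<^bsub>N\<^esub> t x) {m}"
    by (rule lin_ext_eq_finsum[OF N t free_gen_closed[OF left_module_imp_ring[OF N] m]])
       (use m in \<open>auto simp: free_gen_def\<close>)
  also have "\<dots> = t m"
    using left_module.smult_one[OF N bspec[OF t m]] bspec[OF t m] by (simp add: free_gen_def)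
  finally show ?thesis .
qed

text \<open>Lift the values on the generators.\<close>

lemma free_cover_lift:
  assumes D: "left_module R D" and Y: "left_module R Y"
    and g: "g \<in> lin_maps R D Y" "g ` carrier D = carrier Y" and v: "v \<in> lin_maps R (free_cover R M) Y"
  obtains \<mu> where "\<mu> \<in> lin_maps R (free_cover R M) D"
    "\<And>p. p \<in> carrier (free_cover R M) \<Longrightarrow> g (\<mu> p) = v p"
proof -
  note ring = left_module_imp_ring[OF D]
  note F = left_module_free_cover[OF ring, of M]
  have "\<exists>a\<in>carrier D. g a = v (free_gen R m)" if "m \<in> carrier M" for m
  proof -
    have "v (free_gen R m) \<in> g ` carrier D"
      using lin_maps_closed[OF v free_gen_closed[OF ring that]] g(2) by simp
    then obtain a where "v (free_gen R m) = g a" "a \<in> carrier D" by (rule imageE)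
    then show ?thesis by (intro bexI[of _ a]) simp_all
  qed
  then have "\<forall>m\<in>carrier M. \<exists>a. a \<in> carrier D \<and> g a = v (free_gen R m)" by blast
  from bchoice[OF this] obtain t
    where t: "\<forall>m\<in>carrier M. t m \<in> carrier D \<and> g (t m) = v (free_gen R m)" ..
  then have tc: "\<forall>m\<in>carrier M. t m \<in> carrier D" by simp
  let ?\<mu> = "lin_ext R M D t"
  have \<mu>: "?\<mu> \<in> lin_maps R (free_cover R M) D" by (rule lin_ext_lin_maps[OF D tc])
  have "compose (carrier (free_cover R M)) g ?\<mu> = v"
    by (rule lin_maps_free_cover_eqI[OF ring Y lin_maps_compose[OF F \<mu> g(1)] v])
       (use t in \<open>simp add: compose_def free_gen_closed[OF ring] lin_ext_free_gen[OF D tc]\<close>)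
  then have "g (?\<mu> p) = v p" if "p \<in> carrier (free_cover R M)" for p
    using compose_eq[OF that, of g ?\<mu>] by simp
  then show thesis by (rule that[OF \<mu>])
qed

definition cover_map :: "'r ring \<Rightarrow> ('r, 'm) module \<Rightarrow> ('m \<Rightarrow> 'r) \<Rightarrow> 'm" where
  "cover_map R M = lin_ext R M M (\<lambda>x. x)"

lemma cover_map_lin_maps: "left_module R M \<Longrightarrow> cover_map R M \<in> lin_maps R (free_cover R M) M"
  unfolding cover_map_def by (rule lin_ext_lin_maps) simp_all

lemma cover_map_surj:
  assumes "left_module R M"
  shows "cover_map R M ` carrier (free_cover R M) = carrier M"
proof
  show "cover_map R M ` carrier (free_cover R M) \<subseteq> carrier M"
    using lin_maps_closed[OF cover_map_lin_maps[OF assms]] by auto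
  show "carrier M \<subseteq> cover_map R M ` carrier (free_cover R M)"
  proof
    fix m assume m: "m \<in> carrier M"
    have "cover_map R M (free_gen R m) = m"
      unfolding cover_map_def by (rule lin_ext_free_gen[OF assms _ m]) simp
    then show "m \<in> cover_map R M ` carrier (free_cover R M)"
      using imageI[OF free_gen_closed[OF left_module_imp_ring[OF assms] m], of "cover_map R M"] by simp
  qed
qed

text \<open>The extensional and the original covering map have the same kernel.\<close>

lemma relation_module_eq:
  "relation_module R M = (free_cover R M)\<lparr>carrier := a_kernel (free_cover R M) M (cover_map R M)\<rparr>"
proof -
  have "a_kernel (free_cover R M) M (free_cover_map R M) = a_kernel (free_cover R M) M (cover_map R M)"
    by (auto simp: mem_a_kernel free_cover_map_def cover_map_def lin_ext_def)
  then show ?thesis by (simp add: relation_module_def)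
qed

lemma mem_relation_module:
  "k \<in> carrier (relation_module R M) \<longleftrightarrow> k \<in> carrier (free_cover R M) \<and> cover_map R M k = \<zero>\<^bsub>M\<^esub>"
  by (simp add: relation_module_eq mem_a_kernel)

lemma is_submodule_relation_module:
  assumes "left_module R M"
  shows "is_submodule R (free_cover R M) (carrier (relation_module R M))"
  using is_submodule_kernel[OF left_module_free_cover[OF left_module_imp_ring[OF assms]] assms
      cover_map_lin_maps[OF assms]]
  by (simp add: relation_module_eq)

lemma relation_module_carrier_update:
  "relation_module R M = (free_cover R M)\<lparr>carrier := carrier (relation_module R M)\<rparr>"
  by (simp add: relation_module_eq)

lemma left_module_relation_module: "left_module R M \<Longrightarrow> left_module R (relation_module R M)"
  by (subst relation_module_carrier_update)
     (intro left_module_submodule left_module_free_cover is_submodule_relation_module left_module_imp_ring)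


section \<open>Vanishing of \<open>Ext\<^sup>1\<close>\<close>

lemma lin_maps_sum:
  assumes "left_module R M" "left_module R N" "f \<in> lin_maps R M N" "g \<in> lin_maps R M N"
  shows "(\<lambda>x\<in>carrier M. f x \<oplus>\<^bsub>N\<^esub> g x) \<in> lin_maps R M N"
proof -
  interpret M: abelian_group M using assms(1) by (rule left_module_imp_abelian_group)
  interpret N: abelian_group N using assms(2) by (rule left_module_imp_abelian_group)
  note fg = lin_maps_closed[OF assms(3)] lin_maps_closed[OF assms(4)]
  show ?thesis
    using fg left_module.smult_closed[OF assms(1)]
    by (intro lin_mapsI) (simp_all add: lin_maps_add[OF assms(3)] lin_maps_add[OF assms(4)]
        lin_maps_smult[OF assms(3)] lin_maps_smult[OF assms(4)] left_module.smult_r_distr[OF assms(2)] N.a_ac)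
qed

lemma comm_group_Hom_group:
  assumes M: "left_module R M" and N: "left_module R N"
  shows "comm_group (Hom_group R M N)"
proof -
  interpret M: abelian_group M using M by (rule left_module_imp_abelian_group)
  interpret N: abelian_group N using N by (rule left_module_imp_abelian_group)
  let ?H = "Hom_group R M N"
  show ?thesis
  proof (rule comm_groupI)
    fix f g h assume "f \<in> carrier (?H)" "g \<in> carrier (?H)" "h \<in> carrier (?H)"
    then have fgh: "f \<in> lin_maps R M N" "g \<in> lin_maps R M N" "h \<in> lin_maps R M N"
      by (simp_all add: Hom_group_def)
    note cl = lin_maps_closed[OF fgh(1)] lin_maps_closed[OF fgh(2)] lin_maps_closed[OF fgh(3)]
    show "f \<otimes>\<^bsub>?H\<^esub> g \<in> carrier (?H)"
      using lin_maps_sum[OF M N fgh(1,2)] by (simp add: Hom_group_def)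
    show "f \<otimes>\<^bsub>?H\<^esub> g \<otimes>\<^bsub>?H\<^esub> h = f \<otimes>\<^bsub>?H\<^esub> (g \<otimes>\<^bsub>?H\<^esub> h)"
      using cl by (auto simp: Hom_group_def N.a_assoc)
    show "f \<otimes>\<^bsub>?H\<^esub> g = g \<otimes>\<^bsub>?H\<^esub> f"
      using cl by (auto simp: Hom_group_def N.a_comm)
    show "\<one>\<^bsub>?H\<^esub> \<otimes>\<^bsub>?H\<^esub> f = f"
      using cl(1) lin_maps_outside[OF fgh(1)] by (auto simp: Hom_group_def)
    let ?n = "\<lambda>x\<in>carrier M. (\<lambda>x\<in>carrier M. \<zero>\<^bsub>N\<^esub>) x \<ominus>\<^bsub>N\<^esub> f x"
    show "\<exists>y\<in>carrier (?H). y \<otimes>\<^bsub>?H\<^esub> f = \<one>\<^bsub>?H\<^esub>"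
    proof
      show "?n \<in> carrier (?H)"
        using lin_maps_diff[OF M N lin_maps_zero_map[OF M N] fgh(1)] by (simp add: Hom_group_def)
      show "?n \<otimes>\<^bsub>?H\<^esub> f = \<one>\<^bsub>?H\<^esub>"
        using cl(1) by (auto simp: Hom_group_def a_minus_def N.l_neg)
    qed
  next
    show "\<one>\<^bsub>?H\<^esub> \<in> carrier (?H)"
      using lin_maps_zero_map[OF M N] by (simp add: Hom_group_def)
  qed
qed

lemma (in comm_group) trivial_group_FactGroup_iff:
  assumes H: "subgroup H G"
  shows "trivial_group (G Mod H) \<longleftrightarrow> carrier G \<subseteq> H"
proof -
  have "Group.group (G Mod H)"
    using H normal_iff_subgroup normal.factorgroup_is_group by blast
  moreover have "carrier (G Mod H) = {H} \<longleftrightarrow> carrier G \<subseteq> H"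
  proof
    assume *: "carrier (G Mod H) = {H}"
    show "carrier G \<subseteq> H"
    proof
      fix x assume x: "x \<in> carrier G"
      then have "H #> x \<in> carrier (G Mod H)" by (simp add: carrier_FactGroup)
      then show "x \<in> H" using * coset_join1[OF _ x H] by simp
    qed
  next
    assume "carrier G \<subseteq> H"
    then have "H #> x = H" if "x \<in> carrier G" for x using coset_join2[OF that H] that by blast
    then show "carrier (G Mod H) = {H}" using one_closed by (auto simp: carrier_FactGroup)
  qed
  ultimately show ?thesis by (simp add: trivial_group_def)
qed

text \<open>
  A cokernel of abelian groups is trivial exactly if the map is surjective; here the map is the
  restriction from the free cover to the relation module.
\<close>

lemma trivial_Ext1_iff:
  assumes M: "left_module R M" and N: "left_module R N"
  shows "trivial_group (Ext1 R M N) \<longleftrightarrow>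
    (\<forall>\<phi>\<in>lin_maps R (relation_module R M) N. \<exists>\<psi>\<in>lin_maps R (free_cover R M) N.
        \<forall>k\<in>carrier (relation_module R M). \<psi> k = \<phi> k)"
proof -
  let ?F = "free_cover R M" and ?K = "relation_module R M"
  note F = left_module_free_cover[OF left_module_imp_ring[OF M], of M]
  note K = left_module_relation_module[OF M]
  note S = is_submodule_relation_module[OF M]
  interpret HF: comm_group "Hom_group R ?F N" by (rule comm_group_Hom_group[OF F N])
  interpret HK: comm_group "Hom_group R ?K N" by (rule comm_group_Hom_group[OF K N])
  let ?res = "\<lambda>h. restrict h (carrier ?K)"
  have res: "?res h \<in> lin_maps R ?K N" if "h \<in> lin_maps R ?F N" for h
    using lin_maps_restrict[OF F S that] by (simp flip: relation_module_carrier_update)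
  have sub: "carrier ?K \<subseteq> carrier ?F" using S by (simp add: is_submodule_def)
  have "?res \<in> hom (Hom_group R ?F N) (Hom_group R ?K N)"
  proof (rule homI)
    fix f g show "?res (f \<otimes>\<^bsub>Hom_group R ?F N\<^esub> g) = ?res f \<otimes>\<^bsub>Hom_group R ?K N\<^esub> ?res g"
      using sub by (intro ext) (auto simp: Hom_group_def restrict_def)
  qed (use res in \<open>simp add: Hom_group_def\<close>)
  then interpret hom: group_hom "Hom_group R ?F N" "Hom_group R ?K N" ?res
    by (intro group_hom.intro group_hom_axioms.intro HF.is_group HK.is_group)
  have "subgroup (?res ` lin_maps R ?F N) (Hom_group R ?K N)"
    using hom.img_is_subgroup by (simp add: Hom_group_def)
  then have "trivial_group (Ext1 R M N) \<longleftrightarrow> lin_maps R ?K N \<subseteq> ?res ` lin_maps R ?F N"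
    unfolding Ext1_def by (simp add: HK.trivial_group_FactGroup_iff) (simp add: Hom_group_def)
  also have "\<dots> \<longleftrightarrow> (\<forall>\<phi>\<in>lin_maps R ?K N. \<exists>\<psi>\<in>lin_maps R ?F N. \<phi> = ?res \<psi>)"
    by (simp add: subset_iff image_iff Ball_def)
  also have "\<dots> \<longleftrightarrow> (\<forall>\<phi>\<in>lin_maps R ?K N. \<exists>\<psi>\<in>lin_maps R ?F N. \<forall>k\<in>carrier ?K. \<psi> k = \<phi> k)"
  proof (intro ball_cong bex_cong refl)
    fix \<phi> \<psi> assume "\<phi> \<in> lin_maps R ?K N" "\<psi> \<in> lin_maps R ?F N"
    then show "\<phi> = ?res \<psi> \<longleftrightarrow> (\<forall>k\<in>carrier ?K. \<psi> k = \<phi> k)"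
      using lin_maps_eqI[OF _ res, of \<phi> N \<psi>] by (metis restrict_apply')
  qed
  finally show ?thesis .
qed


section \<open>Lifting a monomorphism against an epimorphism\<close>

text \<open>
  Cover the cokernel \<open>Q\<close> by a free module \<open>P\<close> with relation module \<open>K\<close>. Lift \<open>P \<rightarrow> Q\<close> to \<open>l : P \<rightarrow> B\<close>, and
  lift \<open>v l\<close> to \<open>\<mu> : P \<rightarrow> D\<close>. On \<open>K\<close> the map \<open>l\<close> takes values in the image of \<open>f\<close>, and the maps \<open>\<mu>\<close> and
  \<open>u f\<inverse> l\<close> become equal after composition with \<open>g\<close>, so that they differ by a map \<open>\<phi>\<close> into the kernel of \<open>g\<close>.
  As \<open>Ext\<^sup>1\<close> vanishes, \<open>\<phi>\<close> extends to a map \<open>\<psi>\<close> on \<open>P\<close>. Then \<open>\<nu> = \<mu> - \<psi>\<close> agrees with \<open>u f\<inverse> l\<close> on \<open>K\<close>,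
  which makes \<open>l p + f a \<mapsto> \<nu> p + u a\<close> well defined; this is the desired lift, because \<open>l\<close> and \<open>f\<close>
  together cover \<open>B\<close>.
\<close>

lemma lift_of_trivial_Ext1:
  assumes A: "left_module R A" and B: "left_module R B" and Q: "left_module R Q"
    and D: "left_module R D" and Y: "left_module R Y"
    and f: "f \<in> lin_maps R A B" "inj_on f (carrier A)"
    and q: "q \<in> lin_maps R B Q" "q ` carrier B = carrier Q"
      "\<And>b. b \<in> carrier B \<Longrightarrow> q b = \<zero>\<^bsub>Q\<^esub> \<longleftrightarrow> b \<in> f ` carrier A"
    and g: "g \<in> lin_maps R D Y" "g ` carrier D = carrier Y"
    and ext: "trivial_group (Ext1 R Q (D\<lparr>carrier := a_kernel D Y g\<rparr>))"
    and u: "u \<in> lin_maps R A D" and v: "v \<in> lin_maps R B Y"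
    and square: "\<And>a. a \<in> carrier A \<Longrightarrow> g (u a) = v (f a)"
  shows "\<exists>d\<in>lin_maps R B D. (\<forall>a\<in>carrier A. d (f a) = u a) \<and> (\<forall>b\<in>carrier B. g (d b) = v b)"
proof -
  interpret A: abelian_group A using A by (rule left_module_imp_abelian_group)
  interpret B: abelian_group B using B by (rule left_module_imp_abelian_group)
  interpret D: abelian_group D using D by (rule left_module_imp_abelian_group)
  interpret Y: abelian_group Y using Y by (rule left_module_imp_abelian_group)
  interpret Q: abelian_group Q using Q by (rule left_module_imp_abelian_group)
  let ?P = "free_cover R Q" and ?K = "relation_module R Q" and ?\<pi> = "cover_map R Q"
  let ?N = "D\<lparr>carrier := a_kernel D Y g\<rparr>"
  note P = left_module_free_cover[OF left_module_imp_ring[OF Q], of Q]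
  interpret P: abelian_group ?P using P by (rule left_module_imp_abelian_group)
  note K = left_module_relation_module[OF Q]
  note KP = is_submodule_relation_module[OF Q]
  note \<pi> = cover_map_lin_maps[OF Q] cover_map_surj[OF Q]
  note N = left_module_submodule[OF D is_submodule_kernel[OF D Y g(1)]]
  obtain l where l: "l \<in> lin_maps R ?P B" "\<And>p. p \<in> carrier ?P \<Longrightarrow> q (l p) = ?\<pi> p"
    using free_cover_lift[OF B Q q(1,2) \<pi>(1)] by blast
  obtain \<mu> where \<mu>: "\<mu> \<in> lin_maps R ?P D"
    "\<And>p. p \<in> carrier ?P \<Longrightarrow> g (\<mu> p) = compose (carrier ?P) v l p"
    using free_cover_lift[OF D Y g lin_maps_compose[OF P l(1) v]] by blast
  have KsubP: "k \<in> carrier ?P" if "k \<in> carrier ?K" for k using that by (simp add: mem_relation_module)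
  note im = is_submodule_image[OF A B f(1)]
  note Bim = left_module_submodule[OF B im]
  have f_bij: "bij_betw f (carrier A) (carrier (B\<lparr>carrier := f ` carrier A\<rparr>))"
    using f(2) by (simp add: bij_betw_def)
  have f_im: "f \<in> lin_maps R A (B\<lparr>carrier := f ` carrier A\<rparr>)"
    by (rule lin_maps_corestrict[OF f(1)]) simp
  obtain f' where f': "f' \<in> lin_maps R (B\<lparr>carrier := f ` carrier A\<rparr>) A"
    "\<And>a. a \<in> carrier A \<Longrightarrow> f' (f a) = a"
    using lin_maps_inverse[OF A Bim f_im f_bij] by metis
  have lK: "l k \<in> f ` carrier A" if "k \<in> carrier ?K" for k
  proof -
    have "q (l k) = \<zero>\<^bsub>Q\<^esub>" using that by (simp add: l(2) mem_relation_module)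
    then show ?thesis using q(3) lin_maps_closed[OF l(1)] that by (simp add: mem_relation_module)
  qed
  have l_im: "restrict l (carrier ?K) \<in> lin_maps R ?K (B\<lparr>carrier := f ` carrier A\<rparr>)"
    by (rule lin_maps_corestrict) (use lin_maps_restrict[OF P KP l(1)] lK in \<open>simp_all flip: relation_module_carrier_update\<close>)
  (* The map f^-1 l on the relation module. *)
  let ?a = "compose (carrier ?K) f' (restrict l (carrier ?K))"
  have a: "?a \<in> lin_maps R ?K A" by (rule lin_maps_compose[OF K l_im f'(1)])
  have fa: "f (?a k) = l k" if k: "k \<in> carrier ?K" for k
  proof -
    obtain a where a: "l k = f a" "a \<in> carrier A" using lK[OF k] by (rule imageE)
    then show ?thesis using f'(2)[OF a(2)] k by (simp add: compose_def)
  qed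
  let ?ua = "compose (carrier ?K) u ?a"
  have ua: "?ua \<in> lin_maps R ?K D" by (rule lin_maps_compose[OF K a u])
  let ?\<phi> = "\<lambda>k\<in>carrier ?K. restrict \<mu> (carrier ?K) k \<ominus>\<^bsub>D\<^esub> ?ua k"
  have \<mu>K: "restrict \<mu> (carrier ?K) \<in> lin_maps R ?K D"
    using lin_maps_restrict[OF P KP \<mu>(1)] by (simp flip: relation_module_carrier_update)
  have "?\<phi> \<in> lin_maps R ?K ?N"
  proof (rule lin_maps_corestrict[OF lin_maps_diff[OF K D \<mu>K ua]])
    fix k assume k: "k \<in> carrier ?K"
    have "g (u (?a k)) = v (l k)" using square[OF lin_maps_closed[OF a k]] fa[OF k] by simp
    moreover have "g (\<mu> k) = v (l k)" using \<mu>(2)[OF KsubP[OF k]] KsubP[OF k] by (simp add: compose_def)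
    moreover have "g (\<mu> k \<ominus>\<^bsub>D\<^esub> u (?a k)) = g (\<mu> k) \<ominus>\<^bsub>Y\<^esub> g (u (?a k))"
      by (rule lin_maps_diff_apply[OF D Y g(1) lin_maps_closed[OF \<mu>(1) KsubP[OF k]]
            lin_maps_closed[OF u lin_maps_closed[OF a k]]])
    moreover have "v (l k) \<in> carrier Y" by (rule lin_maps_closed[OF v lin_maps_closed[OF l(1) KsubP[OF k]]])
    ultimately have "g (\<mu> k \<ominus>\<^bsub>D\<^esub> u (?a k)) = \<zero>\<^bsub>Y\<^esub>" by (simp add: a_minus_def Y.r_neg)
    moreover have "\<mu> k \<ominus>\<^bsub>D\<^esub> u (?a k) \<in> carrier D"
      using lin_maps_closed[OF \<mu>(1) KsubP[OF k]] lin_maps_closed[OF u lin_maps_closed[OF a k]] by simp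
    ultimately show "?\<phi> k \<in> a_kernel D Y g" using k by (simp add: mem_a_kernel compose_eq)
  qed
  then obtain \<psi> where \<psi>: "\<psi> \<in> lin_maps R ?P ?N" and \<psi>K: "\<forall>k\<in>carrier ?K. \<psi> k = ?\<phi> k"
    using ext unfolding trivial_Ext1_iff[OF Q N] by blast
  have \<psi>D: "\<psi> \<in> lin_maps R ?P D"
    by (rule lin_maps_into_submodule[OF \<psi>]) (auto simp: mem_a_kernel)
  let ?\<nu> = "\<lambda>p\<in>carrier ?P. \<mu> p \<ominus>\<^bsub>D\<^esub> \<psi> p"
  note \<nu> = lin_maps_diff[OF P D \<mu>(1) \<psi>D]
  have g\<nu>: "g (?\<nu> p) = v (l p)" if p: "p \<in> carrier ?P" for p
  proof -
    have "g (\<psi> p) = \<zero>\<^bsub>Y\<^esub>" using lin_maps_closed[OF \<psi> p] by (simp add: mem_a_kernel)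
    moreover have "g (\<mu> p) = v (l p)" using \<mu>(2)[OF p] p by (simp add: compose_def)
    moreover have "g (\<mu> p \<ominus>\<^bsub>D\<^esub> \<psi> p) = g (\<mu> p) \<ominus>\<^bsub>Y\<^esub> g (\<psi> p)"
      by (rule lin_maps_diff_apply[OF D Y g(1) lin_maps_closed[OF \<mu>(1) p] lin_maps_closed[OF \<psi>D p]])
    moreover have "v (l p) \<in> carrier Y" by (rule lin_maps_closed[OF v lin_maps_closed[OF l(1) p]])
    ultimately show ?thesis using p by (simp add: a_minus_def)
  qed
  have \<nu>K: "?\<nu> k = u (?a k)" if k: "k \<in> carrier ?K" for k
  proof -
    have "\<psi> k = \<mu> k \<ominus>\<^bsub>D\<^esub> u (?a k)" using \<psi>K k by (simp add: compose_eq)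
    moreover have "\<mu> k \<in> carrier D" "u (?a k) \<in> carrier D"
      using lin_maps_closed[OF \<mu>(1) KsubP[OF k]] lin_maps_closed[OF u lin_maps_closed[OF a k]] by blast+
    ultimately show ?thesis
      using KsubP[OF k] by (simp add: a_minus_def D.minus_add D.r_neg2)
  qed
  note lc = lin_maps_closed[OF l(1)] and \<nu>c = lin_maps_closed[OF \<nu>]
    and fc = lin_maps_closed[OF f(1)] and uc = lin_maps_closed[OF u]
  have decomp: "\<exists>p\<in>carrier ?P. \<exists>a\<in>carrier A. b = l p \<oplus>\<^bsub>B\<^esub> f a" if b: "b \<in> carrier B" for b
  proof -
    have "q b \<in> ?\<pi> ` carrier ?P" using lin_maps_closed[OF q(1) b] \<pi>(2) by simp
    then obtain p where p: "q b = ?\<pi> p" "p \<in> carrier ?P" by (rule imageE)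
    have "q (b \<ominus>\<^bsub>B\<^esub> l p) = \<zero>\<^bsub>Q\<^esub>"
      using lin_maps_diff_apply[OF B Q q(1) b lc[OF p(2)]] p l(2)[OF p(2)] lin_maps_closed[OF \<pi>(1) p(2)]
      by (simp add: a_minus_def Q.r_neg)
    then have "b \<ominus>\<^bsub>B\<^esub> l p \<in> f ` carrier A" using q(3) b lc[OF p(2)] by simp
    then obtain a where a: "b \<ominus>\<^bsub>B\<^esub> l p = f a" "a \<in> carrier A" by (rule imageE)
    have "b = l p \<oplus>\<^bsub>B\<^esub> f a"
      using b lc[OF p(2)] by (simp add: a(1)[symmetric] a_minus_def B.a_lcomm B.r_neg)
    then show ?thesis using p(2) a(2) by blast
  qed
  (* The graph of the lift. *)
  let ?\<Gamma> = "{(l p \<oplus>\<^bsub>B\<^esub> f a, ?\<nu> p \<oplus>\<^bsub>D\<^esub> u a) | p a. p \<in> carrier ?P \<and> a \<in> carrier A}"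
  have \<Gamma>I: "(b, x) \<in> ?\<Gamma>"
    if "p \<in> carrier ?P" "a \<in> carrier A" "b = l p \<oplus>\<^bsub>B\<^esub> f a" "x = ?\<nu> p \<oplus>\<^bsub>D\<^esub> u a" for b x p a
    unfolding mem_Collect_eq using that by (intro exI[of _ p] exI[of _ a]) simp
  have \<Gamma>E: "\<exists>p a. p \<in> carrier ?P \<and> a \<in> carrier A \<and> b = l p \<oplus>\<^bsub>B\<^esub> f a \<and> x = ?\<nu> p \<oplus>\<^bsub>D\<^esub> u a"
    if "(b, x) \<in> ?\<Gamma>" for b x
  proof -
    from that obtain p a where "(b, x) = (l p \<oplus>\<^bsub>B\<^esub> f a, ?\<nu> p \<oplus>\<^bsub>D\<^esub> u a) \<and> p \<in> carrier ?P \<and> a \<in> carrier A"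
      unfolding mem_Collect_eq by (elim exE)
    then show ?thesis by (intro exI[of _ p] exI[of _ a]) (simp only: prod.inject simp_thms)
  qed
  have sub: "?\<Gamma> \<subseteq> carrier B \<times> carrier D"
    using lc \<nu>c fc uc by auto
  have "\<exists>d\<in>lin_maps R B D. \<forall>b x. (b, x) \<in> ?\<Gamma> \<longrightarrow> d b = x"
  proof (rule lin_map_of_relation[OF B D sub])
    fix b assume b: "b \<in> carrier B"
    obtain p a where "p \<in> carrier ?P" "a \<in> carrier A" "b = l p \<oplus>\<^bsub>B\<^esub> f a"
      using decomp[OF b] by (elim bexE) (rule that)
    then show "\<exists>x. (b, x) \<in> ?\<Gamma>" using \<Gamma>I by blast
  next
    fix b x b' x' assume bx: "(b, x) \<in> ?\<Gamma>" "(b', x') \<in> ?\<Gamma>"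
    obtain p a where pa: "p \<in> carrier ?P" "a \<in> carrier A"
      and eq1: "b = l p \<oplus>\<^bsub>B\<^esub> f a" "x = ?\<nu> p \<oplus>\<^bsub>D\<^esub> u a"
      using \<Gamma>E[OF bx(1)] by (elim exE conjE) (rule that)
    obtain p' a' where pa': "p' \<in> carrier ?P" "a' \<in> carrier A"
      and eq2: "b' = l p' \<oplus>\<^bsub>B\<^esub> f a'" "x' = ?\<nu> p' \<oplus>\<^bsub>D\<^esub> u a'"
      using \<Gamma>E[OF bx(2)] by (elim exE conjE) (rule that)
    note * = pa(1) pa(2) pa'(1) pa'(2) and eq = eq1 eq2
    show "(b \<oplus>\<^bsub>B\<^esub> b', x \<oplus>\<^bsub>D\<^esub> x') \<in> ?\<Gamma>"
    proof (rule \<Gamma>I[OF P.a_closed[OF *(1) *(3)] A.a_closed[OF *(2) *(4)]])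
      show "b \<oplus>\<^bsub>B\<^esub> b' = l (p \<oplus>\<^bsub>?P\<^esub> p') \<oplus>\<^bsub>B\<^esub> f (a \<oplus>\<^bsub>A\<^esub> a')"
        unfolding eq lin_maps_add[OF l(1) *(1) *(3)] lin_maps_add[OF f(1) *(2) *(4)]
        using lc[OF *(1)] lc[OF *(3)] fc[OF *(2)] fc[OF *(4)] by (simp add: B.a_ac)
      show "x \<oplus>\<^bsub>D\<^esub> x' = ?\<nu> (p \<oplus>\<^bsub>?P\<^esub> p') \<oplus>\<^bsub>D\<^esub> u (a \<oplus>\<^bsub>A\<^esub> a')"
        unfolding eq lin_maps_add[OF \<nu> *(1) *(3)] lin_maps_add[OF u *(2) *(4)]
        using \<nu>c[OF *(1)] \<nu>c[OF *(3)] uc[OF *(2)] uc[OF *(4)]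
        by (simp add: D.a_ac del: restrict_apply restrict_apply')
    qed
  next
    fix r b x assume r: "r \<in> carrier R" and bx: "(b, x) \<in> ?\<Gamma>"
    obtain p a where *: "p \<in> carrier ?P" "a \<in> carrier A"
      and eq: "b = l p \<oplus>\<^bsub>B\<^esub> f a" "x = ?\<nu> p \<oplus>\<^bsub>D\<^esub> u a"
      using \<Gamma>E[OF bx] by (elim exE conjE) (rule that)
    show "(r \<odot>\<^bsub>B\<^esub> b, r \<odot>\<^bsub>D\<^esub> x) \<in> ?\<Gamma>"
    proof (rule \<Gamma>I[OF left_module.smult_closed[OF P r *(1)] left_module.smult_closed[OF A r *(2)]])
      show "r \<odot>\<^bsub>B\<^esub> b = l (r \<odot>\<^bsub>?P\<^esub> p) \<oplus>\<^bsub>B\<^esub> f (r \<odot>\<^bsub>A\<^esub> a)"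
        unfolding eq lin_maps_smult[OF l(1) r *(1)] lin_maps_smult[OF f(1) r *(2)]
        by (rule left_module.smult_r_distr[OF B r lc[OF *(1)] fc[OF *(2)]])
      show "r \<odot>\<^bsub>D\<^esub> x = ?\<nu> (r \<odot>\<^bsub>?P\<^esub> p) \<oplus>\<^bsub>D\<^esub> u (r \<odot>\<^bsub>A\<^esub> a)"
        unfolding eq lin_maps_smult[OF \<nu> r *(1)] lin_maps_smult[OF u r *(2)]
        by (rule left_module.smult_r_distr[OF D r \<nu>c[OF *(1)] uc[OF *(2)]])
    qed
  next
    fix x assume bx: "(\<zero>\<^bsub>B\<^esub>, x) \<in> ?\<Gamma>"
    obtain p a where *: "p \<in> carrier ?P" "a \<in> carrier A"
      and eq: "\<zero>\<^bsub>B\<^esub> = l p \<oplus>\<^bsub>B\<^esub> f a" "x = ?\<nu> p \<oplus>\<^bsub>D\<^esub> u a"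
      using \<Gamma>E[OF bx] by (elim exE conjE) (rule that)
    have na: "\<ominus>\<^bsub>A\<^esub> a \<in> carrier A" using *(2) by simp
    have lp: "l p = f (\<ominus>\<^bsub>A\<^esub> a)"
      unfolding lin_maps_neg[OF A B f(1) *(2)]
      by (rule B.minus_equality[symmetric]) (use eq(1) lc[OF *(1)] fc[OF *(2)] in simp_all)
    then have "q (l p) = \<zero>\<^bsub>Q\<^esub>" using q(3)[OF lc[OF *(1)]] na by simp
    then have pK: "p \<in> carrier ?K" using l(2)[OF *(1)] *(1) by (simp add: mem_relation_module)
    have "?a p = \<ominus>\<^bsub>A\<^esub> a" using pK lp f'(2)[OF na] by (simp add: compose_def)
    then have "?\<nu> p = \<ominus>\<^bsub>D\<^esub> u a" using \<nu>K[OF pK] lin_maps_neg[OF A D u *(2)] by simp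
    then show "x = \<zero>\<^bsub>D\<^esub>" unfolding eq(2) using uc[OF *(2)] by (simp add: D.l_neg del: restrict_apply restrict_apply')
  next
    fix h assume "h \<in> lin_maps R B D" "\<And>b x. (b, x) \<in> ?\<Gamma> \<Longrightarrow> h b = x"
    then show ?thesis by (intro bexI[of _ h]) blast+
  qed
  then obtain d where d: "d \<in> lin_maps R B D" and d\<Gamma>: "\<forall>b x. (b, x) \<in> ?\<Gamma> \<longrightarrow> d b = x" ..
  have d_eq: "d (l p \<oplus>\<^bsub>B\<^esub> f a) = ?\<nu> p \<oplus>\<^bsub>D\<^esub> u a" if "p \<in> carrier ?P" "a \<in> carrier A" for p a
    using d\<Gamma> \<Gamma>I[OF that refl refl] by blast
  show ?thesis
  proof (intro bexI[OF _ d] conjI ballI)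
    fix a assume a: "a \<in> carrier A"
    show "d (f a) = u a"
      using d_eq[OF P.zero_closed a] fc[OF a] uc[OF a] lin_maps_zero[OF P B l(1)] lin_maps_zero[OF P D \<nu>]
      by (simp del: restrict_apply restrict_apply')
  next
    fix b assume b: "b \<in> carrier B"
    obtain p a where p: "p \<in> carrier ?P" and a: "a \<in> carrier A" and beq: "b = l p \<oplus>\<^bsub>B\<^esub> f a"
      using decomp[OF b] by (elim bexE) (rule that)
    have "g (d b) = g (?\<nu> p) \<oplus>\<^bsub>Y\<^esub> g (u a)"
      unfolding beq d_eq[OF p a] by (rule lin_maps_add[OF g(1) \<nu>c[OF p] uc[OF a]])
    also have "\<dots> = v (l p) \<oplus>\<^bsub>Y\<^esub> v (f a)" using g\<nu>[OF p] square[OF a] by simp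
    also have "\<dots> = v b"
      unfolding beq by (rule lin_maps_add[OF v lc[OF p] fc[OF a], symmetric])
    finally show "g (d b) = v b" .
  qed
qed

text \<open>
  The vanishing of \<open>Ext\<^sup>1\<close> can be used with any presentation of \<open>Q\<close>, not only with the free cover that
  defines it: extending a map is lifting against \<open>N \<rightarrow> 0\<close>.
\<close>

lemma extend_of_trivial_Ext1:
  assumes B: "left_module R B" and Q: "left_module R Q" and N: "left_module R N"
    and S: "is_submodule R B S"
    and q: "q \<in> lin_maps R B Q" "q ` carrier B = carrier Q"
      "\<forall>b\<in>carrier B. q b = \<zero>\<^bsub>Q\<^esub> \<longleftrightarrow> b \<in> S"
    and ext: "trivial_group (Ext1 R Q N)"
    and \<phi>: "\<phi> \<in> lin_maps R (B\<lparr>carrier := S\<rparr>) N"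
  shows "\<exists>\<psi>\<in>lin_maps R B N. \<forall>s\<in>S. \<psi> s = \<phi> s"
proof -
  interpret N: abelian_group N using N by (rule left_module_imp_abelian_group)
  let ?A = "B\<lparr>carrier := S\<rparr>" and ?Y = "N\<lparr>carrier := {\<zero>\<^bsub>N\<^esub>}\<rparr>" and ?f = "restrict (\<lambda>x\<in>carrier B. x) S"
  let ?g = "\<lambda>x\<in>carrier N. \<zero>\<^bsub>N\<^esub>" and ?v = "\<lambda>x\<in>carrier B. \<zero>\<^bsub>N\<^esub>"
  have sub: "S \<subseteq> carrier B" using S by (simp add: is_submodule_def)
  have "is_submodule R N {\<zero>\<^bsub>N\<^esub>}" by (simp add: is_submodule_def smult_zero[OF N])
  note Y = left_module_submodule[OF N this]
  have "a_kernel N ?Y ?g = carrier N" by (auto simp: mem_a_kernel)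
  then have ker: "N\<lparr>carrier := a_kernel N ?Y ?g\<rparr> = N" by simp
  have "?f \<in> lin_maps R ?A B" by (rule lin_maps_restrict[OF B S lin_maps_id[OF B]])
  moreover have "inj_on ?f (carrier ?A)" using sub by (auto intro!: inj_onI simp: subset_iff)
  moreover have "q b = \<zero>\<^bsub>Q\<^esub> \<longleftrightarrow> b \<in> ?f ` carrier ?A" if "b \<in> carrier B" for b
    using bspec[OF q(3) that] sub by (auto simp: image_iff subset_iff)
  moreover have "?g \<in> lin_maps R N ?Y"
    by (rule lin_maps_corestrict[OF lin_maps_zero_map[OF N N]]) simp
  moreover have "?g ` carrier N = carrier ?Y" by auto
  moreover have "?v \<in> lin_maps R B ?Y"
    by (rule lin_maps_corestrict[OF lin_maps_zero_map[OF B N]]) simp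
  moreover have "?g (\<phi> a) = ?v (?f a)" if "a \<in> carrier ?A" for a
    using lin_maps_closed[OF \<phi> that] that sub by auto
  ultimately have "\<exists>d\<in>lin_maps R B N. (\<forall>a\<in>carrier ?A. d (?f a) = \<phi> a) \<and> (\<forall>b\<in>carrier B. ?g (d b) = ?v b)"
    using lift_of_trivial_Ext1[OF left_module_submodule[OF B S] B Q N Y _ _ q(1,2), of ?f ?g \<phi> ?v] ext \<phi>
    unfolding ker by blast
  then obtain d where d: "d \<in> lin_maps R B N" "\<forall>a\<in>carrier ?A. d (?f a) = \<phi> a" by blast
  show ?thesis
  proof (intro bexI[OF _ d(1)] ballI)
    fix s assume s: "s \<in> S"
    then have "s \<in> carrier B" using sub by blast
    then show "d s = \<phi> s" using bspec[OF d(2), of s] s by simp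
  qed
qed

lemma trivial_Ext1_iso_left:
  assumes Q: "left_module R Q" and Q': "left_module R Q'" and N: "left_module R N"
    and iso: "module_iso R Q Q'" and ext: "trivial_group (Ext1 R Q N)"
  shows "trivial_group (Ext1 R Q' N)"
proof -
  let ?P = "free_cover R Q'" and ?\<pi> = "cover_map R Q'"
  note P = left_module_free_cover[OF left_module_imp_ring[OF Q], of Q']
  note \<pi> = cover_map_lin_maps[OF Q'] cover_map_surj[OF Q']
  obtain h where h: "h \<in> lin_maps R Q' Q" "bij_betw h (carrier Q') (carrier Q)"
    using module_iso_sym[OF Q Q' iso] unfolding module_iso_def by blast
  have h0: "h y = \<zero>\<^bsub>Q\<^esub> \<longleftrightarrow> y = \<zero>\<^bsub>Q'\<^esub>" if "y \<in> carrier Q'" for y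
  proof -
    have "\<zero>\<^bsub>Q'\<^esub> \<in> carrier Q'" using is_submodule_kernel[OF Q' Q h(1)] by (auto simp: is_submodule_def)
    then show ?thesis
      using inj_onD[OF bij_betw_imp_inj_on[OF h(2)] _ that] lin_maps_zero[OF Q' Q h(1)] by metis
  qed
  let ?q = "compose (carrier ?P) h ?\<pi>"
  have q: "?q \<in> lin_maps R ?P Q" by (rule lin_maps_compose[OF P \<pi>(1) h(1)])
  have "?q ` carrier ?P = h ` ?\<pi> ` carrier ?P" by (auto simp: compose_def)
  then have q_surj: "?q ` carrier ?P = carrier Q" using \<pi>(2) h(2) by (simp add: bij_betw_def)
  have q_ker: "\<forall>p\<in>carrier ?P. ?q p = \<zero>\<^bsub>Q\<^esub> \<longleftrightarrow> p \<in> carrier (relation_module R Q')"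
    using h0[OF lin_maps_closed[OF \<pi>(1)]] by (simp add: compose_eq mem_relation_module)
  show ?thesis
    unfolding trivial_Ext1_iff[OF Q' N]
  proof
    fix \<phi> assume "\<phi> \<in> lin_maps R (relation_module R Q') N"
    then have "\<phi> \<in> lin_maps R (?P\<lparr>carrier := carrier (relation_module R Q')\<rparr>) N"
      by (simp flip: relation_module_carrier_update)
    then show "\<exists>\<psi>\<in>lin_maps R ?P N. \<forall>k\<in>carrier (relation_module R Q'). \<psi> k = \<phi> k"
      by (rule extend_of_trivial_Ext1[OF P Q N is_submodule_relation_module[OF Q'] q q_surj q_ker ext])
  qed
qed

lemma trivial_Ext1_iso_right:
  assumes Q: "left_module R Q" and N: "left_module R N" and N': "left_module R N'"
    and iso: "module_iso R N N'" and ext: "trivial_group (Ext1 R Q N)"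
  shows "trivial_group (Ext1 R Q N')"
  unfolding trivial_Ext1_iff[OF Q N']
proof
  let ?P = "free_cover R Q" and ?K = "relation_module R Q"
  note P = left_module_free_cover[OF left_module_imp_ring[OF Q], of Q]
  note K = left_module_relation_module[OF Q]
  obtain h where h: "h \<in> lin_maps R N N'" "bij_betw h (carrier N) (carrier N')"
    using iso unfolding module_iso_def by blast
  obtain h' where h': "h' \<in> lin_maps R N' N" "\<And>y. y \<in> carrier N' \<Longrightarrow> h (h' y) = y"
    using lin_maps_inverse[OF N N' h] by metis
  fix \<phi> assume \<phi>: "\<phi> \<in> lin_maps R ?K N'"
  obtain \<psi> where \<psi>: "\<psi> \<in> lin_maps R ?P N" "\<forall>k\<in>carrier ?K. \<psi> k = compose (carrier ?K) h' \<phi> k"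
    using ext lin_maps_compose[OF K \<phi> h'(1)] unfolding trivial_Ext1_iff[OF Q N] by blast
  show "\<exists>\<psi>\<in>lin_maps R ?P N'. \<forall>k\<in>carrier ?K. \<psi> k = \<phi> k"
  proof (intro bexI ballI)
    show "compose (carrier ?P) h \<psi> \<in> lin_maps R ?P N'" by (rule lin_maps_compose[OF P \<psi>(1) h(1)])
    fix k assume k: "k \<in> carrier ?K"
    then have "k \<in> carrier ?P" by (simp add: mem_relation_module)
    then show "compose (carrier ?P) h \<psi> k = \<phi> k"
      using k \<psi>(2) h'(2)[OF lin_maps_closed[OF \<phi> k]] by (simp add: compose_eq)
  qed
qed

text \<open>
  The cover \<open>\<pi>\<close> of a free module has a linear section \<open>\<sigma>\<close>, so that \<open>p \<mapsto> p - \<sigma> (\<pi> p)\<close> is a retraction onto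
  the relation module.
\<close>

lemma trivial_Ext1_free_cover:
  assumes N: "left_module R N"
  shows "trivial_group (Ext1 R (free_cover R M) N)"
proof -
  let ?F = "free_cover R M"
  let ?P = "free_cover R ?F" and ?K = "relation_module R ?F" and ?\<pi> = "cover_map R ?F"
  note F = left_module_free_cover[OF left_module_imp_ring[OF N], of M]
  note P = left_module_free_cover[OF left_module_imp_ring[OF N], of ?F]
  interpret F: abelian_group ?F using F by (rule left_module_imp_abelian_group)
  interpret P: abelian_group ?P using P by (rule left_module_imp_abelian_group)
  note \<pi> = cover_map_lin_maps[OF F] cover_map_surj[OF F]
  obtain \<sigma> where \<sigma>: "\<sigma> \<in> lin_maps R ?F ?P"
    "\<And>x. x \<in> carrier ?F \<Longrightarrow> ?\<pi> (\<sigma> x) = (\<lambda>x\<in>carrier ?F. x) x"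
    using free_cover_lift[OF P F \<pi> lin_maps_id[OF F]] by blast
  let ?h = "\<lambda>p\<in>carrier ?P. (\<lambda>x\<in>carrier ?P. x) p \<ominus>\<^bsub>?P\<^esub> compose (carrier ?P) \<sigma> ?\<pi> p"
  have h_eq: "?h p = p \<ominus>\<^bsub>?P\<^esub> \<sigma> (?\<pi> p)" if "p \<in> carrier ?P" for p
    using that by (simp add: compose_eq)
  have h: "?h \<in> lin_maps R ?P ?P"
    by (rule lin_maps_diff[OF P P lin_maps_id[OF P] lin_maps_compose[OF P \<pi>(1) \<sigma>(1)]])
  have "?h \<in> lin_maps R ?P (?P\<lparr>carrier := carrier ?K\<rparr>)"
  proof (rule lin_maps_corestrict[OF h])
    fix p assume p: "p \<in> carrier ?P"
    note \<pi>p = lin_maps_closed[OF \<pi>(1) p]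
    have "?\<pi> (?h p) = \<zero>\<^bsub>?F\<^esub>"
      unfolding h_eq[OF p] lin_maps_diff_apply[OF P F \<pi>(1) p lin_maps_closed[OF \<sigma>(1) \<pi>p]]
      using \<sigma>(2)[OF \<pi>p] \<pi>p by (simp add: a_minus_def F.r_neg)
    then show "?h p \<in> carrier ?K" 
      unfolding mem_relation_module by (rule conjI[OF lin_maps_closed[OF h p]])
  qed
  then have hK: "?h \<in> lin_maps R ?P ?K" by (simp flip: relation_module_carrier_update)
  show ?thesis
    unfolding trivial_Ext1_iff[OF F N]
  proof (intro ballI bexI)
    fix \<phi> assume \<phi>: "\<phi> \<in> lin_maps R ?K N"
    show "compose (carrier ?P) \<phi> ?h \<in> lin_maps R ?P N" by (rule lin_maps_compose[OF P hK \<phi>])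
    fix k assume "k \<in> carrier ?K"
    then have k: "k \<in> carrier ?P" "?\<pi> k = \<zero>\<^bsub>?F\<^esub>" by (simp_all add: mem_relation_module)
    have "?h k = k"
      unfolding h_eq[OF k(1)] k(2) lin_maps_zero[OF F P \<sigma>(1)] using k(1) by (simp add: a_minus_def)
    then show "compose (carrier ?P) \<phi> ?h k = \<phi> k" using k(1) by (simp only: compose_eq)
  qed
qed

lemma small_free_cover:
  assumes "strongly_inaccessible (UNIV :: 'u set)"
    and "carrier R \<prec> (UNIV :: 'u set)" "carrier M \<prec> (UNIV :: 'u set)"
  shows "carrier (free_cover R M) \<prec> (UNIV :: 'u set)"
  by (rule small_functions[OF assms(1,3,2)]) (auto simp: mem_free_cover)


section \<open>Morphisms\<close>

lemma ModulesD: "M \<in> Modules R \<Longrightarrow> left_module R M"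
  and Modules_small: "(M :: ('r, 'u) module) \<in> Modules R \<Longrightarrow> carrier M \<prec> (UNIV :: 'u set)"
  by (simp_all add: Modules_def)

lemma MorphismsD:
  "f \<in> Morphisms R \<Longrightarrow> left_module R (Dom f)" "f \<in> Morphisms R \<Longrightarrow> left_module R (Cod f)"
  "f \<in> Morphisms R \<Longrightarrow> Map f \<in> lin_maps R (Dom f) (Cod f)"
  by (simp_all add: Morphisms_def Modules_def)

lemma Modules_submodule:
  assumes "M \<in> Modules R" "is_submodule R M S"
  shows "M\<lparr>carrier := S\<rparr> \<in> Modules R"
proof -
  have "lepoll S (carrier M)" using assms(2) by (simp add: is_submodule_def subset_imp_lepoll)
  then show ?thesis
    using assms left_module_submodule[OF _ assms(2)] lesspoll_trans1 by (auto simp: Modules_def)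
qed

abbreviation kernel_module :: "('r, 'u) morphism \<Rightarrow> ('r, 'u) module" where
  "kernel_module g \<equiv> (Dom g)\<lparr>carrier := a_kernel (Dom g) (Cod g) (Map g)\<rparr>"

lemma kernel_module_Modules: "g \<in> Morphisms R \<Longrightarrow> kernel_module g \<in> Modules R"
  by (rule Modules_submodule) (simp_all add: Morphisms_def Modules_def is_submodule_kernel)

lemma mem_F_Mono_iff:
  assumes f: "f \<in> Morphisms R" and \<F>: "\<F> \<subseteq> Modules R"
  shows "f \<in> F_Mono R \<F> \<longleftrightarrow> inj_on (Map f) (carrier (Dom f)) \<and>
    (\<exists>Q\<in>\<F>. \<exists>q\<in>lin_maps R (Cod f) Q. q ` carrier (Cod f) = carrier Q \<and>
      (\<forall>b\<in>carrier (Cod f). q b = \<zero>\<^bsub>Q\<^esub> \<longleftrightarrow> b \<in> Map f ` carrier (Dom f)))"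
proof -
  have "module_iso R Q (quot_module (Cod f) (Map f ` carrier (Dom f))) \<longleftrightarrow>
      (\<exists>q\<in>lin_maps R (Cod f) Q. q ` carrier (Cod f) = carrier Q \<and>
      (\<forall>b\<in>carrier (Cod f). q b = \<zero>\<^bsub>Q\<^esub> \<longleftrightarrow> b \<in> Map f ` carrier (Dom f)))" if "Q \<in> \<F>" for Q
    using that \<F> module_iso_quot_iff[OF MorphismsD(2)[OF f] is_submodule_image[OF MorphismsD[OF f]], of Q] ModulesD
    by blast
  then show ?thesis using f by (simp add: F_Mono_def)
qed

lemma lifts_against_iff:
  assumes f: "f \<in> Morphisms R" and g: "g \<in> Morphisms R"
  shows "lifts_against R f g \<longleftrightarrow>
    (\<forall>u\<in>lin_maps R (Dom f) (Dom g). \<forall>v\<in>lin_maps R (Cod f) (Cod g).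
      (\<forall>a\<in>carrier (Dom f). Map g (u a) = v (Map f a)) \<longrightarrow>
      (\<exists>d\<in>lin_maps R (Cod f) (Dom g).
        (\<forall>a\<in>carrier (Dom f). d (Map f a) = u a) \<and> (\<forall>b\<in>carrier (Cod f). Map g (d b) = v b)))"
proof -
  note D = MorphismsD[OF f] MorphismsD[OF g]
  have 1: "compose (carrier (Dom f)) (Map g) u = compose (carrier (Dom f)) v (Map f) \<longleftrightarrow>
      (\<forall>a\<in>carrier (Dom f). Map g (u a) = v (Map f a))" for u v
    by (auto simp: compose_def fun_eq_iff restrict_def)
  have 2: "compose (carrier (Dom f)) d (Map f) = u \<longleftrightarrow> (\<forall>a\<in>carrier (Dom f). d (Map f a) = u a)"
    if u: "u \<in> lin_maps R (Dom f) (Dom g)" and d: "d \<in> lin_maps R (Cod f) (Dom g)" for d u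
    using lin_maps_eqI[OF lin_maps_compose[OF D(1,3) d] u] by (auto simp: compose_eq)
  have 3: "compose (carrier (Cod f)) (Map g) d = v \<longleftrightarrow> (\<forall>b\<in>carrier (Cod f). Map g (d b) = v b)"
    if v: "v \<in> lin_maps R (Cod f) (Cod g)" and d: "d \<in> lin_maps R (Cod f) (Dom g)" for d v
    using lin_maps_eqI[OF lin_maps_compose[OF D(2) d D(6)] v] by (auto simp: compose_eq)
  show ?thesis
    unfolding lifts_against_def 1
    by (intro ball_cong bex_cong imp_cong refl) (simp add: 2 3)
qed

lemma F_Mono_lifts_against:
  assumes f: "f \<in> F_Mono R \<F>" and \<F>: "\<F> \<subseteq> Modules R"
    and g: "g \<in> Morphisms R" "Map g ` carrier (Dom g) = carrier (Cod g)"
    and ext: "\<And>Q. Q \<in> \<F> \<Longrightarrow> trivial_group (Ext1 R Q (kernel_module g))"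
  shows "lifts_against R f g"
proof -
  have fM: "f \<in> Morphisms R" using f by (simp add: F_Mono_def)
  note Df = MorphismsD[OF fM] and Dg = MorphismsD[OF g(1)]
  have "inj_on (Map f) (carrier (Dom f)) \<and>
    (\<exists>Q\<in>\<F>. \<exists>q\<in>lin_maps R (Cod f) Q. q ` carrier (Cod f) = carrier Q \<and>
      (\<forall>b\<in>carrier (Cod f). q b = \<zero>\<^bsub>Q\<^esub> \<longleftrightarrow> b \<in> Map f ` carrier (Dom f)))"
    using f unfolding mem_F_Mono_iff[OF fM \<F>] .
  then obtain Q q where inj: "inj_on (Map f) (carrier (Dom f))" and Q: "Q \<in> \<F>"
    and q: "q \<in> lin_maps R (Cod f) Q" "q ` carrier (Cod f) = carrier Q"
    and ker: "\<forall>b\<in>carrier (Cod f). q b = \<zero>\<^bsub>Q\<^esub> \<longleftrightarrow> b \<in> Map f ` carrier (Dom f)"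
    by blast
  have Qm: "left_module R Q" using Q \<F> ModulesD by blast
  show ?thesis
    unfolding lifts_against_iff[OF fM g(1)]
  proof (intro ballI impI)
    fix u v assume "u \<in> lin_maps R (Dom f) (Dom g)" "v \<in> lin_maps R (Cod f) (Cod g)"
      "\<forall>a\<in>carrier (Dom f). Map g (u a) = v (Map f a)"
    then show "\<exists>d\<in>lin_maps R (Cod f) (Dom g).
        (\<forall>a\<in>carrier (Dom f). d (Map f a) = u a) \<and> (\<forall>b\<in>carrier (Cod f). Map g (d b) = v b)"
      by (intro lift_of_trivial_Ext1[OF Df(1,2) Qm Dg(1,2) Df(3) inj q _ Dg(3) g(2) ext[OF Q]])
         (use ker in simp_all)
  qed
qed


section \<open>Injective modules from characters\<close>

text \<open>
  The module of families, indexed by \<open>D\<close>, of additive maps from \<open>R\<close> to the multiplicative group of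
  nonzero complex numbers, with \<open>(s h)(r) = h (r s)\<close>. It is cofree on this divisible group: linear
  maps from \<open>M\<close> into it are families of characters of the additive group of \<open>M\<close>. The value outside
  the relevant arguments is \<open>1\<close>, so that products of families are pointwise products.
\<close>

definition cofree_module :: "'r ring \<Rightarrow> 'd set \<Rightarrow> ('r, 'r \<times> 'd \<Rightarrow> complex) module" where
  "cofree_module R D =
     \<lparr>carrier = {h. (\<forall>r d. h (r, d) \<noteq> 0) \<and> (\<forall>r d. \<not> (r \<in> carrier R \<and> d \<in> D) \<longrightarrow> h (r, d) = 1) \<and>
        (\<forall>d\<in>D. \<forall>r\<in>carrier R. \<forall>s\<in>carrier R. h (r \<oplus>\<^bsub>R\<^esub> s, d) = h (r, d) * h (s, d))},
      monoid.mult = undefined, monoid.one = undefined,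
      ring.zero = (\<lambda>_. 1), add = (\<lambda>h k x. h x * k x),
      smult = (\<lambda>s h (r, d). if r \<in> carrier R \<and> d \<in> D then h (r \<otimes>\<^bsub>R\<^esub> s, d) else 1)\<rparr>"

lemma cofree_module_ops:
  "\<zero>\<^bsub>cofree_module R D\<^esub> = (\<lambda>_. 1)"
  "h \<oplus>\<^bsub>cofree_module R D\<^esub> k = (\<lambda>x. h x * k x)"
  "s \<odot>\<^bsub>cofree_module R D\<^esub> h = (\<lambda>(r, d). if r \<in> carrier R \<and> d \<in> D then h (r \<otimes>\<^bsub>R\<^esub> s, d) else 1)"
  by (simp_all add: cofree_module_def)

lemma mem_cofree_module:
  "h \<in> carrier (cofree_module R D) \<longleftrightarrow>
    (\<forall>r d. h (r, d) \<noteq> 0) \<and> (\<forall>r d. \<not> (r \<in> carrier R \<and> d \<in> D) \<longrightarrow> h (r, d) = 1) \<and>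
    (\<forall>d\<in>D. \<forall>r\<in>carrier R. \<forall>s\<in>carrier R. h (r \<oplus>\<^bsub>R\<^esub> s, d) = h (r, d) * h (s, d))"
  by (simp add: cofree_module_def)

lemma left_module_cofree_module:
  assumes "ring R" shows "left_module R (cofree_module R D)"
proof -
  interpret R: ring R by fact
  have "abelian_group (cofree_module R D)"
  proof (rule abelian_groupI)
    fix h assume h: "h \<in> carrier (cofree_module R D)"
    show "\<exists>k\<in>carrier (cofree_module R D). k \<oplus>\<^bsub>cofree_module R D\<^esub> h = \<zero>\<^bsub>cofree_module R D\<^esub>"
    proof
      show "(\<lambda>x. inverse (h x)) \<in> carrier (cofree_module R D)"
        using h by (simp add: mem_cofree_module)
      show "(\<lambda>x. inverse (h x)) \<oplus>\<^bsub>cofree_module R D\<^esub> h = \<zero>\<^bsub>cofree_module R D\<^esub>"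
        using h by (auto simp: mem_cofree_module cofree_module_ops)
    qed
  qed (simp_all add: mem_cofree_module cofree_module_ops mult_ac)
  then show ?thesis
    using R.ring_axioms
    by (intro left_module.intro left_module_axioms.intro)
       (auto simp: mem_cofree_module cofree_module_ops R.l_distr R.r_distr R.m_assoc fun_eq_iff)
qed

lemma small_cofree_module:
  assumes inacc: "strongly_inaccessible (UNIV :: 'u set)"
    and "carrier R \<prec> (UNIV :: 'u set)" "D \<prec> (UNIV :: 'u set)"
  shows "carrier (cofree_module R D) \<prec> (UNIV :: 'u set)"
  by (rule small_functions[OF inacc small_Times[OF assms] small_complex[OF inacc]])
     (auto simp: mem_cofree_module)

lemma lin_map_of_characters:
  assumes M: "left_module R M"
    and nz: "\<And>d m. d \<in> D \<Longrightarrow> m \<in> carrier M \<Longrightarrow> \<chi> d m \<noteq> 0"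
    and mult: "\<And>d m n. d \<in> D \<Longrightarrow> m \<in> carrier M \<Longrightarrow> n \<in> carrier M \<Longrightarrow> \<chi> d (m \<oplus>\<^bsub>M\<^esub> n) = \<chi> d m * \<chi> d n"
  shows "(\<lambda>m\<in>carrier M. \<lambda>(r, d). if r \<in> carrier R \<and> d \<in> D then \<chi> d (r \<odot>\<^bsub>M\<^esub> m) else 1)
    \<in> lin_maps R M (cofree_module R D)"
proof -
  interpret M: abelian_group M using M by (rule left_module_imp_abelian_group)
  interpret R: ring R using M by (rule left_module_imp_ring)
  note sc = left_module.smult_closed[OF M]
  show ?thesis
  proof (rule lin_mapsI)
    fix m n assume m: "m \<in> carrier M"
    let ?h = "\<lambda>m\<in>carrier M. \<lambda>(r, d). if r \<in> carrier R \<and> d \<in> D then \<chi> d (r \<odot>\<^bsub>M\<^esub> m) else 1"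
    show "?h m \<in> carrier (cofree_module R D)"
      using m sc nz mult by (simp add: mem_cofree_module left_module.smult_l_distr[OF M])
    show "?h (m \<oplus>\<^bsub>M\<^esub> n) = ?h m \<oplus>\<^bsub>cofree_module R D\<^esub> ?h n" if n: "n \<in> carrier M"
      using m n sc mult by (auto simp: cofree_module_ops left_module.smult_r_distr[OF M] fun_eq_iff)
    show "?h (r \<odot>\<^bsub>M\<^esub> m) = r \<odot>\<^bsub>cofree_module R D\<^esub> ?h m" if r: "r \<in> carrier R" for r
      using m r sc by (auto simp: cofree_module_ops left_module.smult_assoc1[OF M] fun_eq_iff)
  qed simp
qed

text \<open>
  Extend, for each index \<open>d\<close>, the character \<open>s \<mapsto> \<phi> s (1, d)\<close> of \<open>S\<close> to \<open>B\<close>; the linear map given by the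
  extended characters extends \<open>\<phi>\<close>.
\<close>

lemma cofree_module_injective:
  assumes B: "left_module R B" and S: "is_submodule R B S"
    and \<phi>: "\<phi> \<in> lin_maps R (B\<lparr>carrier := S\<rparr>) (cofree_module R D)"
  shows "\<exists>\<psi>\<in>lin_maps R B (cofree_module R D). \<forall>s\<in>S. \<psi> s = \<phi> s"
proof -
  interpret B: abelian_group B using B by (rule left_module_imp_abelian_group)
  interpret R: ring R using B by (rule left_module_imp_ring)
  have sub: "S \<subseteq> carrier B" using S by (simp add: is_submodule_def)
  have \<phi>c: "\<phi> s \<in> carrier (cofree_module R D)" if "s \<in> S" for s
    using lin_maps_closed[OF \<phi>] that by simp
  have sg: "subgroup S (add_monoid B)"
    using S is_submodule_neg[OF B S] unfolding is_submodule_def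
    by (intro group.subgroupI[OF B.a_group]) (auto simp flip: a_inv_def)
  have "\<forall>d. \<exists>\<chi>. (\<forall>x\<in>carrier B. \<chi> x \<noteq> 0) \<and>
      (\<forall>x\<in>carrier B. \<forall>y\<in>carrier B. \<chi> (x \<oplus>\<^bsub>B\<^esub> y) = \<chi> x * \<chi> y) \<and> (\<forall>x\<in>S. \<chi> x = \<phi> x (\<one>\<^bsub>R\<^esub>, d))"
    (is "\<forall>d. ?ex d")
  proof
    fix d show "?ex d"
      using extend_character[OF comm_group_add_monoid[OF B] sg, of "\<lambda>s. \<phi> s (\<one>\<^bsub>R\<^esub>, d)"]
        \<phi>c lin_maps_add[OF \<phi>] by (simp add: mem_cofree_module cofree_module_ops)
  qed
  from choice[OF this] obtain \<chi> where \<chi>: "\<forall>d. (\<forall>x\<in>carrier B. \<chi> d x \<noteq> 0) \<and>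
      (\<forall>x\<in>carrier B. \<forall>y\<in>carrier B. \<chi> d (x \<oplus>\<^bsub>B\<^esub> y) = \<chi> d x * \<chi> d y) \<and> (\<forall>x\<in>S. \<chi> d x = \<phi> x (\<one>\<^bsub>R\<^esub>, d))" ..
  let ?\<psi> = "\<lambda>m\<in>carrier B. \<lambda>(r, d). if r \<in> carrier R \<and> d \<in> D then \<chi> d (r \<odot>\<^bsub>B\<^esub> m) else 1"
  have "?\<psi> \<in> lin_maps R B (cofree_module R D)"
    by (rule lin_map_of_characters[OF B]) (use \<chi> in auto)
  moreover have "?\<psi> s = \<phi> s" if s: "s \<in> S" for s
  proof
    fix x :: "'a \<times> 'c"
    obtain r d where x: "x = (r, d)" by fastforce
    have sB: "s \<in> carrier B" using s sub by blast
    show "?\<psi> s x = \<phi> s x"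
    proof (cases "r \<in> carrier R \<and> d \<in> D")
      case True
      have "r \<odot>\<^bsub>B\<^esub> s \<in> S" using S True s by (simp add: is_submodule_def)
      then have "\<chi> d (r \<odot>\<^bsub>B\<^esub> s) = \<phi> (r \<odot>\<^bsub>B\<^esub> s) (\<one>\<^bsub>R\<^esub>, d)" using \<chi> by blast
      also have "\<dots> = (r \<odot>\<^bsub>cofree_module R D\<^esub> \<phi> s) (\<one>\<^bsub>R\<^esub>, d)"
        using lin_maps_smult[OF \<phi>, of r s] True s by simp
      also have "\<dots> = \<phi> s (r, d)" using True by (simp add: cofree_module_ops)
      finally show ?thesis using True sB by (simp add: x)
    next
      case False
      then show ?thesis using \<phi>c[OF s] sB by (auto simp: x mem_cofree_module)
    qed
  qed
  ultimately show ?thesis by (intro bexI[of _ ?\<psi>]) blast+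
qed

lemma trivial_Ext1_cofree_module:
  assumes Q: "left_module R Q"
  shows "trivial_group (Ext1 R Q (cofree_module R D))"
proof -
  note ring = left_module_imp_ring[OF Q]
  show ?thesis
    unfolding trivial_Ext1_iff[OF Q left_module_cofree_module[OF ring]]
  proof
    fix \<phi> assume "\<phi> \<in> lin_maps R (relation_module R Q) (cofree_module R D)"
    then have "\<phi> \<in> lin_maps R ((free_cover R Q)\<lparr>carrier := carrier (relation_module R Q)\<rparr>) (cofree_module R D)"
      by (simp flip: relation_module_carrier_update)
    then show "\<exists>\<psi>\<in>lin_maps R (free_cover R Q) (cofree_module R D). \<forall>k\<in>carrier (relation_module R Q). \<psi> k = \<phi> k"
      by (rule cofree_module_injective[OF left_module_free_cover[OF ring] is_submodule_relation_module[OF Q]])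
  qed
qed

lemma cofree_module_copy_injective:
  fixes J :: "('r, 'u) module"
  assumes J: "J \<in> Modules R" and iso: "module_iso R (cofree_module R D) J"
  shows "J \<in> right_perp R (Modules R)"
proof -
  note Jm = ModulesD[OF J]
  note E = left_module_cofree_module[OF left_module_imp_ring[OF Jm], of D]
  have "trivial_group (Ext1 R Q J)" if "Q \<in> Modules R" for Q :: "('r, 'u) module"
    by (rule trivial_Ext1_iso_right[OF ModulesD[OF that] E Jm iso trivial_Ext1_cofree_module[OF ModulesD[OF that]]])
  then show ?thesis using J by (simp add: right_perp_def)
qed

text \<open>
  The coordinate with index \<open>c\<close> is given by a character of \<open>C\<close> that is nontrivial at \<open>c\<close>; it detects
  that \<open>c\<close> is not in the kernel. The index \<open>0\<close> contributes the trivial character.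
\<close>

lemma embedding_into_cofree_module:
  assumes C: "left_module R C"
  obtains j where "j \<in> lin_maps R C (cofree_module R (carrier C))" "inj_on j (carrier C)"
proof -
  interpret C: abelian_group C using C by (rule left_module_imp_abelian_group)
  interpret R: ring R using C by (rule left_module_imp_ring)
  have "\<forall>c\<in>carrier C. \<exists>\<chi>. (\<forall>x\<in>carrier C. \<chi> x \<noteq> (0 :: complex)) \<and>
      (\<forall>x\<in>carrier C. \<forall>y\<in>carrier C. \<chi> (x \<oplus>\<^bsub>C\<^esub> y) = \<chi> x * \<chi> y) \<and>
      (c \<noteq> \<zero>\<^bsub>C\<^esub> \<longrightarrow> \<chi> c \<noteq> 1)" (is "\<forall>c\<in>_. ?ex c")
  proof
    fix c assume c: "c \<in> carrier C"
    show "?ex c"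
    proof (cases "c = \<zero>\<^bsub>C\<^esub>")
      case True
      then show ?thesis by (intro exI[of _ "\<lambda>_. 1"]) simp
    next
      case False
      obtain \<chi> where "\<And>x. x \<in> carrier C \<Longrightarrow> \<chi> x \<noteq> (0 :: complex)"
        "\<And>x y. x \<in> carrier C \<Longrightarrow> y \<in> carrier C \<Longrightarrow> \<chi> (x \<oplus>\<^bsub>C\<^esub> y) = \<chi> x * \<chi> y" "\<chi> c \<noteq> 1"
        using separating_character[OF comm_group_add_monoid[OF C], of c] c False by auto
      then show ?thesis by (intro exI[of _ \<chi>]) simp
    qed
  qed
  from bchoice[OF this] obtain \<chi> where \<chi>: "\<forall>c\<in>carrier C. (\<forall>x\<in>carrier C. \<chi> c x \<noteq> (0 :: complex)) \<and>
      (\<forall>x\<in>carrier C. \<forall>y\<in>carrier C. \<chi> c (x \<oplus>\<^bsub>C\<^esub> y) = \<chi> c x * \<chi> c y) \<and>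
      (c \<noteq> \<zero>\<^bsub>C\<^esub> \<longrightarrow> \<chi> c c \<noteq> 1)" ..
  let ?j = "\<lambda>m\<in>carrier C. \<lambda>(r, d). if r \<in> carrier R \<and> d \<in> carrier C then \<chi> d (r \<odot>\<^bsub>C\<^esub> m) else 1"
  have j: "?j \<in> lin_maps R C (cofree_module R (carrier C))"
    by (rule lin_map_of_characters[OF C]) (use \<chi> in auto)
  have "inj_on ?j (carrier C)"
  proof (rule lin_maps_inj[OF C left_module_cofree_module[OF R.ring_axioms] j], rule ccontr)
    fix c assume c: "c \<in> carrier C" and "?j c = \<zero>\<^bsub>cofree_module R (carrier C)\<^esub>" and "c \<noteq> \<zero>\<^bsub>C\<^esub>"
    then have "?j c (\<one>\<^bsub>R\<^esub>, c) = 1" by (simp only: cofree_module_ops)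
    then have "\<chi> c c = 1" using c left_module.smult_one[OF C c] by simp
    then show False using \<chi> c \<open>c \<noteq> \<zero>\<^bsub>C\<^esub>\<close> by blast
  qed
  with j show thesis by (rule that)
qed

text \<open>
  The map is the projection \<open>J \<rightarrow> J/C\<close> for an injective module \<open>J\<close> that contains \<open>C\<close>. Membership in the
  right orthogonal class of all modules is injectivity.
\<close>

lemma injective_copresentation:
  fixes R :: "'r ring" and C :: "('r, 'u) module"
  assumes inacc: "strongly_inaccessible (UNIV :: 'u set)" and small: "carrier R \<prec> (UNIV :: 'u set)"
    and C: "C \<in> Modules R"
  obtains g :: "('r, 'u) morphism" where "g \<in> Morphisms R" "Map g ` carrier (Dom g) = carrier (Cod g)"
    "Dom g \<in> right_perp R (Modules R)" "module_iso R C (kernel_module g)"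
proof -
  note Cm = ModulesD[OF C]
  note ring = left_module_imp_ring[OF Cm]
  let ?E = "cofree_module R (carrier C)"
  note E = left_module_cofree_module[OF ring, of "carrier C"]
  obtain j where j: "j \<in> lin_maps R C ?E" "inj_on j (carrier C)"
    using embedding_into_cofree_module[OF Cm] .
  obtain J :: "('r, 'u) module" and h where J: "J \<in> Modules R" and h: "h \<in> lin_maps R ?E J"
    "bij_betw h (carrier ?E) (carrier J)"
    using transport_to_universe[OF E small_cofree_module[OF inacc small Modules_small[OF C]]] .
  note Jm = ModulesD[OF J]
  let ?i = "compose (carrier C) h j"
  have i: "?i \<in> lin_maps R C J" by (rule lin_maps_compose[OF Cm j(1) h(1)])
  have i_inj: "inj_on ?i (carrier C)"
    using j(2) bij_betw_imp_inj_on[OF h(2)] lin_maps_closed[OF j(1)]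
    by (auto simp: compose_def intro!: inj_onI dest: inj_onD)
  let ?S = "?i ` carrier C"
  note S = is_submodule_image[OF Cm Jm i]
  note quot = quot_module_projection[OF Jm S]
  have "lepoll (carrier (quot_module J ?S)) (carrier J)"
    by (subst quot(3)[symmetric]) (rule image_lepoll)
  then have "carrier (quot_module J ?S) \<prec> (UNIV :: 'u set)"
    using Modules_small[OF J] lesspoll_trans1 by blast
  then obtain Y :: "('r, 'u) module" and k where Y: "Y \<in> Modules R"
    and k: "k \<in> lin_maps R (quot_module J ?S) Y" "bij_betw k (carrier (quot_module J ?S)) (carrier Y)"
    using transport_to_universe[OF quot(1)] by blast
  have "module_iso R (quot_module J ?S) Y" using k unfolding module_iso_def by blast
  from module_iso_sym[OF quot(1) ModulesD[OF Y] this]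
  obtain q where q: "q \<in> lin_maps R J Y" "q ` carrier J = carrier Y"
    "\<forall>x\<in>carrier J. q x = \<zero>\<^bsub>Y\<^esub> \<longleftrightarrow> x \<in> ?S"
    unfolding module_iso_quot_iff[OF Jm S ModulesD[OF Y]] by blast
  let ?g = "Morphism J Y q"
  have "?S \<subseteq> carrier J" using S by (simp add: is_submodule_def)
  then have "a_kernel J Y q = ?S" using q(3) by (auto simp: mem_a_kernel)
  then have ker: "kernel_module ?g = J\<lparr>carrier := ?S\<rparr>" by simp
  have "?i \<in> lin_maps R C (kernel_module ?g)"
    unfolding ker by (rule lin_maps_corestrict[OF i]) (rule imageI)
  moreover have "bij_betw ?i (carrier C) (carrier (kernel_module ?g))"
    unfolding ker using i_inj by (simp add: bij_betw_def)
  ultimately have "module_iso R C (kernel_module ?g)" unfolding module_iso_def by blast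
  moreover have "J \<in> right_perp R (Modules R)"
    by (rule cofree_module_copy_injective[OF J]) (use h in \<open>auto simp: module_iso_def\<close>)
  moreover have "?g \<in> Morphisms R" using J Y q(1) by (simp add: Morphisms_def)
  ultimately show thesis using that[of ?g] q(2) by simp
qed

text \<open>
  The map is \<open>E \<rightarrow> 0\<close> for the module \<open>E\<close> of additive maps from \<open>R\<close> to the nonzero complex numbers: a
  character of \<open>A\<close> that is nontrivial at \<open>a\<close> yields a linear map \<open>A \<rightarrow> E\<close> that does not vanish at \<open>a\<close>.
\<close>

lemma injective_cogenerator:
  fixes R :: "'r ring"
  assumes inacc: "strongly_inaccessible (UNIV :: 'u set)" and small: "carrier R \<prec> (UNIV :: 'u set)"
    and ring: "ring R"
  obtains g :: "('r, 'u) morphism" where "g \<in> Morphisms R" "Map g ` carrier (Dom g) = carrier (Cod g)"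
    "Dom g \<in> right_perp R (Modules R)" "carrier (Cod g) = {\<zero>\<^bsub>Cod g\<^esub>}" "kernel_module g = Dom g"
    "\<And>A a. A \<in> (Modules R :: ('r, 'u) module set) \<Longrightarrow> a \<in> carrier A \<Longrightarrow> a \<noteq> \<zero>\<^bsub>A\<^esub> \<Longrightarrow>
      \<exists>u\<in>lin_maps R A (Dom g). u a \<noteq> \<zero>\<^bsub>Dom g\<^esub>"
proof -
  interpret R: ring R by fact
  let ?D = "{()}"
  let ?E = "cofree_module R ?D"
  note E = left_module_cofree_module[OF ring, of ?D]
  interpret E: abelian_group ?E using E by (rule left_module_imp_abelian_group)
  obtain J :: "('r, 'u) module" and h where J: "J \<in> Modules R" and h: "h \<in> lin_maps R ?E J"
    "bij_betw h (carrier ?E) (carrier J)"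
    using transport_to_universe[OF E small_cofree_module[OF inacc small small_finite[OF inacc]]] by blast
  note Jm = ModulesD[OF J]
  let ?Z = "J\<lparr>carrier := {\<zero>\<^bsub>J\<^esub>}\<rparr>" and ?z = "\<lambda>x\<in>carrier J. \<zero>\<^bsub>J\<^esub>"
  interpret J: abelian_group J using Jm by (rule left_module_imp_abelian_group)
  have "is_submodule R J {\<zero>\<^bsub>J\<^esub>}" by (simp add: is_submodule_def smult_zero[OF Jm])
  note Z = Modules_submodule[OF J this]
  have z: "?z \<in> lin_maps R J ?Z" by (rule lin_maps_corestrict[OF lin_maps_zero_map[OF Jm Jm]]) simp
  let ?g = "Morphism J ?Z ?z"
  have "?g \<in> Morphisms R" using J Z z by (simp add: Morphisms_def)
  moreover have "Map ?g ` carrier (Dom ?g) = carrier (Cod ?g)" using J.zero_closed by auto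
  moreover have "J \<in> right_perp R (Modules R)"
    by (rule cofree_module_copy_injective[OF J]) (use h in \<open>auto simp: module_iso_def\<close>)
  moreover have "kernel_module ?g = J"
  proof -
    have "a_kernel J ?Z ?z = carrier J" by (auto simp: mem_a_kernel)
    then show ?thesis by simp
  qed
  moreover have "\<exists>u\<in>lin_maps R A J. u a \<noteq> \<zero>\<^bsub>J\<^esub>"
    if A: "A \<in> Modules R" and a: "a \<in> carrier A" "a \<noteq> \<zero>\<^bsub>A\<^esub>" for A :: "('r, 'u) module" and a
  proof -
    note Am = ModulesD[OF A]
    obtain \<chi> where \<chi>: "\<And>x. x \<in> carrier A \<Longrightarrow> \<chi> x \<noteq> (0 :: complex)"
      "\<And>x y. x \<in> carrier A \<Longrightarrow> y \<in> carrier A \<Longrightarrow> \<chi> (x \<oplus>\<^bsub>A\<^esub> y) = \<chi> x * \<chi> y" "\<chi> a \<noteq> 1"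
      using separating_character[OF comm_group_add_monoid[OF Am], of a] a by auto
    let ?u = "\<lambda>m\<in>carrier A. \<lambda>(r, d). if r \<in> carrier R \<and> d \<in> ?D then \<chi> (r \<odot>\<^bsub>A\<^esub> m) else 1"
    have u: "?u \<in> lin_maps R A ?E"
      by (rule lin_map_of_characters[OF Am, of ?D "\<lambda>_. \<chi>"]) (use \<chi> in auto)
    have "?u a (\<one>\<^bsub>R\<^esub>, ()) \<noteq> 1" using a \<chi>(3) left_module.smult_one[OF Am a(1)] by simp
    then have ne: "?u a \<noteq> \<zero>\<^bsub>?E\<^esub>" by (auto simp only: cofree_module_ops)
    have "h (?u a) \<noteq> h \<zero>\<^bsub>?E\<^esub>"
      using inj_onD[OF bij_betw_imp_inj_on[OF h(2)] _ lin_maps_closed[OF u a(1)] E.zero_closed] ne by blast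
    then have "compose (carrier A) h ?u a \<noteq> \<zero>\<^bsub>J\<^esub>"
      using a lin_maps_zero[OF E Jm h(1)] by (simp only: compose_eq) simp
    then show ?thesis using lin_maps_compose[OF Am u h(1)] by blast
  qed
  ultimately show thesis using that[of ?g] by simp
qed


section \<open>Orthogonal classes and lifting properties\<close>

lemma perp_antimono: "\<S> \<subseteq> \<S>' \<Longrightarrow> left_perp R \<S>' \<subseteq> left_perp R \<S>"
  by (auto simp: left_perp_def)

lemma left_perp_iso:
  assumes \<S>: "\<S> \<subseteq> Modules R" and M: "M \<in> Modules R" and iso: "module_iso R Q M" and Q: "Q \<in> left_perp R \<S>"
  shows "M \<in> left_perp R \<S>"
proof -
  have Qm: "Q \<in> Modules R" using Q by (simp add: left_perp_def)
  have "trivial_group (Ext1 R M C)" if C: "C \<in> \<S>" for C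
  proof -
    have "C \<in> Modules R" using C \<S> by blast
    moreover have "trivial_group (Ext1 R Q C)" using C Q by (simp add: left_perp_def)
    ultimately show ?thesis using trivial_Ext1_iso_left[OF ModulesD[OF Qm] ModulesD[OF M] ModulesD iso] by blast
  qed
  then show ?thesis using M by (simp add: left_perp_def)
qed

lemma right_perp_iso:
  assumes \<S>: "\<S> \<subseteq> Modules R" and M: "M \<in> Modules R" and iso: "module_iso R N M" and N: "N \<in> right_perp R \<S>"
  shows "M \<in> right_perp R \<S>"
proof -
  have Nm: "N \<in> Modules R" using N by (simp add: right_perp_def)
  have "trivial_group (Ext1 R Q M)" if Q: "Q \<in> \<S>" for Q
  proof -
    have "Q \<in> Modules R" using Q \<S> by blast
    moreover have "trivial_group (Ext1 R Q N)" using Q N by (simp add: right_perp_def)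
    ultimately show ?thesis using trivial_Ext1_iso_right[OF ModulesD ModulesD[OF Nm] ModulesD[OF M] iso] by blast
  qed
  then show ?thesis using M by (simp add: right_perp_def)
qed

lemma mem_C_Epi: "g \<in> C_Epi R \<C> \<longleftrightarrow>
    g \<in> Morphisms R \<and> Map g ` carrier (Dom g) = carrier (Cod g) \<and> kernel_module g \<in> \<C>"
  by (simp add: C_Epi_def)

lemma inclusion_Morphisms:
  assumes P: "P \<in> Modules R" and S: "is_submodule R P S"
  shows "Morphism (P\<lparr>carrier := S\<rparr>) P (\<lambda>x\<in>S. x) \<in> Morphisms R"
proof -
  have "S \<subseteq> carrier P" using S by (simp add: is_submodule_def)
  then have "restrict (\<lambda>x\<in>carrier P. x) S = (\<lambda>x\<in>S. x)" by (auto simp: fun_eq_iff restrict_def)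
  then have "(\<lambda>x\<in>S. x) \<in> lin_maps R (P\<lparr>carrier := S\<rparr>) P"
    using lin_maps_restrict[OF ModulesD[OF P] S lin_maps_id[OF ModulesD[OF P]]] by simp
  then show ?thesis using Modules_submodule[OF P S] P by (simp add: Morphisms_def)
qed

lemma inclusion_in_F_Mono:
  assumes P: "P \<in> Modules R" and S: "is_submodule R P S" and \<F>: "\<F> \<subseteq> Modules R" and Q: "Q \<in> \<F>"
    and q: "q \<in> lin_maps R P Q" "q ` carrier P = carrier Q" "\<forall>x\<in>carrier P. q x = \<zero>\<^bsub>Q\<^esub> \<longleftrightarrow> x \<in> S"
  shows "Morphism (P\<lparr>carrier := S\<rparr>) P (\<lambda>x\<in>S. x) \<in> F_Mono R \<F>"
proof -
  have "(\<lambda>x\<in>S. x) ` S = S" by auto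
  then show ?thesis
    unfolding mem_F_Mono_iff[OF inclusion_Morphisms[OF P S] \<F>]
    using Q q by (auto intro!: inj_onI)
qed

lemma transported_free_cover:
  fixes R :: "'r ring" and M :: "('r, 'u) module"
  assumes inacc: "strongly_inaccessible (UNIV :: 'u set)" and small: "carrier R \<prec> (UNIV :: 'u set)"
    and M: "M \<in> Modules R"
  obtains P :: "('r, 'u) module" and h h' where "P \<in> Modules R"
    "h \<in> lin_maps R (free_cover R M) P" "h' \<in> lin_maps R P (free_cover R M)"
    "bij_betw h (carrier (free_cover R M)) (carrier P)" "bij_betw h' (carrier P) (carrier (free_cover R M))"
    "\<And>p. p \<in> carrier (free_cover R M) \<Longrightarrow> h' (h p) = p"
proof -
  note F = left_module_free_cover[OF left_module_imp_ring[OF ModulesD[OF M]], of M]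
  obtain P :: "('r, 'u) module" and h where P: "P \<in> Modules R"
    and h: "h \<in> lin_maps R (free_cover R M) P" "bij_betw h (carrier (free_cover R M)) (carrier P)"
    using transport_to_universe[OF F small_free_cover[OF inacc small Modules_small[OF M]]] .
  obtain h' where "h' \<in> lin_maps R P (free_cover R M)" "bij_betw h' (carrier P) (carrier (free_cover R M))"
    "\<And>p. p \<in> carrier (free_cover R M) \<Longrightarrow> h' (h p) = p"
    using lin_maps_inverse[OF F ModulesD[OF P] h] by metis
  then show thesis using that P h by metis
qed

text \<open>
  Let \<open>P\<close> be a free module that covers the codomain of \<open>g\<close>. The map \<open>0 \<rightarrow> P\<close> is a monomorphism with
  cokernel \<open>P\<close>, which is in every left orthogonal class; its lift makes the covering factor through \<open>g\<close>.
\<close>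

lemma right_box_F_Mono_surj:
  fixes R :: "'r ring" and \<S> :: "('r, 'u) module set"
  assumes inacc: "strongly_inaccessible (UNIV :: 'u set)" and small: "carrier R \<prec> (UNIV :: 'u set)"
    and \<S>: "\<S> \<subseteq> Modules R" and g: "g \<in> right_box R (F_Mono R (left_perp R \<S>))"
  shows "Map g ` carrier (Dom g) = carrier (Cod g)"
proof
  have gM: "g \<in> Morphisms R" using g by (simp add: right_box_def)
  note D = MorphismsD[OF gM]
  show "Map g ` carrier (Dom g) \<subseteq> carrier (Cod g)" using lin_maps_closed[OF D(3)] by auto
  have YM: "Cod g \<in> Modules R" using gM by (simp add: Morphisms_def)
  let ?F = "free_cover R (Cod g)" and ?\<pi> = "cover_map R (Cod g)"
  note F = left_module_free_cover[OF left_module_imp_ring[OF D(1)], of "Cod g"]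
  obtain P :: "('r, 'u) module" and h h' where P: "P \<in> Modules R"
    and h: "h \<in> lin_maps R ?F P" "h' \<in> lin_maps R P ?F"
    "bij_betw h (carrier ?F) (carrier P)" "bij_betw h' (carrier P) (carrier ?F)"
    using transported_free_cover[OF inacc small YM] by metis
  note Pm = ModulesD[OF P]
  interpret P: abelian_group P using Pm by (rule left_module_imp_abelian_group)
  have "module_iso R ?F P" using h unfolding module_iso_def by blast
  then have "trivial_group (Ext1 R P C)" if "C \<in> \<S>" for C
    using trivial_Ext1_iso_left[OF F Pm _ _ trivial_Ext1_free_cover] that \<S> ModulesD by blast
  then have PF: "P \<in> left_perp R \<S>" using P by (simp add: left_perp_def)
  let ?S = "{\<zero>\<^bsub>P\<^esub>}"
  let ?f = "Morphism (P\<lparr>carrier := ?S\<rparr>) P (\<lambda>x\<in>?S. x)"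
  have S: "is_submodule R P ?S" by (simp add: is_submodule_def smult_zero[OF Pm])
  have f: "?f \<in> F_Mono R (left_perp R \<S>)"
    by (rule inclusion_in_F_Mono[OF P S _ PF lin_maps_id[OF Pm]]) (auto simp: left_perp_def)
  then have fM: "?f \<in> Morphisms R" by (simp add: F_Mono_def)
  have lift: "lifts_against R ?f g" using f g by (simp add: right_box_def)
  let ?u = "\<lambda>x\<in>?S. \<zero>\<^bsub>Dom g\<^esub>" and ?v = "compose (carrier P) ?\<pi> h'"
  have u: "?u \<in> lin_maps R (P\<lparr>carrier := ?S\<rparr>) (Dom g)"
    using lin_maps_zero_map[OF left_module_submodule[OF Pm S] D(1)] by simp
  have v: "?v \<in> lin_maps R P (Cod g)" by (rule lin_maps_compose[OF Pm h(2) cover_map_lin_maps[OF D(2)]])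
  have "Map g (?u a) = ?v (Map ?f a)" if "a \<in> carrier (Dom ?f)" for a
    using that lin_maps_zero[OF D] lin_maps_zero[OF Pm D(2) v] by simp
  then obtain d where d: "d \<in> lin_maps R P (Dom g)" "\<forall>b\<in>carrier P. Map g (d b) = ?v b"
    using lift u v unfolding lifts_against_iff[OF fM gM] by fastforce
  show "carrier (Cod g) \<subseteq> Map g ` carrier (Dom g)"
  proof
    fix y assume "y \<in> carrier (Cod g)"
    then have "y \<in> ?\<pi> ` carrier ?F" using cover_map_surj[OF D(2)] by simp
    then obtain p where p: "y = ?\<pi> p" "p \<in> carrier ?F" by (rule imageE)
    have "p \<in> h' ` carrier P" using p(2) h(4) by (simp add: bij_betw_def)
    then obtain b where b: "p = h' b" "b \<in> carrier P" by (rule imageE)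
    have "y = Map g (d b)" using d(2) b p by (simp add: compose_eq)
    then show "y \<in> Map g ` carrier (Dom g)" using lin_maps_closed[OF d(1) b(2)] by (rule image_eqI)
  qed
qed

text \<open>
  For \<open>Q \<in> \<F>\<close> with free presentation \<open>K \<rightarrow> P \<rightarrow> Q\<close>, the inclusion \<open>K \<rightarrow> P\<close> is itself an
  \<open>\<F>\<close>-monomorphism. A map from \<open>K\<close> to the kernel of \<open>g\<close> and the zero map from \<open>P\<close> to the codomain
  form a square, whose lift takes values in the kernel and extends the given map to \<open>P\<close>.
\<close>

lemma right_box_F_Mono_kernel:
  fixes R :: "'r ring" and \<F> :: "('r, 'u) module set"
  assumes inacc: "strongly_inaccessible (UNIV :: 'u set)" and small: "carrier R \<prec> (UNIV :: 'u set)"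
    and \<F>: "\<F> \<subseteq> Modules R" and g: "g \<in> right_box R (F_Mono R \<F>)"
  shows "kernel_module g \<in> right_perp R \<F>"
proof -
  have gM: "g \<in> Morphisms R" using g by (simp add: right_box_def)
  note D = MorphismsD[OF gM]
  note NM = kernel_module_Modules[OF gM]
  have "trivial_group (Ext1 R Q (kernel_module g))" if Q: "Q \<in> \<F>" for Q
  proof -
    have QM: "Q \<in> Modules R" using Q \<F> by blast
    note Qm = ModulesD[OF QM]
    let ?F = "free_cover R Q" and ?\<pi> = "cover_map R Q" and ?K = "relation_module R Q"
    note F = left_module_free_cover[OF left_module_imp_ring[OF D(1)], of Q]
    note \<pi> = cover_map_lin_maps[OF Qm] cover_map_surj[OF Qm]
    obtain P :: "('r, 'u) module" and h h' where P: "P \<in> Modules R"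
      and h: "h \<in> lin_maps R ?F P" "h' \<in> lin_maps R P ?F"
      "bij_betw h (carrier ?F) (carrier P)" "bij_betw h' (carrier P) (carrier ?F)"
      and h'h: "\<And>p. p \<in> carrier ?F \<Longrightarrow> h' (h p) = p"
      using transported_free_cover[OF inacc small QM] by metis
    note Pm = ModulesD[OF P]
    let ?q = "compose (carrier P) ?\<pi> h'"
    have q: "?q \<in> lin_maps R P Q" by (rule lin_maps_compose[OF Pm h(2) \<pi>(1)])
    have "?q ` carrier P = ?\<pi> ` h' ` carrier P" by (auto simp: compose_def)
    then have q_surj: "?q ` carrier P = carrier Q" using \<pi>(2) h(4) by (simp add: bij_betw_def)
    let ?S = "a_kernel P Q ?q"
    note S = is_submodule_kernel[OF Pm Qm q]
    let ?f = "Morphism (P\<lparr>carrier := ?S\<rparr>) P (\<lambda>x\<in>?S. x)"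
    have f: "?f \<in> F_Mono R \<F>"
      by (rule inclusion_in_F_Mono[OF P S \<F> Q q q_surj]) (simp add: mem_a_kernel)
    then have fM: "?f \<in> Morphisms R" by (simp add: F_Mono_def)
    have lift: "lifts_against R ?f g" using f g by (simp add: right_box_def)
    have hK: "h k \<in> ?S" if "k \<in> carrier ?K" for k
      using that lin_maps_closed[OF h(1)] h'h by (simp add: mem_a_kernel mem_relation_module compose_eq)
    have "restrict h' ?S \<in> lin_maps R (P\<lparr>carrier := ?S\<rparr>) (?F\<lparr>carrier := carrier ?K\<rparr>)"
    proof (rule lin_maps_corestrict[OF lin_maps_restrict[OF Pm S h(2)]])
      fix x assume "x \<in> carrier (P\<lparr>carrier := ?S\<rparr>)"
      then show "restrict h' ?S x \<in> carrier ?K"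
        using lin_maps_closed[OF h(2)] by (auto simp: mem_a_kernel mem_relation_module compose_eq)
    qed
    then have h'S: "restrict h' ?S \<in> lin_maps R (P\<lparr>carrier := ?S\<rparr>) ?K"
      by (simp flip: relation_module_carrier_update)
    show ?thesis
      unfolding trivial_Ext1_iff[OF Qm ModulesD[OF NM]]
    proof
      fix \<phi> assume \<phi>: "\<phi> \<in> lin_maps R ?K (kernel_module g)"
      let ?u = "compose ?S \<phi> (restrict h' ?S)" and ?v = "\<lambda>x\<in>carrier P. \<zero>\<^bsub>Cod g\<^esub>"
      have "?u \<in> lin_maps R (P\<lparr>carrier := ?S\<rparr>) (kernel_module g)"
        using lin_maps_compose[OF left_module_submodule[OF Pm S] h'S \<phi>] by simp
      then have uN: "?u \<in> lin_maps R (P\<lparr>carrier := ?S\<rparr>) (kernel_module g)" .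
      have u: "?u \<in> lin_maps R (P\<lparr>carrier := ?S\<rparr>) (Dom g)"
        by (rule lin_maps_into_submodule[OF uN]) (auto simp: mem_a_kernel)
      have v: "?v \<in> lin_maps R P (Cod g)" by (rule lin_maps_zero_map[OF Pm D(2)])
      have square: "Map g (?u a) = ?v (Map ?f a)" if "a \<in> carrier (Dom ?f)" for a
      proof -
        have a: "a \<in> ?S" using that by simp
        have "?u a \<in> a_kernel (Dom g) (Cod g) (Map g)" using lin_maps_closed[OF uN, of a] a by simp
        then have "Map g (?u a) = \<zero>\<^bsub>Cod g\<^esub>" unfolding mem_a_kernel by (rule conjunct2)
        moreover have "?v (Map ?f a) = \<zero>\<^bsub>Cod g\<^esub>" using a by (simp add: mem_a_kernel)
        ultimately show ?thesis by (simp only:)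
      qed
      have "\<exists>d\<in>lin_maps R (Cod ?f) (Dom g).
        (\<forall>a\<in>carrier (Dom ?f). d (Map ?f a) = ?u a) \<and> (\<forall>b\<in>carrier (Cod ?f). Map g (d b) = ?v b)"
        using lift unfolding lifts_against_iff[OF fM gM]
        by (elim ballE[of _ _ ?u] ballE[of _ _ ?v] impE) (use u v square in \<open>simp_all only: morphism.sel ball_simps, auto\<close>)
      then obtain d where d: "d \<in> lin_maps R P (Dom g)"
        and du: "\<forall>a\<in>?S. d ((\<lambda>x\<in>?S. x) a) = ?u a" and gd: "\<forall>b\<in>carrier P. Map g (d b) = ?v b"
        by auto
      have "d \<in> lin_maps R P (kernel_module g)"
        by (rule lin_maps_corestrict[OF d]) (use gd lin_maps_closed[OF d] in \<open>simp add: mem_a_kernel\<close>)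
      then have "compose (carrier ?F) d h \<in> lin_maps R ?F (kernel_module g)"
        by (rule lin_maps_compose[OF F h(1)])
      moreover have "compose (carrier ?F) d h k = \<phi> k" if k: "k \<in> carrier ?K" for k
      proof -
        have kF: "k \<in> carrier ?F" using k by (simp add: mem_relation_module)
        have "d (h k) = ?u (h k)" using bspec[OF du hK[OF k]] hK[OF k] by simp
        also have "\<dots> = \<phi> k" using hK[OF k] h'h[OF kF] by (simp add: compose_eq)
        finally show ?thesis using kF by (simp add: compose_eq)
      qed
      ultimately show "\<exists>\<psi>\<in>lin_maps R ?F (kernel_module g). \<forall>k\<in>carrier ?K. \<psi> k = \<phi> k" by blast
    qed
  qed
  then show ?thesis using NM by (simp add: right_perp_def)
qed

text \<open>
  A nonzero \<open>a\<close> with \<open>f a = 0\<close> would be sent to \<open>0\<close> by every map to the cogenerator that extends along \<open>f\<close>.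
\<close>

lemma mono_of_lifts_against_cogenerator:
  assumes f: "f \<in> Morphisms R" and g: "g \<in> Morphisms R" and zero: "carrier (Cod g) = {\<zero>\<^bsub>Cod g\<^esub>}"
    and cogen: "\<And>a. a \<in> carrier (Dom f) \<Longrightarrow> a \<noteq> \<zero>\<^bsub>Dom f\<^esub> \<Longrightarrow>
      \<exists>u\<in>lin_maps R (Dom f) (Dom g). u a \<noteq> \<zero>\<^bsub>Dom g\<^esub>"
    and lift: "lifts_against R f g"
  shows "inj_on (Map f) (carrier (Dom f))"
proof (rule lin_maps_inj[OF MorphismsD[OF f]], rule ccontr)
  note Df = MorphismsD[OF f] and Dg = MorphismsD[OF g]
  fix a assume a: "a \<in> carrier (Dom f)" "Map f a = \<zero>\<^bsub>Cod f\<^esub>" "a \<noteq> \<zero>\<^bsub>Dom f\<^esub>"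
  obtain u where u: "u \<in> lin_maps R (Dom f) (Dom g)" "u a \<noteq> \<zero>\<^bsub>Dom g\<^esub>" using cogen[OF a(1,3)] by blast
  let ?v = "\<lambda>x\<in>carrier (Cod f). \<zero>\<^bsub>Cod g\<^esub>"
  have v: "?v \<in> lin_maps R (Cod f) (Cod g)" by (rule lin_maps_zero_map[OF Df(2) Dg(2)])
  have "Map g (u x) = ?v (Map f x)" if "x \<in> carrier (Dom f)" for x
    using lin_maps_closed[OF Dg(3) lin_maps_closed[OF u(1) that]] zero lin_maps_closed[OF Df(3) that] by simp
  then obtain d where d: "d \<in> lin_maps R (Cod f) (Dom g)" "\<forall>x\<in>carrier (Dom f). d (Map f x) = u x"
    using lift u(1) v unfolding lifts_against_iff[OF f g] by blast
  then have "u a = d (Map f a)" using a(1) by simp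
  also have "\<dots> = \<zero>\<^bsub>Dom g\<^esub>" unfolding a(2) by (rule lin_maps_zero[OF Df(2) Dg(1) d(1)])
  finally show False using u(2) by simp
qed

text \<open>
  Let \<open>f : A \<rightarrow> B\<close>, \<open>g : J \<rightarrow> Y\<close>, and let \<open>N\<close> be the kernel of \<open>g\<close>. Every map \<open>w : Q \<rightarrow> Y\<close> factors through
  \<open>g\<close>: the lift of \<open>w q : B \<rightarrow> Y\<close> that is zero on \<open>A\<close> factors through \<open>Q\<close>. For an epimorphism \<open>g\<close>
  the conclusion follows from the exactness of \<open>Hom(Q, J) \<rightarrow> Hom(Q, Y) \<rightarrow> Ext\<^sup>1(Q, N) \<rightarrow> Ext\<^sup>1(Q, J)\<close>. In terms of
  the free presentation of \<open>Q\<close>, and for any \<open>g\<close>, a map \<open>\<phi>\<close> on the relation module is extended to \<open>\<psi>\<close> with values in \<open>J\<close>; then \<open>g \<psi>\<close> induces a map \<open>w\<close> on \<open>Q\<close>, and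
  subtracting from \<open>\<psi>\<close> the factorization \<open>e\<close> of \<open>w\<close> moves its values into \<open>N\<close>.
\<close>

lemma trivial_Ext1_of_lifts_against:
  assumes f: "f \<in> Morphisms R" and g: "g \<in> Morphisms R"
    and Q: "left_module R Q"
    and q: "q \<in> lin_maps R (Cod f) Q" "q ` carrier (Cod f) = carrier Q"
      "\<forall>b\<in>carrier (Cod f). q b = \<zero>\<^bsub>Q\<^esub> \<longleftrightarrow> b \<in> Map f ` carrier (Dom f)"
    and J: "trivial_group (Ext1 R Q (Dom g))" and lift: "lifts_against R f g"
  shows "trivial_group (Ext1 R Q (kernel_module g))"
proof -
  note Df = MorphismsD[OF f] and Dg = MorphismsD[OF g]
  let ?F = "free_cover R Q" and ?\<pi> = "cover_map R Q" and ?K = "relation_module R Q"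
  note F = left_module_free_cover[OF left_module_imp_ring[OF Q], of Q]
  note \<pi> = cover_map_lin_maps[OF Q] cover_map_surj[OF Q]
  note N = left_module_submodule[OF Dg(1) is_submodule_kernel[OF Dg]]
  interpret J: abelian_group "Dom g" using Dg(1) by (rule left_module_imp_abelian_group)
  interpret Y: abelian_group "Cod g" using Dg(2) by (rule left_module_imp_abelian_group)
  show ?thesis
    unfolding trivial_Ext1_iff[OF Q N]
  proof
    fix \<phi> assume \<phi>: "\<phi> \<in> lin_maps R ?K (kernel_module g)"
    have "\<phi> \<in> lin_maps R ?K (Dom g)" by (rule lin_maps_into_submodule[OF \<phi>]) (auto simp: mem_a_kernel)
    then obtain \<psi> where \<psi>: "\<psi> \<in> lin_maps R ?F (Dom g)" "\<forall>k\<in>carrier ?K. \<psi> k = \<phi> k"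
      using J unfolding trivial_Ext1_iff[OF Q Dg(1)] by blast
    let ?g\<psi> = "compose (carrier ?F) (Map g) \<psi>"
    have "?g\<psi> k = \<zero>\<^bsub>Cod g\<^esub>" if "k \<in> carrier ?F" "?\<pi> k = \<zero>\<^bsub>Q\<^esub>" for k
    proof -
      have k: "k \<in> carrier ?K" using that by (simp add: mem_relation_module)
      then show ?thesis
        using lin_maps_closed[OF \<phi> k] \<psi>(2) that(1) by (simp add: mem_a_kernel compose_eq)
    qed
    then have "\<forall>k\<in>carrier ?F. ?\<pi> k = \<zero>\<^bsub>Q\<^esub> \<longrightarrow> ?g\<psi> k = \<zero>\<^bsub>Cod g\<^esub>" by blast
    from lin_map_factor[OF F Q Dg(2) \<pi> lin_maps_compose[OF F \<psi>(1) Dg(3)] this]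
    obtain w where w: "w \<in> lin_maps R Q (Cod g)" "\<And>p. p \<in> carrier ?F \<Longrightarrow> w (?\<pi> p) = ?g\<psi> p" by blast
    let ?u = "\<lambda>x\<in>carrier (Dom f). \<zero>\<^bsub>Dom g\<^esub>" and ?v = "compose (carrier (Cod f)) w q"
    have u: "?u \<in> lin_maps R (Dom f) (Dom g)" by (rule lin_maps_zero_map[OF Df(1) Dg(1)])
    have v: "?v \<in> lin_maps R (Cod f) (Cod g)" by (rule lin_maps_compose[OF Df(2) q(1) w(1)])
    have "Map g (?u a) = ?v (Map f a)" if a: "a \<in> carrier (Dom f)" for a
    proof -
      have "q (Map f a) = \<zero>\<^bsub>Q\<^esub>" using bspec[OF q(3) lin_maps_closed[OF Df(3) a]] a by blast
      then show ?thesis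
        using a lin_maps_closed[OF Df(3) a] lin_maps_zero[OF Dg] lin_maps_zero[OF Q Dg(2) w(1)] by (simp add: compose_eq)
    qed
    then obtain d where d: "d \<in> lin_maps R (Cod f) (Dom g)" "\<forall>a\<in>carrier (Dom f). d (Map f a) = ?u a"
      "\<forall>b\<in>carrier (Cod f). Map g (d b) = ?v b"
      using lift u v unfolding lifts_against_iff[OF f g] by blast
    have "\<forall>b\<in>carrier (Cod f). q b = \<zero>\<^bsub>Q\<^esub> \<longrightarrow> d b = \<zero>\<^bsub>Dom g\<^esub>"
    proof (intro ballI impI)
      fix b assume "b \<in> carrier (Cod f)" "q b = \<zero>\<^bsub>Q\<^esub>"
      then have "b \<in> Map f ` carrier (Dom f)" using q(3) by blast
      then obtain a where "b = Map f a" "a \<in> carrier (Dom f)" by (rule imageE)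
      then show "d b = \<zero>\<^bsub>Dom g\<^esub>" using d(2) by simp
    qed
    from lin_map_factor[OF Df(2) Q Dg(1) q(1,2) d(1) this]
    obtain e where e: "e \<in> lin_maps R Q (Dom g)" "\<And>b. b \<in> carrier (Cod f) \<Longrightarrow> e (q b) = d b" by blast
    have ge: "Map g (e y) = w y" if y: "y \<in> carrier Q" for y
    proof -
      have "y \<in> q ` carrier (Cod f)" using y q(2) by simp
      then obtain b where b: "y = q b" "b \<in> carrier (Cod f)" by (rule imageE)
      then show ?thesis using d(3) e(2)[OF b(2)] by (simp add: compose_eq)
    qed
    let ?e = "compose (carrier ?F) e ?\<pi>"
    have e\<pi>: "?e \<in> lin_maps R ?F (Dom g)" by (rule lin_maps_compose[OF F \<pi>(1) e(1)])
    let ?d = "\<lambda>p\<in>carrier ?F. \<psi> p \<ominus>\<^bsub>Dom g\<^esub> ?e p"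
    note dl = lin_maps_diff[OF F Dg(1) \<psi>(1) e\<pi>]
    have "?d \<in> lin_maps R ?F (kernel_module g)"
    proof (rule lin_maps_corestrict[OF dl])
      fix p assume p: "p \<in> carrier ?F"
      note \<psi>p = lin_maps_closed[OF \<psi>(1) p] and ep = lin_maps_closed[OF e\<pi> p]
      have "Map g (?e p) = Map g (\<psi> p)"
        using ge[OF lin_maps_closed[OF \<pi>(1) p]] w(2)[OF p] p by (simp add: compose_eq)
      then have "Map g (\<psi> p) \<ominus>\<^bsub>Cod g\<^esub> Map g (?e p) = \<zero>\<^bsub>Cod g\<^esub>"
        using lin_maps_closed[OF Dg(3) \<psi>p] by (simp only: a_minus_def Y.r_neg)
      then have "Map g (\<psi> p \<ominus>\<^bsub>Dom g\<^esub> ?e p) = \<zero>\<^bsub>Cod g\<^esub>"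
        by (simp only: lin_maps_diff_apply[OF Dg \<psi>p ep])
      then show "?d p \<in> a_kernel (Dom g) (Cod g) (Map g)"
        using p \<psi>p ep by (simp add: mem_a_kernel)
    qed
    moreover have "?d k = \<phi> k" if k: "k \<in> carrier ?K" for k
    proof -
      have kF: "k \<in> carrier ?F" "?\<pi> k = \<zero>\<^bsub>Q\<^esub>" using k by (simp_all add: mem_relation_module)
      have "?e k = \<zero>\<^bsub>Dom g\<^esub>" using kF lin_maps_zero[OF Q Dg(1) e(1)] by (simp add: compose_eq)
      then show ?thesis using kF \<psi>(2) k lin_maps_closed[OF \<psi>(1) kF(1)] by (simp add: a_minus_def)
    qed
    ultimately show "\<exists>\<psi>\<in>lin_maps R ?F (kernel_module g). \<forall>k\<in>carrier ?K. \<psi> k = \<phi> k" by blast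
  qed
qed

lemma cokernel_exists:
  fixes f :: "('r, 'u) morphism"
  assumes f: "f \<in> Morphisms R"
  obtains Q :: "('r, 'u) module" and q where "Q \<in> Modules R" "q \<in> lin_maps R (Cod f) Q"
    "q ` carrier (Cod f) = carrier Q"
    "\<forall>b\<in>carrier (Cod f). q b = \<zero>\<^bsub>Q\<^esub> \<longleftrightarrow> b \<in> Map f ` carrier (Dom f)"
proof -
  note D = MorphismsD[OF f]
  note S = is_submodule_image[OF D]
  let ?C = "quot_module (Cod f) (Map f ` carrier (Dom f))"
  note quot = quot_module_projection[OF D(2) S]
  have "lepoll (carrier ?C) (carrier (Cod f))"
    by (subst quot(3)[symmetric]) (rule image_lepoll)
  moreover have "carrier (Cod f) \<prec> (UNIV :: 'u set)"
    using f by (simp add: Morphisms_def Modules_def)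
  ultimately have "carrier ?C \<prec> (UNIV :: 'u set)" using lesspoll_trans1 by blast
  then obtain Q :: "('r, 'u) module" and k where Q: "Q \<in> Modules R"
    and k: "k \<in> lin_maps R ?C Q" "bij_betw k (carrier ?C) (carrier Q)"
    using transport_to_universe[OF quot(1)] by blast
  have "module_iso R ?C Q" using k unfolding module_iso_def by blast
  from module_iso_sym[OF quot(1) ModulesD[OF Q] this] show thesis
    unfolding module_iso_quot_iff[OF D(2) S ModulesD[OF Q]] using that[OF Q] by blast
qed

text \<open>
  The test maps are \<open>E \<rightarrow> 0\<close> for an injective cogenerator \<open>E\<close>, which detects monomorphisms, and for each
  \<open>C \<in> \<S>\<close> a projection \<open>J \<rightarrow> J/C\<close> with \<open>J\<close> injective, which detects that \<open>Ext\<^sup>1(Q, C)\<close> vanishes for the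
  cokernel \<open>Q\<close>. For the class \<open>\<S> = \<C>\<close> of a cotorsion theory \<open>(\<F>, \<C>)\<close> this gives one half of the saturated
  pair; for a small \<open>\<S>\<close> it gives a set of generators.
\<close>

lemma test_maps_exist:
  fixes R :: "'r ring" and \<S> :: "('r, 'u) module set"
  assumes inacc: "strongly_inaccessible (UNIV :: 'u set)" and small: "carrier R \<prec> (UNIV :: 'u set)"
    and ring: "ring R" and \<S>: "\<S> \<subseteq> Modules R"
  obtains \<T> :: "('r, 'u) morphism set" where
    "\<S> \<prec> (UNIV :: 'u set) \<Longrightarrow> \<T> \<prec> (UNIV :: 'u set)"
    "\<T> \<subseteq> C_Epi R (right_perp R (left_perp R \<S>))"
    "left_box R \<T> \<subseteq> F_Mono R (left_perp R \<S>)"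
proof -
  obtain g0 :: "('r, 'u) morphism" where g0: "g0 \<in> Morphisms R" "Map g0 ` carrier (Dom g0) = carrier (Cod g0)"
    "Dom g0 \<in> right_perp R (Modules R)" "carrier (Cod g0) = {\<zero>\<^bsub>Cod g0\<^esub>}" "kernel_module g0 = Dom g0"
    and cogen: "\<And>A a. A \<in> (Modules R :: ('r, 'u) module set) \<Longrightarrow> a \<in> carrier A \<Longrightarrow> a \<noteq> \<zero>\<^bsub>A\<^esub> \<Longrightarrow>
      \<exists>u\<in>lin_maps R A (Dom g0). u a \<noteq> \<zero>\<^bsub>Dom g0\<^esub>"
    using injective_cogenerator[OF inacc small ring] by blast
  have "\<forall>C\<in>\<S>. \<exists>g :: ('r, 'u) morphism. g \<in> Morphisms R \<and> Map g ` carrier (Dom g) = carrier (Cod g) \<and>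
      Dom g \<in> right_perp R (Modules R) \<and> module_iso R C (kernel_module g)"
    (is "\<forall>C\<in>\<S>. ?ex C")
  proof
    fix C assume "C \<in> \<S>"
    then have "C \<in> Modules R" using \<S> by blast
    from injective_copresentation[OF inacc small this]
    obtain g :: "('r, 'u) morphism" where "g \<in> Morphisms R" "Map g ` carrier (Dom g) = carrier (Cod g)"
      "Dom g \<in> right_perp R (Modules R)" "module_iso R C (kernel_module g)" .
    then show "?ex C" by (intro exI[of _ g] conjI)
  qed
  from bchoice[OF this] obtain \<gamma> :: "('r, 'u) module \<Rightarrow> ('r, 'u) morphism" where \<gamma>: "\<forall>C\<in>\<S>. \<gamma> C \<in> Morphisms R \<and>
      Map (\<gamma> C) ` carrier (Dom (\<gamma> C)) = carrier (Cod (\<gamma> C)) \<and>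
      Dom (\<gamma> C) \<in> right_perp R (Modules R) \<and> module_iso R C (kernel_module (\<gamma> C))" ..
  let ?T = "insert g0 (\<gamma> ` \<S>)"
  let ?L = "left_perp R \<S>"
  have L: "?L \<subseteq> Modules R" by (auto simp: left_perp_def)
  have "?T \<prec> (UNIV :: 'u set)" if "\<S> \<prec> (UNIV :: 'u set)"
    by (rule small_insert[OF inacc]) (use image_lepoll that lesspoll_trans1 in blast)
  moreover have "?T \<subseteq> C_Epi R (right_perp R ?L)"
  proof
    fix g assume "g \<in> ?T"
    then consider "g = g0" | C where "C \<in> \<S>" "g = \<gamma> C" by blast
    then show "g \<in> C_Epi R (right_perp R ?L)"
    proof cases
      case 1
      have "Dom g0 \<in> right_perp R ?L" using g0(3) L by (auto simp: right_perp_def)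
      then show ?thesis unfolding 1 mem_C_Epi g0(5) using g0(1,2) by simp
    next
      case 2
      have C: "C \<in> right_perp R ?L" using 2(1) \<S> by (auto simp: right_perp_def left_perp_def)
      have g: "g \<in> Morphisms R" "Map g ` carrier (Dom g) = carrier (Cod g)" "module_iso R C (kernel_module g)"
        using \<gamma> 2 by auto
      show ?thesis
        unfolding mem_C_Epi using g right_perp_iso[OF L kernel_module_Modules[OF g(1)] g(3) C] by simp
    qed
  qed
  moreover have "left_box R ?T \<subseteq> F_Mono R ?L"
  proof
    fix f assume "f \<in> left_box R ?T"
    then have f: "f \<in> Morphisms R" and lift0: "lifts_against R f g0"
      and lift: "\<And>C. C \<in> \<S> \<Longrightarrow> lifts_against R f (\<gamma> C)"
      by (auto simp: left_box_def)
    have "Dom f \<in> Modules R" using f by (simp add: Morphisms_def)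
    then have "inj_on (Map f) (carrier (Dom f))"
      by (intro mono_of_lifts_against_cogenerator[OF f g0(1,4) _ lift0] cogen)
    moreover obtain Q :: "('r, 'u) module" and q where Q: "Q \<in> Modules R" and q: "q \<in> lin_maps R (Cod f) Q"
      "q ` carrier (Cod f) = carrier Q"
      "\<forall>b\<in>carrier (Cod f). q b = \<zero>\<^bsub>Q\<^esub> \<longleftrightarrow> b \<in> Map f ` carrier (Dom f)"
      using cokernel_exists[OF f] .
    moreover have "Q \<in> ?L"
    proof -
      have "trivial_group (Ext1 R Q C)" if C: "C \<in> \<S>" for C
      proof -
        have g: "\<gamma> C \<in> Morphisms R" "Map (\<gamma> C) ` carrier (Dom (\<gamma> C)) = carrier (Cod (\<gamma> C))"
          "Dom (\<gamma> C) \<in> right_perp R (Modules R)" "module_iso R C (kernel_module (\<gamma> C))"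
          using \<gamma> C by auto
        have Cm: "left_module R C" using C \<S> ModulesD by blast
        note Nm = ModulesD[OF kernel_module_Modules[OF g(1)]]
        have "trivial_group (Ext1 R Q (Dom (\<gamma> C)))" using g(3) Q by (simp add: right_perp_def)
        then have "trivial_group (Ext1 R Q (kernel_module (\<gamma> C)))"
          by (rule trivial_Ext1_of_lifts_against[OF f g(1) ModulesD[OF Q] q _ lift[OF C]])
        then show ?thesis
          by (rule trivial_Ext1_iso_right[OF ModulesD[OF Q] Nm Cm module_iso_sym[OF Cm Nm g(4)]])
      qed
      then show ?thesis using Q by (simp add: left_perp_def)
    qed
    ultimately show "f \<in> F_Mono R ?L" unfolding mem_F_Mono_iff[OF f L] by blast
  qed
  ultimately show thesis by (rule that)
qed


section \<open>The saturated pair of a cotorsion theory\<close>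

lemma cotorsion_theoryD:
  assumes "cotorsion_theory R \<F> \<C>"
  shows "right_perp R \<F> = \<C>" "left_perp R \<C> = \<F>" "\<F> \<subseteq> Modules R" "\<C> \<subseteq> Modules R"
proof -
  show C: "right_perp R \<F> = \<C>" and F: "left_perp R \<C> = \<F>"
    using assms unfolding cotorsion_theory_def by (metis, metis)
  show "\<F> \<subseteq> Modules R" by (subst F[symmetric]) (auto simp: left_perp_def)
  show "\<C> \<subseteq> Modules R" by (subst C[symmetric]) (auto simp: right_perp_def)
qed

lemma F_Mono_lifts_against_C_Epi:
  assumes "cotorsion_theory R \<F> \<C>" "f \<in> F_Mono R \<F>" "g \<in> C_Epi R \<C>"
  shows "lifts_against R f g"
proof -
  note \<F> = cotorsion_theoryD(3)[OF assms(1)]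
  have g: "g \<in> Morphisms R" "Map g ` carrier (Dom g) = carrier (Cod g)" "kernel_module g \<in> \<C>"
    using assms(3) by (simp_all add: mem_C_Epi)
  have "trivial_group (Ext1 R Q (kernel_module g))" if "Q \<in> \<F>" for Q
    using g(3) that unfolding cotorsion_theoryD(1)[OF assms(1), symmetric] by (simp add: right_perp_def)
  then show ?thesis by (rule F_Mono_lifts_against[OF assms(2) \<F> g(1,2)])
qed

lemma saturated_pair_cotorsion_theory:
  fixes R :: "'r ring" and \<F> \<C> :: "('r, 'u) module set"
  assumes inacc: "strongly_inaccessible (UNIV :: 'u set)" and ring: "ring R"
    and small: "carrier R \<prec> (UNIV :: 'u set)" and ct: "cotorsion_theory R \<F> \<C>"
  shows "saturated_pair R (F_Mono R \<F>) (C_Epi R \<C>)"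
proof -
  note \<C> = cotorsion_theoryD(1)[OF ct] and \<F> = cotorsion_theoryD(2)[OF ct]
  note sub = cotorsion_theoryD(4,3)[OF ct]
  have "C_Epi R \<C> = right_box R (F_Mono R \<F>)"
  proof
    show "C_Epi R \<C> \<subseteq> right_box R (F_Mono R \<F>)"
      using F_Mono_lifts_against_C_Epi[OF ct] by (auto simp: right_box_def mem_C_Epi)
    show "right_box R (F_Mono R \<F>) \<subseteq> C_Epi R \<C>"
    proof
      fix g assume g: "g \<in> right_box R (F_Mono R \<F>)"
      have "kernel_module g \<in> \<C>" using right_box_F_Mono_kernel[OF inacc small sub(2) g] \<C> by simp
      moreover have "Map g ` carrier (Dom g) = carrier (Cod g)"
        using right_box_F_Mono_surj[OF inacc small sub(1)] g \<F> by simp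
      ultimately show "g \<in> C_Epi R \<C>" using g by (simp add: mem_C_Epi right_box_def)
    qed
  qed
  moreover have "F_Mono R \<F> = left_box R (C_Epi R \<C>)"
  proof
    show "F_Mono R \<F> \<subseteq> left_box R (C_Epi R \<C>)"
      using F_Mono_lifts_against_C_Epi[OF ct] by (auto simp: left_box_def F_Mono_def)
    obtain \<T> :: "('r, 'u) morphism set" where \<T>: "\<T> \<subseteq> C_Epi R (right_perp R (left_perp R \<C>))"
      "left_box R \<T> \<subseteq> F_Mono R (left_perp R \<C>)"
      using test_maps_exist[OF inacc small ring sub(1)] by metis
    have "left_box R (C_Epi R \<C>) \<subseteq> left_box R \<T>" using \<T>(1) \<F> \<C> by (auto simp: left_box_def)
    then show "left_box R (C_Epi R \<C>) \<subseteq> F_Mono R \<F>" using \<T>(2) \<F> by auto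
  qed
  ultimately show ?thesis by (simp add: saturated_pair_def)
qed


section \<open>Generation by a set and fibrant generation\<close>

text \<open>The cokernel of \<open>0 \<rightarrow> M\<close> is \<open>M\<close>, so that the class of monomorphisms determines the class of modules.\<close>

lemma zero_inclusion_in_F_Mono_iff:
  assumes M: "M \<in> Modules R" and \<S>: "\<S> \<subseteq> Modules R"
  shows "Morphism (M\<lparr>carrier := {\<zero>\<^bsub>M\<^esub>}\<rparr>) M (\<lambda>x\<in>{\<zero>\<^bsub>M\<^esub>}. x) \<in> F_Mono R (left_perp R \<S>) \<longleftrightarrow> M \<in> left_perp R \<S>"
proof
  note Mm = ModulesD[OF M]
  interpret M: abelian_group M using Mm by (rule left_module_imp_abelian_group)
  let ?S = "{\<zero>\<^bsub>M\<^esub>}"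
  let ?f = "Morphism (M\<lparr>carrier := ?S\<rparr>) M (\<lambda>x\<in>?S. x)"
  have S: "is_submodule R M ?S" by (simp add: is_submodule_def smult_zero[OF Mm])
  have L: "left_perp R \<S> \<subseteq> Modules R" by (auto simp: left_perp_def)
  show "?f \<in> F_Mono R (left_perp R \<S>)" if "M \<in> left_perp R \<S>"
    by (rule inclusion_in_F_Mono[OF M S L that lin_maps_id[OF Mm]]) auto
  assume "?f \<in> F_Mono R (left_perp R \<S>)"
  then obtain Q q where Q: "Q \<in> left_perp R \<S>" and q: "q \<in> lin_maps R M Q" "q ` carrier M = carrier Q"
    "\<forall>b\<in>carrier M. q b = \<zero>\<^bsub>Q\<^esub> \<longleftrightarrow> b \<in> ?S"
    unfolding mem_F_Mono_iff[OF inclusion_Morphisms[OF M S] L] by auto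
  have Qm: "left_module R Q" using Q L ModulesD by blast
  have "inj_on q (carrier M)" by (rule lin_maps_inj[OF Mm Qm q(1)]) (use q(3) in simp)
  then have "module_iso R M Q" using q(1,2) unfolding module_iso_def bij_betw_def by blast
  then show "M \<in> left_perp R \<S>" using left_perp_iso[OF \<S> M module_iso_sym[OF Mm Qm] Q] by blast
qed

theorem proposition2p7:
  fixes R :: "'r ring" and \<F> \<C> :: "('r, 'u) module set"
  assumes "strongly_inaccessible (UNIV :: 'u set)"
    and "ring R" and "carrier R \<prec> (UNIV :: 'u set)"
    and "cotorsion_theory R \<F> \<C>"
  shows "generated_by_set R \<F> \<C> \<longleftrightarrow> fibrantly_generated R (F_Mono R \<F>) (C_Epi R \<C>)"
proof
  note inacc = assms(1) and ring = assms(2) and small = assms(3) and ct = assms(4)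
  note \<C> = cotorsion_theoryD(1)[OF ct] and \<F> = cotorsion_theoryD(2)[OF ct]
  note sat = saturated_pair_cotorsion_theory[OF inacc ring small ct]
  {
    assume "generated_by_set R \<F> \<C>"
    then obtain \<S> where \<S>: "\<S> \<subseteq> Modules R" "\<S> \<prec> (UNIV :: 'u set)" "\<F> = left_perp R \<S>"
      unfolding generated_by_set_def by blast
    obtain \<T> :: "('r, 'u) morphism set" where \<T>: "\<S> \<prec> (UNIV :: 'u set) \<Longrightarrow> \<T> \<prec> (UNIV :: 'u set)"
      "\<T> \<subseteq> C_Epi R (right_perp R (left_perp R \<S>))" "left_box R \<T> \<subseteq> F_Mono R (left_perp R \<S>)"
      using test_maps_exist[OF inacc small ring \<S>(1)] by metis
    have T_sub: "\<T> \<subseteq> C_Epi R \<C>" using \<T>(2) \<S>(3) \<C> by simp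
    have "F_Mono R \<F> \<subseteq> left_box R \<T>"
      using F_Mono_lifts_against_C_Epi[OF ct] T_sub by (auto simp: left_box_def F_Mono_def)
    then have "F_Mono R \<F> = left_box R \<T>" using \<T>(3) \<S>(3) by auto
    moreover have "\<T> \<subseteq> Morphisms R" using T_sub by (auto simp: mem_C_Epi)
    ultimately show "fibrantly_generated R (F_Mono R \<F>) (C_Epi R \<C>)"
      unfolding fibrantly_generated_def using sat \<T>(1)[OF \<S>(2)] by blast
  }
  assume "fibrantly_generated R (F_Mono R \<F>) (C_Epi R \<C>)"
  then obtain \<T> where \<T>: "\<T> \<subseteq> Morphisms R" "\<T> \<prec> (UNIV :: 'u set)" "F_Mono R \<F> = left_box R \<T>"
    unfolding fibrantly_generated_def by blast
  have "\<T> \<subseteq> right_box R (F_Mono R \<F>)" unfolding \<T>(3) using \<T>(1) by (auto simp: right_box_def left_box_def)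
  moreover have "C_Epi R \<C> = right_box R (F_Mono R \<F>)"
    using sat unfolding saturated_pair_def by (rule conjunct1)
  ultimately have epi: "\<T> \<subseteq> C_Epi R \<C>" by (simp only:)
  let ?S = "kernel_module ` \<T>"
  have S\<C>: "?S \<subseteq> \<C>" using epi by (auto simp: mem_C_Epi)
  have S: "?S \<subseteq> Modules R" using \<T>(1) kernel_module_Modules by auto
  have small_S: "?S \<prec> (UNIV :: 'u set)" using \<T>(2) image_lepoll lesspoll_trans1 by blast
  have \<F>_sub: "\<F> \<subseteq> left_perp R ?S" using perp_antimono[OF S\<C>, of R] unfolding \<F> .
  have "left_perp R ?S \<subseteq> \<F>"
  proof
    fix M assume M: "M \<in> left_perp R ?S"
    then have MM: "M \<in> Modules R" by (simp add: left_perp_def)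
    let ?f = "Morphism (M\<lparr>carrier := {\<zero>\<^bsub>M\<^esub>}\<rparr>) M (\<lambda>x\<in>{\<zero>\<^bsub>M\<^esub>}. x)"
    have f: "?f \<in> F_Mono R (left_perp R ?S)" using zero_inclusion_in_F_Mono_iff[OF MM S] M by blast
    have "lifts_against R ?f g" if g: "g \<in> \<T>" for g
    proof (rule F_Mono_lifts_against[OF f])
      show "left_perp R ?S \<subseteq> Modules R" by (auto simp: left_perp_def)
      show "g \<in> Morphisms R" "Map g ` carrier (Dom g) = carrier (Cod g)"
        using subsetD[OF epi g] by (simp_all add: mem_C_Epi)
      show "trivial_group (Ext1 R Q (kernel_module g))" if "Q \<in> left_perp R ?S" for Q
        using that g by (auto simp: left_perp_def)
    qed
    then have "?f \<in> F_Mono R \<F>" unfolding \<T>(3) using f by (simp add: left_box_def F_Mono_def)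
    then show "M \<in> \<F>"
      using zero_inclusion_in_F_Mono_iff[OF MM cotorsion_theoryD(4)[OF ct]] \<F> by simp
  qed
  with \<F>_sub have "\<F> = left_perp R ?S" by (rule subset_antisym)
  then show "generated_by_set R \<F> \<C>"
    unfolding generated_by_set_def using ct S small_S by blast
qed

end
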